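(* Assume the following conditions. (C1) $\|\boldsymbol{\mu}\|^2/n=O(1)$. (C2) There exists a constant $\kappa_0>0$ such that $\lambda_{\min}(n^{-1}\mathbf{X}_{M_0+1}^{\top}\mathbf{X}_{M_0+1})\ge\kappa_0$ (for all $n$). (C3) There exist constants $0<c_1<c_2<\infty$ such that $\Pr(c_1\le\hat\sigma^2/\sigma^2\le c_2)\to1$. Say that asymptotic risk optimality holds if $R_n(\hat{\mathbf{w}})/\inf_{\mathbf{w}\in\mathcal{H}_n}R_n(\mathbf{w})\to_p1$, and that it does not hold if this ratio does not converge in probability to $1$. Then: (i) Consider $\phi_n\to\infty$. If $\phi_n^2(k_{M_0+1}-k_1)/(n\eta_n^2)\to0$, then the asymptotic risk optimality holds. (ii) Consider $\phi_n=2$. If $(k_{M_0+1}-k_1)/(n\eta_n^2)\to0$, then as long as $\sum_{m>M_0+1}\hat w_m^2\left(\frac{k_m}{k_{M_0+1}}-1\right)$ does not converge to $0$ in probability, the asymptotic risk optimality does not hold. If $k_{M_0+1}\to\infty$, $(k_{M_0+1}-k_1)/(n\eta_n^2)\to0$, and $k_{M_n}/k_{M_0+1}\to1$, then the asymptotic risk optimality holds.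
   Context: Model. For each sample size $n$, $y_i=\mu_i+e_i$, $\mu_i=\sum_{j=1}^{\infty}\beta_jx_{ij}$, $i=1,\dots,n$, with deterministic covariates $x_{ij}$, unknown coefficients $\beta_j$, and i.i.d. errors $e_i$ with $E(e_i)=0$, $E(e_i^2)=\sigma^2>0$, and $E|e_i|^{4+\zeta}<\infty$ for some $\zeta>0$. Write $\mathbf{y}=(y_1,\dots,y_n)^{\top}$, $\boldsymbol{\mu}=(\mu_1,\dots,\mu_n)^{\top}$, $\mathbf{e}=(e_1,\dots,e_n)^{\top}$, so $\mathbf{y}=\boldsymbol{\mu}+\mathbf{e}$. Candidate models. There are $M_n$ nested candidate models; the $m$th uses the first $k_m$ covariates, where $0<k_1<\cdots<k_{M_n}<n$ are integers. $\mathbf{X}_m$ is the $n\times k_m$ design matrix of the $m$th model, assumed of full column rank, and $\mathbf{P}_m=\mathbf{X}_m(\mathbf{X}_m^{\top}\mathbf{X}_m)^{-1}\mathbf{X}_m^{\top}$. True model. Let $\mathcal{A}_m=\{1,\dots,k_m\}$ and let $\mathcal{A}_m^c$ be its complement. There is an index $M_0$ with $M_0\ge1$ and $M_n>M_0+1$ such that $(\beta_j,\ j\in\mathcal{A}_{M_0+1}\cap\mathcal{A}_{M_0}^c)\ne\mathbf{0}$ and $\beta_j=0$ for all $j>k_{M_0+1}$. Thus models $1,\dots,M_0$ are under-fitted, model $M_0+1$ is the true model, and models $m>M_0+1$ are over-fitted. Put $\eta_n=\sum_{j\in\mathcal{A}_{M_0+1}\cap\mathcal{A}_{M_0}^c}\beta_j^2$.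 $M_n$, $M_0$, the $k_m$, and the $\beta_j$ may depend on $n$. All limits are as $n\to\infty$; $\to_p$ denotes convergence in probability. Averaging. $\mathcal{H}_n=\{\mathbf{w}\in[0,1]^{M_n}:\sum_{m=1}^{M_n}w_m=1\}$, $\mathbf{P}(\mathbf{w})=\sum_{m=1}^{M_n}w_m\mathbf{P}_m$, $\hat{\boldsymbol{\mu}}(\mathbf{w})=\mathbf{P}(\mathbf{w})\mathbf{y}$. The weight criterion is $\mathcal{G}_n(\mathbf{w})=\|\{\mathbf{I}_n-\mathbf{P}(\mathbf{w})\}\mathbf{y}\|^2+\phi_n\hat\sigma^2\mathbf{w}^{\top}\mathbf{K}$ with $\hat\sigma^2=(n-k_{M_n})^{-1}\mathbf{y}^{\top}(\mathbf{I}_n-\mathbf{P}_{M_n})\mathbf{y}$, $\mathbf{K}=(k_1,\dots,k_{M_n})^{\top}$, and penalty factor $\phi_n$ (possibly depending on $n$). The selected weight is $\hat{\mathbf{w}}=(\hat w_1,\dots,\hat w_{M_n})^{\top}=\arg\min_{\mathbf{w}\in\mathcal{H}_n}\mathcal{G}_n(\mathbf{w})$. The loss is $L_n(\mathbf{w})=\|\boldsymbol{\mu}-\hat{\boldsymbol{\mu}}(\mathbf{w})\|^2$ and the risk is the function $R_n(\mathbf{w})=E\{L_n(\mathbf{w})\}$ of a non-random $\mathbf{w}$; $R_n(\hat{\mathbf{w}})$ is this function evaluated at $\mathbf{w}=\hat{\mathbf{w}}$ (a random variable). $\lambda_{\min}$ denotes the minimum eigenvalue, $\|\cdot\|$ the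 Euclidean norm. *)

theory Defs
  imports
    "HOL-Probability.Probability"
    "HOL-Library.Landau_Symbols"
    "Jordan_Normal_Form.DL_Rank"
    "Jordan_Normal_Form.Gauss_Jordan_Elimination"
    "Jordan_Normal_Form.Spectral_Radius"
begin

text \<open>
  Observations, covariates and candidate models are numbered from 1; the entries of
  vectors and matrices of the matrix library are numbered from 0, hence the successors below.
  Throughout, \<open>n\<close> is the sample size, \<open>M\<close> the number of candidate models, \<open>k m\<close> the
  number of covariates of model \<open>m\<close>, and \<open>\<beta>\<close>, \<open>k\<close>, \<open>M\<close>, \<open>\<phi>\<close> are the values for that
  particular sample size.
\<close>

definition sq_norm2 :: "real vec \<Rightarrow> real" where
  "sq_norm2 v = scalar_prod v v"

definition mean_vec :: "(nat \<Rightarrow> nat \<Rightarrow> real) \<Rightarrow> (nat \<Rightarrow> real) \<Rightarrow> nat \<Rightarrow> real vec" where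
  "mean_vec x \<beta> n = vec n (\<lambda>i. \<Sum>j. \<beta> (Suc j) * x (Suc i) (Suc j))"

definition error_vec :: "(nat \<Rightarrow> 'a \<Rightarrow> real) \<Rightarrow> nat \<Rightarrow> 'a \<Rightarrow> real vec" where
  "error_vec e n \<omega> = vec n (\<lambda>i. e (Suc i) \<omega>)"

definition response_vec ::
    "(nat \<Rightarrow> nat \<Rightarrow> real) \<Rightarrow> (nat \<Rightarrow> real) \<Rightarrow> (nat \<Rightarrow> 'a \<Rightarrow> real) \<Rightarrow> nat \<Rightarrow> 'a \<Rightarrow> real vec" where
  "response_vec x \<beta> e n \<omega> = mean_vec x \<beta> n + error_vec e n \<omega>"

definition design :: "(nat \<Rightarrow> nat \<Rightarrow> real) \<Rightarrow> nat \<Rightarrow> nat \<Rightarrow> real mat" where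
  "design x n p = mat n p (\<lambda>(i, j). x (Suc i) (Suc j))"

text \<open>Only used for matrices of full column rank, where the inverse exists.\<close>

definition proj_mat :: "real mat \<Rightarrow> real mat" where
  "proj_mat X = X * the (mat_inverse (transpose_mat X * X)) * transpose_mat X"

text \<open>Only used for symmetric matrices of positive dimension, whose spectrum is finite and nonempty.\<close>

definition lambda_min :: "real mat \<Rightarrow> real" where
  "lambda_min A = Min (spectrum A)"

text \<open>Functions on \<open>{1..M}\<close> in the sense of extensional function spaces represent vectors of length \<open>M\<close>.\<close>

definition weights :: "nat \<Rightarrow> (nat \<Rightarrow> real) set" where
  "weights M = {w \<in> {1..M} \<rightarrow>\<^sub>E {0..1}. (\<Sum>m = 1..M. w m) = 1}"

text \<open>The weighted sum of the candidate projections, written entrywise because matrices of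
  varying dimension do not form an additive monoid as a type.\<close>

definition avg_mat ::
    "(nat \<Rightarrow> nat \<Rightarrow> real) \<Rightarrow> nat \<Rightarrow> nat \<Rightarrow> (nat \<Rightarrow> nat) \<Rightarrow> (nat \<Rightarrow> real) \<Rightarrow> real mat" where
  "avg_mat x n M k w =
     mat n n (\<lambda>(a, b). \<Sum>m = 1..M. w m * proj_mat (design x n (k m)) $$ (a, b))"

definition sigma2_hat :: "(nat \<Rightarrow> nat \<Rightarrow> real) \<Rightarrow> nat \<Rightarrow> nat \<Rightarrow> real vec \<Rightarrow> real" where
  "sigma2_hat x n p y =
     scalar_prod y ((1\<^sub>m n - proj_mat (design x n p)) *\<^sub>v y) / (real n - real p)"

definition weight_crit ::
    "(nat \<Rightarrow> nat \<Rightarrow> real) \<Rightarrow> nat \<Rightarrow> nat \<Rightarrow> (nat \<Rightarrow> nat) \<Rightarrow> real \<Rightarrow> real vec \<Rightarrow> (nat \<Rightarrow> real) \<Rightarrow> real" where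
  "weight_crit x n M k \<phi> y w =
     sq_norm2 ((1\<^sub>m n - avg_mat x n M k w) *\<^sub>v y)
     + \<phi> * sigma2_hat x n (k M) y * (\<Sum>m = 1..M. w m * real (k m))"

definition loss ::
    "(nat \<Rightarrow> nat \<Rightarrow> real) \<Rightarrow> (nat \<Rightarrow> real) \<Rightarrow> nat \<Rightarrow> nat \<Rightarrow> (nat \<Rightarrow> nat) \<Rightarrow> real vec \<Rightarrow> (nat \<Rightarrow> real) \<Rightarrow> real" where
  "loss x \<beta> n M k y w = sq_norm2 (mean_vec x \<beta> n - avg_mat x n M k w *\<^sub>v y)"

definition risk ::
    "'a measure \<Rightarrow> (nat \<Rightarrow> nat \<Rightarrow> real) \<Rightarrow> (nat \<Rightarrow> real) \<Rightarrow> (nat \<Rightarrow> 'a \<Rightarrow> real)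
      \<Rightarrow> nat \<Rightarrow> nat \<Rightarrow> (nat \<Rightarrow> nat) \<Rightarrow> (nat \<Rightarrow> real) \<Rightarrow> real" where
  "risk \<Omega> x \<beta> e n M k w = (\<integral>\<omega>. loss x \<beta> n M k (response_vec x \<beta> e n \<omega>) w \<partial>\<Omega>)"

definition converges_in_prob :: "'a measure \<Rightarrow> (nat \<Rightarrow> 'a \<Rightarrow> real) \<Rightarrow> real \<Rightarrow> bool" where
  "converges_in_prob \<Omega> Z c \<longleftrightarrow>
     (\<forall>\<epsilon>>0. (\<lambda>n. measure \<Omega> {\<omega> \<in> space \<Omega>. \<bar>Z n \<omega> - c\<bar> > \<epsilon>}) \<longlonglongrightarrow> 0)"

definition risk_optimal ::
    "'a measure \<Rightarrow> (nat \<Rightarrow> nat \<Rightarrow> real) \<Rightarrow> (nat \<Rightarrow> nat \<Rightarrow> real) \<Rightarrow> (nat \<Rightarrow> 'a \<Rightarrow> real)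
      \<Rightarrow> (nat \<Rightarrow> nat) \<Rightarrow> (nat \<Rightarrow> nat \<Rightarrow> nat) \<Rightarrow> (nat \<Rightarrow> 'a \<Rightarrow> nat \<Rightarrow> real) \<Rightarrow> bool" where
  "risk_optimal \<Omega> x \<beta> e M k w_hat \<longleftrightarrow>
     converges_in_prob \<Omega>
       (\<lambda>n \<omega>. risk \<Omega> x (\<beta> n) e n (M n) (k n) (w_hat n \<omega>)
               / (INF w\<in>weights (M n). risk \<Omega> x (\<beta> n) e n (M n) (k n) w)) 1"

definition eta :: "(nat \<Rightarrow> real) \<Rightarrow> (nat \<Rightarrow> nat) \<Rightarrow> nat \<Rightarrow> real" where
  "eta \<beta> k M0 = (\<Sum>j\<in>{1..k (M0 + 1)} - {1..k M0}. (\<beta> j)\<^sup>2)"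

end

theory Submission imports Defs begin

text \<open>
  Write \<open>k\<^sub>0 = 0\<close>, \<open>P\<^sub>0 = 0\<close>, and let \<open>g\<^sub>l\<close> be the tail weight \<open>w\<^sub>l + \<dots> + w\<^sub>M\<close>. Since the candidate models
  are nested, the differences \<open>P\<^sub>l - P\<^sub>l\<^sub>-\<^sub>1\<close> are mutually orthogonal projections of rank \<open>k\<^sub>l - k\<^sub>l\<^sub>-\<^sub>1\<close>, and
  \<open>P(w)\<close> is the sum of the \<open>g\<^sub>l (P\<^sub>l - P\<^sub>l\<^sub>-\<^sub>1)\<close>. Everything is therefore diagonal in the tail weights, which
  range over the nonincreasing sequences from 1 to 0. With \<open>\<theta>\<^sub>l = \<parallel>(P\<^sub>l - P\<^sub>l\<^sub>-\<^sub>1) \<mu>\<parallel>\<^sup>2\<close>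
  and \<open>Y\<^sub>l = \<parallel>(P\<^sub>l - P\<^sub>l\<^sub>-\<^sub>1) y\<parallel>\<^sup>2\<close>, the risk is
  \<open>\<Sum> (1 - g\<^sub>l)\<^sup>2 \<theta>\<^sub>l + \<sigma>\<^sup>2 \<Sum> g\<^sub>l\<^sup>2 (k\<^sub>l - k\<^sub>l\<^sub>-\<^sub>1)\<close> (\<open>risk_eq\<close>), and the criterion is, up to a term that does not
  depend on the weights, \<open>\<Sum> ((1 - g\<^sub>l)\<^sup>2 Y\<^sub>l + \<phi> \<sigma>\<^sub>h\<^sup>2 g\<^sub>l (k\<^sub>l - k\<^sub>l\<^sub>-\<^sub>1))\<close> with \<open>\<sigma>\<^sub>h\<^sup>2\<close> the variance
  estimate (\<open>weight_crit_eq\<close>).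

  Let \<open>T = M\<^sub>0 + 1\<close> be the index of the true model and \<open>D = k\<^sub>T - k\<^sub>1\<close>. The eigenvalue condition yields
  \<open>\<theta>\<^sub>T \<ge> n \<kappa> \<eta>\<close> (\<open>signal_lower_bound\<close>). As \<open>\<parallel>\<mu>\<parallel>\<^sup>2 = O(n)\<close>, this makes \<open>\<eta>\<close> bounded, so that the hypotheses
  with \<open>n \<eta>\<^sup>2\<close> imply \<open>\<phi>\<^sup>2 D / (n \<eta>) \<rightarrow> 0\<close> and \<open>D / (n \<eta>) \<rightarrow> 0\<close>. Since \<open>g\<^sub>l \<ge> g\<^sub>T\<close> for \<open>l \<le> T\<close>,
  the terms of the risk with \<open>l \<le> T\<close> alone are at least \<open>\<sigma>\<^sup>2 k\<^sub>T (1 - O(D / (n \<eta>)))\<close>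
  (\<open>risk_up_to_true_lower\<close>), while all weight on the true model has risk \<open>\<sigma>\<^sup>2 k\<^sub>T\<close>. Hence the infimum of the
  risk is equivalent to \<open>\<sigma>\<^sup>2 k\<^sub>T\<close>, and risk optimality holds as soon as the selected weights have bias
  \<open>\<Sum>\<^sub>l\<^sub>\<le>\<^sub>T (1 - g\<^sub>l)\<^sup>2 \<theta>\<^sub>l\<close> and excess variance \<open>\<Sum>\<^sub>l\<^sub>>\<^sub>T g\<^sub>l\<^sup>2 (k\<^sub>l - k\<^sub>l\<^sub>-\<^sub>1)\<close> of smaller order than \<open>k\<^sub>T\<close>
  in probability (\<open>risk_optimalI\<close>).

  For the bias, compare the selected weights with those that move the weight of the under-fitted models to
  the true one: optimality first gives \<open>1 - g\<^sub>T = O(\<phi> D / (n \<eta>))\<close> and then the bias bound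
  \<open>D \<cdot> O(\<phi>\<^sup>2 D / (n \<eta>))\<close> (\<open>underfit_bias_bound\<close>). For the excess variance when \<open>\<phi> \<rightarrow> \<infinity>\<close>, compare
  with the weights that move the weight of the over-fitted models to the true one. If
  \<open>\<phi> \<sigma>\<^sub>h\<^sup>2 (k\<^sub>m - k\<^sub>T)\<close> exceeds \<open>2 e\<^sup>T (P\<^sub>m - P\<^sub>T) e\<close> for all \<open>m > T\<close> simultaneously, then the over-fitted models
  get no weight (\<open>crit_min_no_overfit\<close>). This event has probability tending to 1: the quadratic forms are
  nondecreasing in \<open>m\<close> and have variance at most a multiple of \<open>k\<^sub>m - k\<^sub>T\<close> (\<open>quadratic_form_moments\<close>), so that
  Chebyshev's inequality at one index per dyadic block of dimensions suffices
  (\<open>monotone_process_maximal_inequality\<close>). For \<open>\<phi> = 2\<close> and \<open>k\<^sub>M / k\<^sub>T \<rightarrow> 1\<close> the excess variance is at most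
  \<open>k\<^sub>M - k\<^sub>T\<close>.

  Conversely, \<open>\<Sum>\<^sub>m\<^sub>>\<^sub>T w\<^sub>m\<^sup>2 (k\<^sub>m - k\<^sub>T)\<close> is at most the excess variance, hence \<open>\<sigma>\<^sup>2\<close> times it is at most the risk
  minus \<open>\<sigma>\<^sup>2 k\<^sub>T (1 - o(1))\<close>. Risk optimality thus forces the sum to be of smaller order than \<open>k\<^sub>T\<close> in
  probability (\<open>overfit_vanishes\<close>).
\<close>

section \<open>Quadratic forms and projections onto column spaces\<close>

unbundle no vec_syntax
hide_const (open) Determinants.det Determinants.trace
no_notation inner (infix "\<bullet>" 70)

text \<open>The quadratic form of a square matrix.\<close>

definition quad :: "real mat \<Rightarrow> real vec \<Rightarrow> real" where
  "quad A v = v \<bullet> (A *\<^sub>v v)"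

lemma sq_norm2_sum: "v \<in> carrier_vec n \<Longrightarrow> sq_norm2 v = (\<Sum>i<n. (v $ i)\<^sup>2)"
  by (auto simp: sq_norm2_def scalar_prod_def power2_eq_square atLeast0LessThan)

lemma sq_norm2_nonneg: "sq_norm2 v \<ge> 0"
  by (auto simp: sq_norm2_def scalar_prod_def intro!: sum_nonneg)

lemma sq_norm2_eq_0_iff:
  assumes "v \<in> carrier_vec n"
  shows "sq_norm2 v = 0 \<longleftrightarrow> v = 0\<^sub>v n"
proof
  assume "sq_norm2 v = 0"
  hence "\<forall>i\<in>{..<n}. (v $ i)\<^sup>2 = 0"
    unfolding sq_norm2_sum[OF assms] by (subst (asm) sum_nonneg_eq_0_iff) auto
  thus "v = 0\<^sub>v n" using assms by (intro eq_vecI) auto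
qed (auto simp: sq_norm2_def)

text \<open>Full column rank also rules out repeated columns, as needed for an argument by linear
  independence of the set of columns.\<close>

lemma full_rank_mult_vec_eq_0:
  fixes X :: "'f::field mat"
  assumes X: "X \<in> carrier_mat n p" and rk: "vec_space.rank n X = p"
    and v: "v \<in> carrier_vec p" and Xv: "X *\<^sub>v v = 0\<^sub>v n"
  shows "v = 0\<^sub>v p"
proof -
  interpret vec_space "TYPE('f)" n .
  obtain S where S: "maximal S (\<lambda>T. T \<subseteq> set (cols X) \<and> lin_indpt T)"
    using maximal_exists[of "(\<lambda>T. T \<subseteq> set (cols X) \<and> lin_indpt T)" "card (set (cols X))" "{}"]
    by (meson List.finite_set card_mono empty_iff empty_subsetI finite_lin_indpt2 rev_finite_subset)
  have "card S = p" using rank_card_indpt[OF X S] rk by simp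
  moreover have "S \<subseteq> set (cols X)" using S by (simp add: maximal_def)
  ultimately have "p \<le> card (set (cols X))" by (metis List.finite_set card_mono)
  moreover have "length (cols X) = p" using X by simp
  ultimately have dist: "distinct (cols X)"
    by (metis card_distinct card_length le_antisym)
  have indpt: "lin_indpt (set (cols X))" by (rule full_rank_lin_indpt[OF X rk dist])
  \<comment> \<open>Linear combinations are indexed by the columns themselves, so the entries of \<open>v\<close> become a function of the column.\<close>
  define a where "a c = v $ (THE i. i < p \<and> col X i = c)" for c
  have a: "a (col X i) = v $ i" if "i < p" for i
  proof -
    have "(THE j. j < p \<and> col X j = col X i) = i"
    proof (rule the_equality)
      fix j assume "j < p \<and> col X j = col X i"
      thus "j = i" using dist X that
        by (metis carrier_matD(2) cols_length cols_nth nth_eq_iff_index_eq)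
    qed (use that in auto)
    thus ?thesis by (simp add: a_def)
  qed
  have "Matrix.vec p (\<lambda>i. a (col X i)) = v" using v by (intro eq_vecI) (auto simp: a)
  hence "lincomb a (set (cols X)) = 0\<^sub>v n"
    using mat_mult_eq_lincomb[OF X dist, of a] Xv by simp
  hence "a c = 0" if "c \<in> set (cols X)" for c
    using indpt that unfolding lin_dep_def by (auto simp: module_vec_simps)
  hence "v $ i = 0" if "i < p" for i
    using a[OF that] that X by (metis carrier_matD(2) cols_length cols_nth nth_mem)
  thus ?thesis using v by (intro eq_vecI) auto
qed

lemma scalar_prod_transpose_mult:
  fixes A :: "real mat"
  assumes "A \<in> carrier_mat n p" "u \<in> carrier_vec n" "v \<in> carrier_vec p"
  shows "u \<bullet> (A *\<^sub>v v) = (transpose_mat A *\<^sub>v u) \<bullet> v"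
  using assms by (metis assoc_scalar_prod transpose_vec_mult_scalar comm_scalar_prod mult_mat_vec_carrier transpose_carrier_mat)

lemma quad_gram:
  assumes "X \<in> carrier_mat n p" "v \<in> carrier_vec p"
  shows "quad (transpose_mat X * X) v = sq_norm2 (X *\<^sub>v v)"
proof -
  have "quad (transpose_mat X * X) v = v \<bullet> (transpose_mat X *\<^sub>v (X *\<^sub>v v))"
    using assms by (simp add: quad_def assoc_mult_mat_vec[of _ p n _ p])
  also have "\<dots> = (X *\<^sub>v v) \<bullet> (X *\<^sub>v v)"
    using assms scalar_prod_transpose_mult[of "transpose_mat X" p n v "X *\<^sub>v v"] by simp
  finally show ?thesis by (simp add: sq_norm2_def)
qed

text \<open>For full column rank the Gram matrix is injective because \<open>v\<^sup>T X\<^sup>T X v = \<parallel>X v\<parallel>\<^sup>2\<close>, so the inverse in the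
  definition of the projection exists.\<close>

lemma gram_inverse:
  fixes X :: "real mat"
  assumes X: "X \<in> carrier_mat n p" and rk: "vec_space.rank n X = p"
  obtains B where "mat_inverse (transpose_mat X * X) = Some B" "B \<in> carrier_mat p p"
    "(transpose_mat X * X) * B = 1\<^sub>m p" "B * (transpose_mat X * X) = 1\<^sub>m p"
proof -
  let ?G = "transpose_mat X * X"
  have G: "?G \<in> carrier_mat p p" using X by simp
  have "Determinant.det ?G \<noteq> 0"
  proof
    assume "Determinant.det ?G = 0"
    then obtain v where v: "v \<in> carrier_vec p" "v \<noteq> 0\<^sub>v p" "?G *\<^sub>v v = 0\<^sub>v p"
      using det_0_iff_vec_prod_zero_field[OF G] by auto
    have "sq_norm2 (X *\<^sub>v v) = 0" using quad_gram[OF X v(1)] v by (simp add: quad_def)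
    hence "X *\<^sub>v v = 0\<^sub>v n" using X v by (subst (asm) sq_norm2_eq_0_iff[of _ n]) auto
    thus False using full_rank_mult_vec_eq_0[OF X rk v(1)] v(2) by simp
  qed
  hence "?G \<in> Units (ring_mat TYPE(real) p ())" by (rule det_non_zero_imp_unit[OF G])
  hence "mat_inverse ?G \<noteq> None" using mat_inverse(1)[OF G, where b="()"] by blast
  then obtain B where "mat_inverse ?G = Some B" by auto
  thus thesis using that mat_inverse(2)[OF G] by blast
qed

text \<open>The trace of a square matrix.\<close>

definition mat_trace :: "real mat \<Rightarrow> real" where
  "mat_trace A = (\<Sum>i<dim_row A. A $$ (i, i))"

lemma mat_trace_mult_comm:
  assumes "A \<in> carrier_mat n p" "B \<in> carrier_mat p n"
  shows "mat_trace (A * B) = mat_trace (B * A)"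
proof -
  have "mat_trace (A * B) = (\<Sum>i<n. \<Sum>j<p. A $$ (i,j) * B $$ (j,i))"
    using assms by (auto simp: mat_trace_def scalar_prod_def atLeast0LessThan intro!: sum.cong)
  also have "\<dots> = (\<Sum>j<p. \<Sum>i<n. B $$ (j,i) * A $$ (i,j))"
    by (subst sum.swap) (simp add: mult.commute)
  also have "\<dots> = mat_trace (B * A)"
    using assms by (auto simp: mat_trace_def scalar_prod_def atLeast0LessThan intro!: sum.cong)
  finally show ?thesis .
qed

lemma proj_mat_props:
  fixes X :: "real mat"
  assumes X: "X \<in> carrier_mat n p" and rk: "vec_space.rank n X = p"
  shows proj_mat_carrier: "proj_mat X \<in> carrier_mat n n"
    and proj_mat_symmetric: "transpose_mat (proj_mat X) = proj_mat X"
    and proj_mat_mult_self: "proj_mat X * X = X"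
    and proj_mat_factor: "\<exists>C\<in>carrier_mat p n. proj_mat X = X * C"
    and mat_trace_proj_mat: "mat_trace (proj_mat X) = real p"
proof -
  let ?Xt = "transpose_mat X"
  obtain B where B: "mat_inverse (?Xt * X) = Some B" "B \<in> carrier_mat p p"
      "(?Xt * X) * B = 1\<^sub>m p" "B * (?Xt * X) = 1\<^sub>m p"
    using gram_inverse[OF X rk] by blast
  have P: "proj_mat X = X * B * ?Xt" by (simp add: proj_mat_def B(1))
  have Xt: "?Xt \<in> carrier_mat p n" using X by simp
  show "proj_mat X \<in> carrier_mat n n" using P X B Xt by simp
  have Gt: "transpose_mat (?Xt * X) = ?Xt * X" using X by (simp add: transpose_mult[of _ p n _ p])
  have "transpose_mat B * (?Xt * X) = 1\<^sub>m p"
    using B X Gt transpose_mult[of "?Xt * X" p p B p] by simp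
  hence "(transpose_mat B * (?Xt * X)) * B = B" using B by simp
  moreover have "(transpose_mat B * (?Xt * X)) * B = transpose_mat B * ((?Xt * X) * B)"
    using B X by (intro assoc_mult_mat[of _ p p _ p _ p]) auto
  ultimately have Bt: "transpose_mat B = B" using B by simp
  have "transpose_mat (X * B * ?Xt) = X * (transpose_mat B * ?Xt)"
    using X B Xt by (simp only: transpose_mult[OF mult_carrier_mat[OF X B(2)] Xt] transpose_mult[OF X B(2)] transpose_transpose)
  also have "\<dots> = X * B * ?Xt" unfolding Bt using X B by (simp add: assoc_mult_mat[of _ n p _ p _ n])
  finally show "transpose_mat (proj_mat X) = proj_mat X" by (simp add: P)
  have "X * B * ?Xt * X = X * (B * (?Xt * X))"
    using X B by (simp add: assoc_mult_mat[of _ n p _ p _ n] assoc_mult_mat[of _ n p _ n _ p] assoc_mult_mat[of _ p p _ n _ p])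
  thus "proj_mat X * X = X" using B X by (simp add: P)
  have PX: "proj_mat X = X * (B * ?Xt)" using P X B by (simp add: assoc_mult_mat[of _ n p _ p _ n])
  thus "\<exists>C\<in>carrier_mat p n. proj_mat X = X * C" using B Xt by (intro bexI[of _ "B * ?Xt"]) auto
  have "mat_trace (proj_mat X) = mat_trace (B * ?Xt * X)"
    unfolding PX using X B by (intro mat_trace_mult_comm[of _ n p]) auto
  also have "B * ?Xt * X = B * (?Xt * X)" using X B by (intro assoc_mult_mat[of _ p p _ n _ p]) auto
  finally show "mat_trace (proj_mat X) = real p" using B(4) by (simp add: mat_trace_def)
qed

text \<open>If the columns of \<open>Y\<close> lie in the column space of \<open>X\<close>, then projecting onto the latter fixes the
  range of the former.\<close>

lemma mult_proj_mat_nested: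
  fixes X Y :: "real mat"
  assumes X: "X \<in> carrier_mat n p" "vec_space.rank n X = p"
    and Y: "Y \<in> carrier_mat n r" "vec_space.rank n Y = r"
    and E: "E \<in> carrier_mat p r" "Y = X * E"
  shows "proj_mat X * proj_mat Y = proj_mat Y"
proof -
  note PX = proj_mat_props[OF X] and PY = proj_mat_props[OF Y]
  obtain C where C: "C \<in> carrier_mat r n" "proj_mat Y = Y * C" using PY(4) by blast
  have "proj_mat X * Y = proj_mat X * X * E"
    using X E PX(1) by (simp add: assoc_mult_mat[of _ n n _ p _ r])
  hence "proj_mat X * Y = Y" using PX(3) E by simp
  moreover have "proj_mat X * proj_mat Y = proj_mat X * Y * C"
    using C Y PX(1) by (simp add: assoc_mult_mat[of _ n n _ r _ n])
  ultimately show ?thesis using C by simp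
qed

lemma design_prefix:
  assumes "r \<le> p"
  shows "design x n r = design x n p * mat p r (\<lambda>(i, j). if i = j then 1 else 0)"
proof (rule eq_matI)
  fix i j
  assume "i < dim_row (design x n p * mat p r (\<lambda>(i, j). if i = j then 1 else 0))"
    and "j < dim_col (design x n p * mat p r (\<lambda>(i, j). if i = j then 1 else 0))"
  hence ij: "i < n" "j < r" by (auto simp: design_def)
  have "(\<Sum>l\<in>{0..<p}. x (Suc i) (Suc l) * (if l = j then 1 else 0)) = x (Suc i) (Suc j)"
    using ij assms by (subst sum.mono_neutral_right[of _ "{j}"]) auto
  thus "design x n r $$ (i, j) = (design x n p * mat p r (\<lambda>(i, j). if i = j then 1 else 0)) $$ (i, j)"
    using ij by (simp add: design_def scalar_prod_def)
qed (auto simp: design_def)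

section \<open>The smallest eigenvalue and the Rayleigh quotient\<close>

lemma sq_norm2_mult_bound:
  fixes A :: "real mat"
  assumes A: "A \<in> carrier_mat n p"
  obtains C where "C > 0" "\<And>v. v \<in> carrier_vec p \<Longrightarrow> sq_norm2 (A *\<^sub>v v) \<le> C * sq_norm2 v"
proof -
  define C where "C = (\<Sum>i<n. \<Sum>j<p. (A $$ (i, j))\<^sup>2) + 1"
  have "sq_norm2 (A *\<^sub>v v) \<le> C * sq_norm2 v" if v: "v \<in> carrier_vec p" for v
  proof -
    have "sq_norm2 (A *\<^sub>v v) = (\<Sum>i<n. (\<Sum>j<p. A $$ (i, j) * v $ j)\<^sup>2)"
      using A v by (subst sq_norm2_sum[of _ n]) (auto simp: scalar_prod_def atLeast0LessThan intro!: sum.cong)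
    also have "\<dots> \<le> (\<Sum>i<n. (\<Sum>j<p. (A $$ (i, j))\<^sup>2) * (\<Sum>j<p. (v $ j)\<^sup>2))"
      by (intro sum_mono Cauchy_Schwarz_ineq_sum)
    also have "\<dots> = (C - 1) * sq_norm2 v"
      by (simp add: sum_distrib_right C_def sq_norm2_sum[OF v])
    also have "\<dots> \<le> C * sq_norm2 v" using sq_norm2_nonneg[of v] by (simp add: algebra_simps)
    finally show ?thesis .
  qed
  moreover have "C > 0" unfolding C_def by (intro add_nonneg_pos sum_nonneg) auto
  ultimately show thesis using that by blast
qed

lemma sq_norm2_add:
  assumes "u \<in> carrier_vec n" "v \<in> carrier_vec n"
  shows "sq_norm2 (u + v) = sq_norm2 u + 2 * (u \<bullet> v) + sq_norm2 v"
  using assms by (simp add: sq_norm2_def add_scalar_prod_distrib[of _ n] scalar_prod_add_distrib[of _ n] comm_scalar_prod[of v n u])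

lemma sq_norm2_diff:
  assumes "u \<in> carrier_vec n" "v \<in> carrier_vec n"
  shows "sq_norm2 (u - v) = sq_norm2 u - 2 * (u \<bullet> v) + sq_norm2 v"
  using assms by (simp add: sq_norm2_def minus_scalar_prod_distrib[of _ n] scalar_prod_minus_distrib[of _ n] comm_scalar_prod[of v n u])

lemma sq_norm2_smult: "sq_norm2 (c \<cdot>\<^sub>v v) = c\<^sup>2 * sq_norm2 v"
  by (simp add: sq_norm2_def power2_eq_square)

lemma quad_smult:
  assumes "A \<in> carrier_mat n n" "v \<in> carrier_vec n"
  shows "quad A (c \<cdot>\<^sub>v v) = c\<^sup>2 * quad A v"
  using assms by (simp add: quad_def mult_mat_vec[of _ n n] power2_eq_square)

lemma smult_mat_mat_vec:
  fixes A :: "real mat"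
  assumes "A \<in> carrier_mat n p" "v \<in> carrier_vec p"
  shows "(c \<cdot>\<^sub>m A) *\<^sub>v v = c \<cdot>\<^sub>v (A *\<^sub>v v)"
  using assms by (intro eq_vecI) (auto simp: scalar_prod_def sum_distrib_left mult.assoc)

text \<open>The Rayleigh bound for real symmetric matrices. The infimum \<open>m\<close> of the form over unit vectors is an
  eigenvalue: otherwise \<open>B = A - m I\<close> would be invertible, and since \<open>B\<close> is positive semidefinite,
  \<open>u\<^sup>T B u\<close> is at least a multiple of \<open>\<parallel>B u\<parallel>\<^sup>2\<close>, hence of \<open>\<parallel>u\<parallel>\<^sup>2\<close>, which keeps the form away from \<open>m\<close>.\<close>

lemma lambda_min_le_quad:
  fixes A :: "real mat"
  assumes A: "A \<in> carrier_mat n n" and sym: "transpose_mat A = A" and v: "v \<in> carrier_vec n"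
  shows "lambda_min A * sq_norm2 v \<le> quad A v"
proof -
  define U where "U = {u \<in> carrier_vec n. sq_norm2 u = 1}"
  define m where "m = Inf (quad A ` U)"
  obtain CA where CA: "CA > 0" "\<And>u. u \<in> carrier_vec n \<Longrightarrow> sq_norm2 (A *\<^sub>v u) \<le> CA * sq_norm2 u"
    using sq_norm2_mult_bound[OF A] by blast
  have lower: "quad A u \<ge> - (1 + CA) * sq_norm2 u" if u: "u \<in> carrier_vec n" for u
  proof -
    have "0 \<le> sq_norm2 (u + A *\<^sub>v u)" by (rule sq_norm2_nonneg)
    hence "0 \<le> sq_norm2 u + 2 * quad A u + sq_norm2 (A *\<^sub>v u)"
      using A u by (simp add: sq_norm2_add[of _ n] quad_def)
    thus ?thesis using CA(2)[OF u] CA(1) sq_norm2_nonneg[of u]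
      by (smt (verit) left_diff_distrib mult_nonneg_nonneg mult_minus_left mult_cancel_right1 distrib_right)
  qed
  have bdd: "bdd_below (quad A ` U)"
    using lower unfolding bdd_below_def U_def by (intro exI[of _ "- (1 + CA)"]) force
  have unit: "c * sq_norm2 u \<le> quad A u" if c: "\<And>u. u \<in> U \<Longrightarrow> c \<le> quad A u" and u: "u \<in> carrier_vec n" for c u
  proof (cases "sq_norm2 u = 0")
    case True
    hence "u = 0\<^sub>v n" using sq_norm2_eq_0_iff[OF u] by simp
    thus ?thesis using True A by (simp add: quad_def)
  next
    case False
    hence pos: "sq_norm2 u > 0" using sq_norm2_nonneg[of u] by simp
    let ?r = "1 / sqrt (sq_norm2 u)"
    have "?r\<^sup>2 = 1 / sq_norm2 u" using pos by (simp add: power_divide)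
    hence "?r \<cdot>\<^sub>v u \<in> U" using u pos by (simp add: U_def sq_norm2_smult)
    hence "c \<le> ?r\<^sup>2 * quad A u" using c quad_smult[OF A u] by metis
    thus ?thesis using \<open>?r\<^sup>2 = 1 / sq_norm2 u\<close> pos by (simp add: field_simps)
  qed
  have m: "m \<le> quad A u" if "u \<in> U" for u
    unfolding m_def using that bdd by (intro cInf_lower) auto
  show ?thesis
  proof (cases "U = {}")
    case True
    thus ?thesis using unit[of "lambda_min A" v] v by simp
  next
    case ne: False
    define B where "B = A - m \<cdot>\<^sub>m 1\<^sub>m n"
    have B: "B \<in> carrier_mat n n" unfolding B_def using A by (intro minus_carrier_mat) auto
    have Bv: "B *\<^sub>v u = A *\<^sub>v u - m \<cdot>\<^sub>v u" if u: "u \<in> carrier_vec n" for u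
      using A u by (simp add: B_def minus_mult_distrib_mat_vec[of _ n n] smult_mat_mat_vec[of _ n n])
    have Bsym: "transpose_mat B = B"
    proof (rule eq_matI)
      fix i j assume "i < dim_row B" "j < dim_col B"
      hence ij: "i < n" "j < n" using B by auto
      have "A $$ (j, i) = A $$ (i, j)" using sym ij A by (metis carrier_matD index_transpose_mat(1))
      thus "transpose_mat B $$ (i, j) = B $$ (i, j)" using ij A by (simp add: B_def)
    qed (use B in auto)
    have qB: "quad B u = quad A u - m * sq_norm2 u" if u: "u \<in> carrier_vec n" for u
      using A u by (simp add: quad_def Bv scalar_prod_minus_distrib[of _ n] sq_norm2_def)
    have qB0: "quad B u \<ge> 0" if u: "u \<in> carrier_vec n" for u
      using unit[of m u] m u qB[OF u] by simp
    have "eigenvalue A m"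
    proof (rule ccontr)
      assume nev: "\<not> eigenvalue A m"
      have "Determinant.det B \<noteq> 0"
      proof
        assume "Determinant.det B = 0"
        then obtain u where u: "u \<in> carrier_vec n" "u \<noteq> 0\<^sub>v n" "B *\<^sub>v u = 0\<^sub>v n"
          using det_0_iff_vec_prod_zero_field[OF B] by auto
        have "A *\<^sub>v u = m \<cdot>\<^sub>v u"
        proof (rule eq_vecI)
          fix i assume "i < dim_vec (m \<cdot>\<^sub>v u)"
          hence i: "i < n" using u by simp
          have "(A *\<^sub>v u - m \<cdot>\<^sub>v u) $ i = 0" using u(3) Bv[OF u(1)] i by simp
          thus "(A *\<^sub>v u) $ i = (m \<cdot>\<^sub>v u) $ i" using i u A by simp
        qed (use u A in auto)
        thus False using nev u A by (auto simp: eigenvalue_def eigenvector_def)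
      qed
      hence "B \<in> Units (ring_mat TYPE(real) n ())" by (rule det_non_zero_imp_unit[OF B])
      then obtain B' where B': "B' \<in> carrier_mat n n" "B' * B = 1\<^sub>m n"
        unfolding Units_def ring_mat_def by auto
      obtain C where C: "C > 0" "\<And>u. u \<in> carrier_vec n \<Longrightarrow> sq_norm2 (B *\<^sub>v u) \<le> C * sq_norm2 u"
        using sq_norm2_mult_bound[OF B] by blast
      obtain C' where C': "C' > 0" "\<And>u. u \<in> carrier_vec n \<Longrightarrow> sq_norm2 (B' *\<^sub>v u) \<le> C' * sq_norm2 u"
        using sq_norm2_mult_bound[OF B'(1)] by blast
      have gap: "quad A u \<ge> m + 1 / ((1 + C) * C')" if u: "u \<in> U" for u
      proof -
        have uc: "u \<in> carrier_vec n" "sq_norm2 u = 1" using u by (auto simp: U_def)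
        define w where "w = B *\<^sub>v u"
        have w: "w \<in> carrier_vec n" using B uc by (simp add: w_def)
        have "u = B' *\<^sub>v w" using B B' uc by (simp add: w_def assoc_mult_mat_vec[of _ n n _ n, symmetric])
        hence w1: "1 \<le> C' * sq_norm2 w" using C'(2)[OF w] uc by simp
        have "2 * quad B w \<le> (1 + C) * sq_norm2 w"
        proof -
          have "0 \<le> sq_norm2 (w - B *\<^sub>v w)" by (rule sq_norm2_nonneg)
          hence "2 * quad B w \<le> sq_norm2 w + sq_norm2 (B *\<^sub>v w)"
            using B w by (simp add: sq_norm2_diff[of _ n] quad_def)
          thus ?thesis using C(2)[OF w] by (simp add: field_simps)
        qed
        hence qw: "quad B w \<le> (1 + C) * sq_norm2 w"
          using mult_nonneg_nonneg[of "1 + C" "sq_norm2 w"] C(1) sq_norm2_nonneg[of w] by linarith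
        \<comment> \<open>Evaluate the nonnegative form at \<open>u + t B u\<close>, with \<open>t\<close> minimizing the resulting upper bound.\<close>
        define t where "t = - 1 / (1 + C)"
        have Bw: "B *\<^sub>v w \<in> carrier_vec n" using B w by simp
        have uBw: "u \<bullet> (B *\<^sub>v w) = sq_norm2 w"
          using scalar_prod_transpose_mult[OF B uc(1) w] Bsym by (simp add: w_def sq_norm2_def)
        have "0 \<le> quad B (u + t \<cdot>\<^sub>v w)" using uc w by (intro qB0) simp
        also have "quad B (u + t \<cdot>\<^sub>v w) = quad B u + 2 * t * sq_norm2 w + t\<^sup>2 * quad B w"
        proof -
          have "B *\<^sub>v (u + t \<cdot>\<^sub>v w) = w + t \<cdot>\<^sub>v (B *\<^sub>v w)"
            using B uc w by (simp add: mult_add_distrib_mat_vec[of _ n n] mult_mat_vec[of _ n n] w_def)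
          moreover have "w \<bullet> w = sq_norm2 w" by (simp add: sq_norm2_def)
          ultimately show ?thesis using uc w Bw uBw
            by (simp add: quad_def add_scalar_prod_distrib[of _ n] scalar_prod_add_distrib[of _ n]
                w_def[symmetric] power2_eq_square algebra_simps)
        qed
        also have "\<dots> \<le> quad B u + 2 * t * sq_norm2 w + t\<^sup>2 * ((1 + C) * sq_norm2 w)"
          using qw by (intro add_left_mono mult_left_mono) auto
        also have "t\<^sup>2 * ((1 + C) * sq_norm2 w) = (t * (1 + C)) * t * sq_norm2 w"
          by (simp only: power2_eq_square mult_ac)
        also have "t * (1 + C) = - 1" using C(1) by (simp add: t_def)
        finally have "quad B u \<ge> - t * sq_norm2 w" by simp
        also have "- t * sq_norm2 w = sq_norm2 w / (1 + C)" by (simp add: t_def)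
        finally have "quad B u \<ge> sq_norm2 w / (1 + C)" .
        moreover have "sq_norm2 w / (1 + C) \<ge> (1 / C') / (1 + C)"
          using w1 C(1) C'(1) by (intro divide_right_mono) (auto simp: field_simps)
        ultimately show ?thesis using qB[OF uc(1)] uc(2) by (simp add: field_simps)
      qed
      have "m + 1 / ((1 + C) * C') \<le> m" unfolding m_def
        by (rule cInf_greatest) (use ne gap in \<open>auto simp: m_def\<close>)
      moreover have "(1 + C) * C' > 0" using C(1) C'(1) by (intro mult_pos_pos) auto
      ultimately show False by simp
    qed
    hence "m \<in> spectrum A" by (simp add: spectrum_def)
    hence "lambda_min A \<le> m" unfolding lambda_min_def
      using card_finite_spectrum(1)[OF A] by simp
    hence "lambda_min A * sq_norm2 v \<le> m * sq_norm2 v"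
      using sq_norm2_nonneg by (rule mult_right_mono)
    also have "\<dots> \<le> quad A v" using unit[of m v] m v by simp
    finally show ?thesis .
  qed
qed

section \<open>Tail weights\<close>

text \<open>The tail weight \<open>g\<^sub>l = w\<^sub>l + \<dots> + w\<^sub>M\<close>.\<close>

definition tail_weight :: "nat \<Rightarrow> (nat \<Rightarrow> real) \<Rightarrow> nat \<Rightarrow> real" where
  "tail_weight M w l = (\<Sum>m = l..M. w m)"

text \<open>The sequences of tail weights of weight vectors, characterized intrinsically: nonincreasing on
  \<open>{1..M + 1}\<close>, from 1 to 0. Values outside of that range are irrelevant.\<close>

definition tail_seq :: "nat \<Rightarrow> (nat \<Rightarrow> real) \<Rightarrow> bool" where
  "tail_seq M g \<longleftrightarrow> g 1 = 1 \<and> g (Suc M) = 0 \<and> (\<forall>l\<in>{1..M}. g (Suc l) \<le> g l)"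

lemma tail_weight_Suc: "l \<le> M \<Longrightarrow> tail_weight M w l = w l + tail_weight M w (Suc l)"
  unfolding tail_weight_def by (rule sum.atLeast_Suc_atMost)

lemma tail_seq_tail_weight:
  assumes "w \<in> weights M"
  shows "tail_seq M (tail_weight M w)"
  using assms by (auto simp: tail_seq_def weights_def tail_weight_Suc PiE_iff) (auto simp: tail_weight_def)

lemma tail_seq_antimono:
  assumes "tail_seq M g" "1 \<le> l" "l \<le> l'" "l' \<le> Suc M"
  shows "g l' \<le> g l"
  using assms(3,4)
proof (induction l' rule: dec_induct)
  case (step j)
  thus ?case using assms(1,2) unfolding tail_seq_def by (smt (verit) Suc_le_mono atLeastAtMost_iff le_SucI le_trans)
qed simp

lemma tail_seq_bounds:
  assumes "tail_seq M g" "1 \<le> l" "l \<le> Suc M"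
  shows "0 \<le> g l" "g l \<le> 1"
  using tail_seq_antimono[OF assms(1), of l "Suc M"] tail_seq_antimono[OF assms(1), of 1 l] assms
  by (auto simp: tail_seq_def)

lemma tail_seq_obtain_weights:
  assumes "tail_seq M g"
  obtains w where "w \<in> weights M" "\<And>l. l \<in> {1..M} \<Longrightarrow> tail_weight M w l = g l"
proof -
  define w where "w = (\<lambda>m\<in>{1..M}. g m - g (Suc m))"
  have tl: "tail_weight M w l = g l" if "1 \<le> l" "l \<le> Suc M" for l
    using that(2,1)
  proof (induction l rule: inc_induct)
    case base
    thus ?case using assms by (simp add: tail_weight_def tail_seq_def)
  next
    case (step j)
    moreover have "w j = g j - g (Suc j)" using step by (simp add: w_def)
    ultimately show ?case by (simp add: tail_weight_Suc)
  qed
  have "(\<Sum>m = 1..M. w m) = 1"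
    using tl[of 1] assms by (simp add: tail_weight_def tail_seq_def)
  moreover have "w \<in> {1..M} \<rightarrow>\<^sub>E {0..1}"
  proof (rule PiE_I)
    fix m assume "m \<in> {1..M}"
    thus "w m \<in> {0..1}"
      using tail_seq_bounds[OF assms, of m] tail_seq_bounds[OF assms, of "Suc m"]
        tail_seq_antimono[OF assms, of m "Suc m"] by (auto simp: w_def)
  qed (auto simp: w_def)
  ultimately have "w \<in> weights M" by (simp add: weights_def)
  thus thesis using tl that by auto
qed

lemma sum_telescope_from_0:
  fixes a :: "nat \<Rightarrow> real"
  assumes "a 0 = 0"
  shows "(\<Sum>l = 1..m. a l - a (l - 1)) = a m"
  using assms by (induction m) auto

lemma sum_telescope_range:
  fixes a :: "nat \<Rightarrow> real"
  assumes "r \<le> m"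
  shows "(\<Sum>l = Suc r..m. a l - a (l - 1)) = a m - a r"
  using assms by (induction m rule: dec_induct) auto

text \<open>Summation by parts.\<close>

lemma sum_weights_Abel:
  fixes a w :: "nat \<Rightarrow> real"
  assumes "a 0 = 0"
  shows "(\<Sum>m = 1..M. w m * a m) = (\<Sum>l = 1..M. tail_weight M w l * (a l - a (l - 1)))"
proof -
  have "(\<Sum>m = 1..M. w m * a m) = (\<Sum>m = 1..M. \<Sum>l = 1..m. w m * (a l - a (l - 1)))"
    by (simp only: sum_distrib_left[symmetric] sum_telescope_from_0[of a, OF assms])
  also have "\<dots> = (\<Sum>m = 1..M. \<Sum>l = 1..M. if l \<le> m then w m * (a l - a (l - 1)) else 0)"
    by (intro sum.cong refl sum.mono_neutral_cong_left) auto
  also have "\<dots> = (\<Sum>l = 1..M. \<Sum>m = 1..M. if l \<le> m then w m * (a l - a (l - 1)) else 0)"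
    by (rule sum.swap)
  also have "\<dots> = (\<Sum>l = 1..M. \<Sum>m = l..M. w m * (a l - a (l - 1)))"
    by (intro sum.cong refl sum.mono_neutral_cong_right) auto
  finally show ?thesis by (simp add: tail_weight_def sum_distrib_right)
qed

text \<open>The double sum that arises from products of nested projections, since \<open>P\<^sub>m P\<^sub>j\<close> is the projection
  with index \<open>min m j\<close>.\<close>

lemma sum_weights_min:
  fixes a w :: "nat \<Rightarrow> real"
  assumes "a 0 = 0"
  shows "(\<Sum>m = 1..M. w m * (\<Sum>j = 1..M. w j * a (min m j)))
    = (\<Sum>l = 1..M. (tail_weight M w l)\<^sup>2 * (a l - a (l - 1)))"
proof -
  define b where "b m = (\<Sum>j = 1..M. w j * a (min m j))" for m
  have b0: "b 0 = 0" by (simp add: b_def assms)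
  have "b l - b (l - 1) = tail_weight M w l * (a l - a (l - 1))" if l: "l \<in> {1..M}" for l
  proof -
    have "b l - b (l - 1) = (\<Sum>j = 1..M. w j * (a (min l j) - a (min (l - 1) j)))"
      unfolding b_def sum_subtractf[symmetric] by (intro sum.cong refl) (simp add: right_diff_distrib)
    also have "\<dots> = (\<Sum>j = l..M. w j * (a l - a (l - 1)))"
    proof (rule sum.mono_neutral_cong_right)
      show "\<forall>j\<in>{1..M} - {l..M}. w j * (a (min l j) - a (min (l - 1) j)) = 0"
      proof
        fix j assume "j \<in> {1..M} - {l..M}"
        hence "min l j = j" "min (l - 1) j = j" by auto
        thus "w j * (a (min l j) - a (min (l - 1) j)) = 0" by simp
      qed
    next
      fix j assume "j \<in> {l..M}"
      hence "min l j = l" "min (l - 1) j = l - 1" by auto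
      thus "w j * (a (min l j) - a (min (l - 1) j)) = w j * (a l - a (l - 1))" by simp
    qed (use l in auto)
    finally show ?thesis by (simp add: tail_weight_def sum_distrib_right)
  qed
  hence "(\<Sum>m = 1..M. w m * b m) = (\<Sum>l = 1..M. tail_weight M w l * (tail_weight M w l * (a l - a (l - 1))))"
    unfolding sum_weights_Abel[of b, OF b0] by (intro sum.cong) auto
  thus ?thesis by (simp add: b_def power2_eq_square mult.assoc)
qed

lemma tail_weight_sq_ge:
  assumes "w \<in> weights M" "1 \<le> l"
  shows "(\<Sum>m = l..M. (w m)\<^sup>2) \<le> (tail_weight M w l)\<^sup>2"
proof -
  have w0: "w m \<ge> 0" if "m \<in> {l..M}" for m using assms that by (auto simp: weights_def PiE_iff)
  have "w m \<le> tail_weight M w l" if "m \<in> {l..M}" for m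
    unfolding tail_weight_def using that w0 by (intro member_le_sum) auto
  hence "(\<Sum>m = l..M. (w m)\<^sup>2) \<le> (\<Sum>m = l..M. w m * tail_weight M w l)"
    using w0 by (intro sum_mono) (auto simp: power2_eq_square intro!: mult_left_mono)
  also have "\<dots> = (tail_weight M w l)\<^sup>2"
    by (simp add: sum_distrib_right[symmetric] power2_eq_square tail_weight_def)
  finally show ?thesis .
qed

section \<open>The criterion and the risk in terms of tail weights\<close>

text \<open>The weight criterion as a function of the tail weights \<open>g\<close>, up to a summand independent of \<open>g\<close>:
  \<open>d l\<close> is the dimension added by model \<open>l\<close>, \<open>Y l\<close> the energy of the response in the added directions, and
  \<open>\<nu>\<close> the penalty factor times the variance estimate.\<close>

definition tail_crit :: "nat \<Rightarrow> real \<Rightarrow> (nat \<Rightarrow> real) \<Rightarrow> (nat \<Rightarrow> real) \<Rightarrow> (nat \<Rightarrow> real) \<Rightarrow> real" where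
  "tail_crit M \<nu> d Y g = (\<Sum>l = 1..M. (1 - g l)\<^sup>2 * Y l + \<nu> * g l * d l)"

lemma sum_split_first_middle:
  fixes f :: "nat \<Rightarrow> real"
  assumes "1 \<le> T" "T \<le> M"
  shows "(\<Sum>l = 1..M. f l) = f 1 + (\<Sum>l = 2..T. f l) + (\<Sum>l = Suc T..M. f l)"
proof -
  have "{1..M} = {1} \<union> {2..T} \<union> {Suc T..M}" using assms by auto
  thus ?thesis using assms by (simp add: sum.union_disjoint)
qed

text \<open>Comparison with the weights that move everything before \<open>T\<close> to \<open>T\<close>.\<close>

lemma crit_min_underfit:
  assumes opt: "\<And>h. tail_seq M h \<Longrightarrow> tail_crit M \<nu> d Y g \<le> tail_crit M \<nu> d Y h"
    and g: "tail_seq M g" and T: "2 \<le> T" "T \<le> M" and l0: "\<nu> \<ge> 0" and d: "\<And>l. l \<in> {1..M} \<Longrightarrow> d l \<ge> 0"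
  shows "(\<Sum>l = 2..T. (1 - g l)\<^sup>2 * Y l) \<le> \<nu> * (1 - g T) * (\<Sum>l = 2..T. d l)"
proof -
  define h where "h l = (if l \<le> T then 1 else g l)" for l
  have "tail_seq M h"
    using g T tail_seq_bounds(2)[OF g] by (auto simp: tail_seq_def h_def)
  from opt[OF this] have "(\<Sum>l = 2..T. (1 - g l)\<^sup>2 * Y l + \<nu> * g l * d l) \<le> (\<Sum>l = 2..T. \<nu> * d l)"
    unfolding tail_crit_def using g T
    by (subst (asm) (1 2) sum_split_first_middle[where T=T]) (auto simp: h_def tail_seq_def)
  hence "(\<Sum>l = 2..T. (1 - g l)\<^sup>2 * Y l) \<le> (\<Sum>l = 2..T. \<nu> * (1 - g l) * d l)"
    by (simp add: sum.distrib algebra_simps sum_subtractf)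
  also have "\<dots> \<le> (\<Sum>l = 2..T. \<nu> * (1 - g T) * d l)"
    using tail_seq_antimono[OF g] T l0 d by (intro sum_mono mult_right_mono mult_left_mono) auto
  finally show ?thesis by (simp add: sum_distrib_left)
qed

text \<open>Comparison with the weights that move everything after \<open>T\<close> to \<open>T\<close>.\<close>

lemma crit_min_overfit:
  assumes opt: "\<And>h. tail_seq M h \<Longrightarrow> tail_crit M \<nu> d Y g \<le> tail_crit M \<nu> d Y h"
    and g: "tail_seq M g" and T: "1 \<le> T" "T \<le> M" and Y: "\<And>l. l \<in> {1..M} \<Longrightarrow> Y l \<ge> 0"
  shows "(\<Sum>l = Suc T..M. g l * (\<nu> * d l - 2 * Y l)) \<le> 0"
proof -
  define h where "h l = (if l \<le> T then g l else 0)" for l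
  have "tail_seq M h"
    using g T tail_seq_bounds(1)[OF g] by (auto simp: tail_seq_def h_def)
  from opt[OF this] have "(\<Sum>l = Suc T..M. (1 - g l)\<^sup>2 * Y l + \<nu> * g l * d l) \<le> (\<Sum>l = Suc T..M. Y l)"
    unfolding tail_crit_def using g T
    by (subst (asm) (1 2) sum_split_first_middle[where T=T]) (auto simp: h_def)
  hence "(\<Sum>l = Suc T..M. g l * (\<nu> * d l - 2 * Y l) + (g l)\<^sup>2 * Y l) \<le> 0"
    by (simp add: sum.distrib algebra_simps sum_subtractf power2_eq_square)
  moreover have "(\<Sum>l = Suc T..M. g l * (\<nu> * d l - 2 * Y l))
      \<le> (\<Sum>l = Suc T..M. g l * (\<nu> * d l - 2 * Y l) + (g l)\<^sup>2 * Y l)"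
    using Y by (intro sum_mono) auto
  ultimately show ?thesis by linarith
qed

text \<open>The bias of the selected weights up to the true index \<open>T\<close>. Here \<open>\<theta>\<close>, \<open>\<epsilon>\<close> and \<open>Y\<close> are the energies of mean,
  error and response in the added directions, and \<open>a\<close> is a lower bound for the signal that dominates the
  noise. The bound on \<open>1 - g T\<close> comes from the single term \<open>l = T\<close> of the comparison; it is then
  fed back into the full sum.\<close>

lemma underfit_bias_bound:
  fixes Y \<epsilon> \<theta> d :: "nat \<Rightarrow> real"
  assumes opt: "\<And>h. tail_seq M h \<Longrightarrow> tail_crit M \<nu> d Y g \<le> tail_crit M \<nu> d Y h"
    and g: "tail_seq M g" and T: "2 \<le> T" "T \<le> M" and l0: "\<nu> \<ge> 0"
    and d: "\<And>l. l \<in> {1..M} \<Longrightarrow> d l \<ge> 0"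
    and \<epsilon>: "\<And>l. l \<in> {1..M} \<Longrightarrow> \<epsilon> l \<ge> 0"
    and Y0: "\<And>l. l \<in> {1..M} \<Longrightarrow> Y l \<ge> 0"
    and Y: "\<And>l. l \<in> {2..T} \<Longrightarrow> \<theta> l \<le> 2 * Y l + 2 * \<epsilon> l"
    and a: "a > 0" "\<theta> T \<ge> a" 
    and D: "D = (\<Sum>l = 2..T. d l)"
    and Q: "(\<Sum>l = 2..T. \<epsilon> l) \<le> K * D" "K * D \<le> a / 4"
  shows "(\<Sum>l = 1..T. (1 - g l)\<^sup>2 * \<theta> l) \<le> 8 * \<nu>\<^sup>2 * D\<^sup>2 / a + 32 * \<nu>\<^sup>2 * D\<^sup>2 * (K * D) / a\<^sup>2"
proof -
  define G where "G = 1 - g T"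
  have G0: "G \<ge> 0" using tail_seq_bounds[OF g, of T] T by (simp add: G_def)
  have D0: "D \<ge> 0" unfolding D using d T by (intro sum_nonneg) auto
  have "\<epsilon> T \<le> (\<Sum>l = 2..T. \<epsilon> l)" using \<epsilon> T by (intro member_le_sum) auto
  hence "Y T \<ge> a / 4" using Y[of T] T a Q by auto
  have main: "(\<Sum>l = 2..T. (1 - g l)\<^sup>2 * Y l) \<le> \<nu> * G * D"
    unfolding G_def D by (rule crit_min_underfit[OF opt g T l0 d])
  have "G\<^sup>2 * (a / 4) \<le> G\<^sup>2 * Y T" using \<open>Y T \<ge> a / 4\<close> by (intro mult_left_mono) auto
  also have "\<dots> \<le> (\<Sum>l = 2..T. (1 - g l)\<^sup>2 * Y l)"
    unfolding G_def using T Y0 by (intro member_le_sum[of T "{2..T}" "\<lambda>l. (1 - g l)\<^sup>2 * Y l"]) auto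
  also note main
  finally have "G * (G * (a / 4)) \<le> G * (\<nu> * D)" by (simp add: power2_eq_square algebra_simps)
  hence Ga: "G * (a / 4) \<le> \<nu> * D" using G0 l0 D0 by (cases "G = 0") auto
  hence GD: "G \<le> 4 * \<nu> * D / a" using a by (simp add: field_simps)
  have "(\<Sum>l = 1..T. (1 - g l)\<^sup>2 * \<theta> l) = (\<Sum>l = 2..T. (1 - g l)\<^sup>2 * \<theta> l)"
    using g T sum_split_first_middle[of T T "\<lambda>l. (1 - g l)\<^sup>2 * \<theta> l"] by (simp add: tail_seq_def)
  also have "\<dots> \<le> (\<Sum>l = 2..T. 2 * ((1 - g l)\<^sup>2 * Y l) + 2 * ((1 - g l)\<^sup>2 * \<epsilon> l))"
  proof (rule sum_mono)
    fix l assume "l \<in> {2..T}"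
    from mult_left_mono[OF Y[OF this], of "(1 - g l)\<^sup>2"]
    show "(1 - g l)\<^sup>2 * \<theta> l \<le> 2 * ((1 - g l)\<^sup>2 * Y l) + 2 * ((1 - g l)\<^sup>2 * \<epsilon> l)"
      by (simp add: algebra_simps)
  qed
  also have "\<dots> = 2 * (\<Sum>l = 2..T. (1 - g l)\<^sup>2 * Y l) + 2 * (\<Sum>l = 2..T. (1 - g l)\<^sup>2 * \<epsilon> l)"
    by (simp add: sum.distrib sum_distrib_left)
  also have "(\<Sum>l = 2..T. (1 - g l)\<^sup>2 * \<epsilon> l) \<le> (\<Sum>l = 2..T. G\<^sup>2 * \<epsilon> l)"
    unfolding G_def using tail_seq_antimono[OF g] tail_seq_bounds[OF g] T \<epsilon>
    by (intro sum_mono mult_right_mono power_mono) auto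
  also have "\<dots> = G\<^sup>2 * (\<Sum>l = 2..T. \<epsilon> l)" by (simp add: sum_distrib_left)
  also have "\<dots> \<le> (4 * \<nu> * D / a)\<^sup>2 * (K * D)"
    using GD G0 Q \<epsilon> T by (intro mult_mono power_mono) (auto intro!: sum_nonneg)
  also note main
  also have "\<nu> * G * D \<le> \<nu> * (4 * \<nu> * D / a) * D"
    using GD l0 D0 by (intro mult_right_mono mult_left_mono) auto
  finally show ?thesis using a by (simp add: power2_eq_square field_simps)
qed

lemma quadratic_tradeoff:
  fixes a b \<gamma> :: real
  assumes "a > 0" "b \<ge> 0"
  shows "(1 - \<gamma>)\<^sup>2 * a + \<gamma>\<^sup>2 * b \<ge> b - b\<^sup>2 / a"
proof -
  \<comment> \<open>Complete the square in \<open>1 - \<gamma>\<close>.\<close>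
  have "0 \<le> (a * (1 - \<gamma>) - b)\<^sup>2 / a + (1 - \<gamma>)\<^sup>2 * b" using assms by auto
  also have "\<dots> = (1 - \<gamma>)\<^sup>2 * a + \<gamma>\<^sup>2 * b - (b - b\<^sup>2 / a)"
    using assms by (simp add: power2_eq_square field_simps)
  finally show ?thesis by simp
qed

text \<open>Each term with \<open>2 \<le> l \<le> T\<close> of the variance is at least the one with \<open>g T\<close> in place of \<open>g l\<close>, so
  the best tradeoff between the bias at \<open>T\<close> and the variance bounds the risk.\<close>

lemma truncated_risk_lower_bound:
  fixes \<theta> d :: "nat \<Rightarrow> real"
  assumes g: "tail_seq M g" and T: "2 \<le> T" "T \<le> M"
    and d: "\<And>l. l \<in> {1..M} \<Longrightarrow> d l \<ge> 0"
    and \<theta>: "\<And>l. l \<in> {1..M} \<Longrightarrow> \<theta> l \<ge> 0"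
    and a: "a > 0" "\<theta> T \<ge> a" and s: "s \<ge> 0"
    and D: "D = (\<Sum>l = 2..T. d l)"
  shows "(\<Sum>l = 1..T. (1 - g l)\<^sup>2 * \<theta> l) + s * (\<Sum>l = 1..T. (g l)\<^sup>2 * d l)
    \<ge> s * (d 1 + D) * (1 - s * D / a)"
proof -
  have D0: "D \<ge> 0" unfolding D using d T by (intro sum_nonneg) auto
  have "(1 - g T)\<^sup>2 * a \<le> (1 - g T)\<^sup>2 * \<theta> T" using a by (intro mult_left_mono) auto
  also have "\<dots> \<le> (\<Sum>l = 1..T. (1 - g l)\<^sup>2 * \<theta> l)"
    using T \<theta> by (intro member_le_sum[of T "{1..T}" "\<lambda>l. (1 - g l)\<^sup>2 * \<theta> l"]) auto
  finally have 1: "(1 - g T)\<^sup>2 * a \<le> (\<Sum>l = 1..T. (1 - g l)\<^sup>2 * \<theta> l)" .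
  have "(\<Sum>l = 1..T. (g l)\<^sup>2 * d l) = d 1 + (\<Sum>l = 2..T. (g l)\<^sup>2 * d l)"
    using g T sum_split_first_middle[of T T "\<lambda>l. (g l)\<^sup>2 * d l"] by (simp add: tail_seq_def)
  moreover have "(\<Sum>l = 2..T. (g l)\<^sup>2 * d l) \<ge> (\<Sum>l = 2..T. (g T)\<^sup>2 * d l)"
    using tail_seq_antimono[OF g] tail_seq_bounds[OF g] T d
    by (intro sum_mono mult_right_mono power_mono) auto
  ultimately have 2: "(\<Sum>l = 1..T. (g l)\<^sup>2 * d l) \<ge> d 1 + (g T)\<^sup>2 * D"
    by (simp add: D sum_distrib_left)
  have "s * (d 1 + D) * (1 - s * D / a) \<le> s * d 1 + (s * D - (s * D)\<^sup>2 / a)"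
  proof -
    have "0 \<le> s * d 1 * (s * D) / a" using s D0 d[of 1] T a by simp
    thus ?thesis by (simp add: power2_eq_square algebra_simps)
  qed
  also have "\<dots> \<le> s * d 1 + ((1 - g T)\<^sup>2 * a + (g T)\<^sup>2 * (s * D))"
    using quadratic_tradeoff[of a "s * D" "g T"] a s D0 by simp
  also have "\<dots> = (1 - g T)\<^sup>2 * a + s * (d 1 + (g T)\<^sup>2 * D)" by (simp add: algebra_simps)
  also have "\<dots> \<le> (\<Sum>l = 1..T. (1 - g l)\<^sup>2 * \<theta> l) + s * (\<Sum>l = 1..T. (g l)\<^sup>2 * d l)"
    using 1 2 s by (intro add_mono mult_left_mono)
  finally show ?thesis .
qed

text \<open>If the penalty of each over-fitted model exceeds twice the energy it captures beyond \<open>T\<close>, then a minimizer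
  of the criterion gives these models no weight. Here \<open>\<rho> m\<close> is the dimension of model \<open>m\<close> and \<open>q m\<close> the energy
  of the response in it.\<close>

lemma crit_min_no_overfit:
  assumes w: "w \<in> weights M"
    and opt: "\<And>h. tail_seq M h \<Longrightarrow>
      tail_crit M \<nu> (\<lambda>l. \<rho> l - \<rho> (l - 1)) (\<lambda>l. q l - q (l - 1)) (tail_weight M w)
        \<le> tail_crit M \<nu> (\<lambda>l. \<rho> l - \<rho> (l - 1)) (\<lambda>l. q l - q (l - 1)) h"
    and T: "1 \<le> T" "T \<le> M"
    and q: "\<And>l. l \<in> {1..M} \<Longrightarrow> q (l - 1) \<le> q l"
    and gt: "\<And>m. m \<in> {Suc T..M} \<Longrightarrow> 2 * (q m - q T) < \<nu> * (\<rho> m - \<rho> T)"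
    and l: "l \<in> {Suc T..M}"
  shows "tail_weight M w l = 0"
proof -
  \<comment> \<open>Returning from tail weights to weights, all summands of the comparison become nonnegative.\<close>
  define a where "a m = (if m \<le> T then 0 else \<nu> * (\<rho> m - \<rho> T) - 2 * (q m - q T))" for m
  have a_diff: "a l - a (l - 1) = (if l \<le> T then 0 else \<nu> * (\<rho> l - \<rho> (l - 1)) - 2 * (q l - q (l - 1)))"
    if "l \<in> {1..M}" for l
  proof (cases "l \<le> T")
    case False
    show ?thesis
    proof (cases "l = Suc T")
      case False
      with \<open>\<not> l \<le> T\<close> have "\<not> l - 1 \<le> T" by simp
      thus ?thesis using \<open>\<not> l \<le> T\<close> by (simp add: a_def algebra_simps)
    qed (simp add: a_def)
  next
    case True
    hence "l - 1 \<le> T" by simp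
    thus ?thesis using True by (simp add: a_def)
  qed
  have "(\<Sum>m = 1..M. w m * a m) = (\<Sum>l = 1..M. tail_weight M w l * (a l - a (l - 1)))"
    by (rule sum_weights_Abel) (simp add: a_def)
  also have "\<dots> = (\<Sum>l = Suc T..M. tail_weight M w l * (\<nu> * (\<rho> l - \<rho> (l - 1)) - 2 * (q l - q (l - 1))))"
    using T by (intro sum.mono_neutral_cong_right) (auto simp: a_diff[simplified])
  also have "\<dots> \<le> 0"
    by (rule crit_min_overfit[OF opt tail_seq_tail_weight[OF w] T]) (use q in auto)
  finally have le: "(\<Sum>m = 1..M. w m * a m) \<le> 0" .
  have w0: "w m \<ge> 0" if "m \<in> {1..M}" for m using w that by (auto simp: weights_def PiE_iff)
  have a0: "a m \<ge> 0" if "m \<in> {1..M}" for m using gt[of m] that by (auto simp: a_def)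
  have "w m * a m = 0" if "m \<in> {1..M}" for m
  proof -
    have "(\<Sum>m = 1..M. w m * a m) = 0"
      using le sum_nonneg[of "{1..M}" "\<lambda>m. w m * a m"] w0 a0 by force
    thus ?thesis using sum_nonneg_eq_0_iff[of "{1..M}" "\<lambda>m. w m * a m"] w0 a0 that by auto
  qed
  moreover have "a m \<noteq> 0" if "m \<in> {Suc T..M}" for m using gt[OF that] that by (auto simp: a_def)
  ultimately have "w m = 0" if "m \<in> {Suc T..M}" for m using that T by fastforce
  thus ?thesis unfolding tail_weight_def using l by (intro sum.neutral) auto
qed

lemma sum_sq_weights_le_tail:
  assumes w: "w \<in> weights M" and T: "1 \<le> T" "T \<le> M"
    and \<rho>: "\<And>l. l \<in> {Suc T..M} \<Longrightarrow> \<rho> (l - 1) \<le> (\<rho> l :: real)"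
  shows "(\<Sum>m = Suc T..M. (w m)\<^sup>2 * (\<rho> m - \<rho> T))
    \<le> (\<Sum>l = Suc T..M. (tail_weight M w l)\<^sup>2 * (\<rho> l - \<rho> (l - 1)))"
proof -
  define a where "a m = (if m \<le> T then 0 else \<rho> m - \<rho> T)" for m
  have a_diff: "a l - a (l - 1) = (if l \<le> T then 0 else \<rho> l - \<rho> (l - 1))" if "l \<in> {1..M}" for l
    using that by (cases "l = Suc T") (auto simp: a_def)
  have "(\<Sum>m = Suc T..M. (w m)\<^sup>2 * (\<rho> m - \<rho> T)) = (\<Sum>m = 1..M. (w m)\<^sup>2 * a m)"
    using T by (intro sum.mono_neutral_cong_left) (auto simp: a_def)
  also have "\<dots> = (\<Sum>l = 1..M. tail_weight M (\<lambda>m. (w m)\<^sup>2) l * (a l - a (l - 1)))"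
    by (rule sum_weights_Abel) (simp add: a_def)
  also have "\<dots> = (\<Sum>l = Suc T..M. tail_weight M (\<lambda>m. (w m)\<^sup>2) l * (\<rho> l - \<rho> (l - 1)))"
    using T by (intro sum.mono_neutral_cong_right) (auto simp: a_diff[simplified])
  also have "\<dots> \<le> (\<Sum>l = Suc T..M. (tail_weight M w l)\<^sup>2 * (\<rho> l - \<rho> (l - 1)))"
    using T \<rho> tail_weight_sq_ge[OF w]
    by (intro sum_mono mult_right_mono) (auto simp: tail_weight_def)
  finally show ?thesis .
qed

section \<open>Nested families of orthogonal projections\<close>

lemma scalar_prod_mult_mat_vec_sum:
  fixes B :: "real mat"
  assumes "B \<in> carrier_mat n p" "u \<in> carrier_vec n" "v \<in> carrier_vec p"
  shows "u \<bullet> (B *\<^sub>v v) = (\<Sum>i<n. \<Sum>j<p. u $ i * (B $$ (i, j) * v $ j))"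
  using assms by (auto simp: scalar_prod_def atLeast0LessThan sum_distrib_left intro!: sum.cong)

lemma sq_norm2_le_add:
  assumes "a \<in> carrier_vec n" "b \<in> carrier_vec n"
  shows "sq_norm2 a \<le> 2 * sq_norm2 (a + b) + 2 * sq_norm2 b"
proof -
  have "0 \<le> sq_norm2 (a + 2 \<cdot>\<^sub>v b)" by (rule sq_norm2_nonneg)
  also have "\<dots> = 2 * sq_norm2 (a + b) + 2 * sq_norm2 b - sq_norm2 a"
    using assms by (simp add: sq_norm2_add[of _ n] sq_norm2_smult)
  finally show ?thesis by simp
qed

text \<open>An increasing family of orthogonal projections of \<open>\<real>\<^sup>N\<close>, starting with \<open>P\<^sub>0 = 0\<close>: symmetric matrices
  such that each one fixes the ranges of its predecessors; \<open>l = m\<close> gives idempotence.\<close>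

locale nested_projections =
  fixes N M :: nat and P :: "nat \<Rightarrow> real mat"
  assumes carrier: "m \<le> M \<Longrightarrow> P m \<in> carrier_mat N N"
    and symmetric: "m \<le> M \<Longrightarrow> transpose_mat (P m) = P m"
    and nested: "l \<le> m \<Longrightarrow> m \<le> M \<Longrightarrow> P m * P l = P l"
    and P_0: "P 0 = 0\<^sub>m N N"
begin

lemma mult_min:
  assumes "m \<le> M" "l \<le> M"
  shows "P m * P l = P (min m l)"
proof (cases "l \<le> m")
  case True
  thus ?thesis using nested assms by (simp add: min_def)
next
  case False
  hence "P l * P m = P m" using nested assms by simp
  hence "transpose_mat (P m) * transpose_mat (P l) = transpose_mat (P m)"
    using transpose_mult[OF carrier carrier, of l m] assms by simp
  thus ?thesis using False symmetric assms by (simp add: min_def)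
qed

lemma mult_vec_carrier [simp]:
  "m \<le> M \<Longrightarrow> v \<in> carrier_vec N \<Longrightarrow> P m *\<^sub>v v \<in> carrier_vec N"
  using carrier mult_mat_vec_carrier by blast

lemma mult_vec_min:
  assumes "m \<le> M" "l \<le> M" "v \<in> carrier_vec N"
  shows "P m *\<^sub>v (P l *\<^sub>v v) = P (min m l) *\<^sub>v v"
  using assms carrier mult_min by (metis assoc_mult_mat_vec)

lemma scalar_prod_swap:
  assumes "m \<le> M" "u \<in> carrier_vec N" "v \<in> carrier_vec N"
  shows "u \<bullet> (P m *\<^sub>v v) = (P m *\<^sub>v u) \<bullet> v"
  using scalar_prod_transpose_mult[OF carrier] symmetric assms by simp

lemma scalar_prod_min:
  assumes "m \<le> M" "l \<le> M" "u \<in> carrier_vec N" "v \<in> carrier_vec N"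
  shows "(P m *\<^sub>v u) \<bullet> (P l *\<^sub>v v) = u \<bullet> (P (min m l) *\<^sub>v v)"
  using assms by (simp add: scalar_prod_swap[symmetric] mult_vec_min)

lemma sq_norm2_mult_vec:
  assumes "m \<le> M" "v \<in> carrier_vec N"
  shows "sq_norm2 (P m *\<^sub>v v) = quad (P m) v"
  using scalar_prod_min[of m m v v] assms by (simp add: sq_norm2_def quad_def)

lemma quad_0: "v \<in> carrier_vec N \<Longrightarrow> quad (P 0) v = 0"
  by (simp add: quad_def P_0 scalar_prod_mult_mat_vec_sum[of _ N N])

lemma quad_diff:
  assumes "l \<le> m" "m \<le> M" "v \<in> carrier_vec N"
  shows "quad (P m) v - quad (P l) v = sq_norm2 (P m *\<^sub>v v - P l *\<^sub>v v)"
  using assms scalar_prod_min[of m l v v]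
  by (simp add: sq_norm2_diff[of _ N] sq_norm2_mult_vec quad_def[of "P l"] min_def)

lemma quad_mono:
  assumes "l \<le> m" "m \<le> M" "v \<in> carrier_vec N"
  shows "quad (P l) v \<le> quad (P m) v"
  using quad_diff[OF assms] sq_norm2_nonneg[of "P m *\<^sub>v v - P l *\<^sub>v v"] by linarith

lemma quad_diff_le_add:
  assumes "l \<le> m" "m \<le> M" "u \<in> carrier_vec N" "v \<in> carrier_vec N"
  shows "quad (P m) u - quad (P l) u
    \<le> 2 * (quad (P m) (u + v) - quad (P l) (u + v)) + 2 * (quad (P m) v - quad (P l) v)"
proof -
  have c: "P m \<in> carrier_mat N N" "P l \<in> carrier_mat N N" using carrier assms by auto
  have "P m *\<^sub>v (u + v) - P l *\<^sub>v (u + v) = (P m *\<^sub>v u - P l *\<^sub>v u) + (P m *\<^sub>v v - P l *\<^sub>v v)"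
    unfolding mult_add_distrib_mat_vec[OF c(1) assms(3,4)] mult_add_distrib_mat_vec[OF c(2) assms(3,4)]
    using assms c by (intro eq_vecI) auto
  thus ?thesis
    using assms sq_norm2_le_add[of "P m *\<^sub>v u - P l *\<^sub>v u" N "P m *\<^sub>v v - P l *\<^sub>v v"] c
    by (simp add: quad_diff)
qed

lemma fixed_mono:
  assumes "l \<le> m" "m \<le> M" "u \<in> carrier_vec N" "P l *\<^sub>v u = u"
  shows "P m *\<^sub>v u = u"
  using mult_vec_min[of m l u] assms by (simp add: min_def)

lemma quad_diff_fixed:
  assumes "l \<le> m" "m \<le> M" "u \<in> carrier_vec N" "v \<in> carrier_vec N" "P l *\<^sub>v u = u"
  shows "quad (P m) (u + v) - quad (P l) (u + v) = quad (P m) v - quad (P l) v"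
proof -
  have c: "P m \<in> carrier_mat N N" "P l \<in> carrier_mat N N" using carrier assms by auto
  have "P m *\<^sub>v (u + v) - P l *\<^sub>v (u + v) = P m *\<^sub>v v - P l *\<^sub>v v"
    unfolding mult_add_distrib_mat_vec[OF c(1) assms(3,4)] mult_add_distrib_mat_vec[OF c(2) assms(3,4)]
      fixed_mono[OF assms(1-3,5)] assms(5)
    using assms c by (intro eq_vecI) auto
  thus ?thesis using assms by (simp add: quad_diff)
qed

text \<open>The matrix \<open>P(w)\<close>. Only the indices from 1 to \<open>M\<close> carry weight.\<close>

definition average :: "(nat \<Rightarrow> real) \<Rightarrow> real mat" where
  "average w = mat N N (\<lambda>(a, b). \<Sum>m = 1..M. w m * P m $$ (a, b))"

lemma average_carrier [simp]: "average w \<in> carrier_mat N N"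
  by (simp add: average_def)

lemma average_mult_vec_carrier [simp]: "v \<in> carrier_vec N \<Longrightarrow> average w *\<^sub>v v \<in> carrier_vec N"
  by (rule mult_mat_vec_carrier[OF average_carrier])

lemma scalar_prod_average:
  assumes u: "u \<in> carrier_vec N" and v: "v \<in> carrier_vec N"
  shows "u \<bullet> (average w *\<^sub>v v) = (\<Sum>m = 1..M. w m * (u \<bullet> (P m *\<^sub>v v)))"
proof -
  have "u \<bullet> (average w *\<^sub>v v) = (\<Sum>i<N. \<Sum>j<N. \<Sum>m = 1..M. w m * (u $ i * (P m $$ (i, j) * v $ j)))"
    unfolding scalar_prod_mult_mat_vec_sum[OF average_carrier u v]
    by (intro sum.cong refl) (simp add: average_def sum_distrib_left sum_distrib_right algebra_simps)
  also have "\<dots> = (\<Sum>i<N. \<Sum>m = 1..M. \<Sum>j<N. w m * (u $ i * (P m $$ (i, j) * v $ j)))"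
    by (intro sum.cong refl sum.swap)
  also have "\<dots> = (\<Sum>m = 1..M. \<Sum>i<N. \<Sum>j<N. w m * (u $ i * (P m $$ (i, j) * v $ j)))"
    by (rule sum.swap)
  also have "\<dots> = (\<Sum>m = 1..M. w m * (u \<bullet> (P m *\<^sub>v v)))"
    using carrier u v
    by (intro sum.cong refl) (simp add: scalar_prod_mult_mat_vec_sum[of _ N N] sum_distrib_left)
  finally show ?thesis .
qed

text \<open>The energy \<open>\<parallel>(P\<^sub>l - P\<^sub>l\<^sub>-\<^sub>1) v\<parallel>\<^sup>2\<close> of \<open>v\<close> in the directions that index \<open>l\<close> adds; used for \<open>l \<ge> 1\<close>.\<close>

abbreviation block :: "nat \<Rightarrow> real vec \<Rightarrow> real" where
  "block l v \<equiv> quad (P l) v - quad (P (l - 1)) v"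

lemma block_nonneg: "l \<in> {1..M} \<Longrightarrow> v \<in> carrier_vec N \<Longrightarrow> 0 \<le> block l v"
  using quad_mono[of "l - 1" l v] by auto

lemma scalar_prod_average_self:
  assumes v: "v \<in> carrier_vec N"
  shows "v \<bullet> (average w *\<^sub>v v) = (\<Sum>l = 1..M. tail_weight M w l * block l v)"
proof -
  have "v \<bullet> (average w *\<^sub>v v) = (\<Sum>m = 1..M. w m * quad (P m) v)"
    by (simp add: scalar_prod_average[OF v v] quad_def)
  thus ?thesis using sum_weights_Abel[of "\<lambda>m. quad (P m) v" w M] quad_0[OF v] by simp
qed

lemma sq_norm2_average:
  assumes v: "v \<in> carrier_vec N"
  shows "sq_norm2 (average w *\<^sub>v v) = (\<Sum>l = 1..M. (tail_weight M w l)\<^sup>2 * block l v)"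
proof -
  have "sq_norm2 (average w *\<^sub>v v) = (\<Sum>m = 1..M. w m * ((average w *\<^sub>v v) \<bullet> (P m *\<^sub>v v)))"
    unfolding sq_norm2_def by (rule scalar_prod_average) (use v in auto)
  also have "\<dots> = (\<Sum>m = 1..M. w m * (\<Sum>j = 1..M. w j * quad (P (min m j)) v))"
  proof (intro sum.cong refl arg_cong2[where f="(*)"])
    fix m assume m: "m \<in> {1..M}"
    have "(average w *\<^sub>v v) \<bullet> (P m *\<^sub>v v) = (P m *\<^sub>v v) \<bullet> (average w *\<^sub>v v)"
      using m v by (intro comm_scalar_prod[of _ N]) auto
    also have "\<dots> = (\<Sum>j = 1..M. w j * ((P m *\<^sub>v v) \<bullet> (P j *\<^sub>v v)))"
      using m v by (intro scalar_prod_average) auto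
    also have "\<dots> = (\<Sum>j = 1..M. w j * quad (P (min m j)) v)"
      using m v by (intro sum.cong refl) (simp add: scalar_prod_min quad_def)
    finally show "(average w *\<^sub>v v) \<bullet> (P m *\<^sub>v v) = (\<Sum>j = 1..M. w j * quad (P (min m j)) v)" .
  qed
  also have "\<dots> = (\<Sum>l = 1..M. (tail_weight M w l)\<^sup>2 * block l v)"
    by (rule sum_weights_min[of "\<lambda>m. quad (P m) v"]) (rule quad_0[OF v])
  finally show ?thesis .
qed

lemma sq_norm2_residual:
  assumes v: "v \<in> carrier_vec N"
  shows "sq_norm2 (v - average w *\<^sub>v v)
    = sq_norm2 v - quad (P M) v + (\<Sum>l = 1..M. (1 - tail_weight M w l)\<^sup>2 * block l v)"
proof -
  have "(\<Sum>l = 1..M. block l v) = quad (P M) v"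
    by (rule sum_telescope_from_0[of "\<lambda>m. quad (P m) v"]) (rule quad_0[OF v])
  moreover have "(\<Sum>l = 1..M. (1 - tail_weight M w l)\<^sup>2 * block l v)
    = (\<Sum>l = 1..M. block l v) - 2 * (\<Sum>l = 1..M. tail_weight M w l * block l v)
      + (\<Sum>l = 1..M. (tail_weight M w l)\<^sup>2 * block l v)"
    unfolding sum_distrib_left sum_subtractf[symmetric] sum.distrib[symmetric]
    by (intro sum.cong refl) (simp add: power2_eq_square algebra_simps)
  ultimately show ?thesis
    using v by (simp add: sq_norm2_diff[of _ N] scalar_prod_average_self sq_norm2_average)
qed

lemma sq_norm2_average_loss:
  assumes u: "u \<in> carrier_vec N" and v: "v \<in> carrier_vec N"
  shows "sq_norm2 (u - average w *\<^sub>v (u + v))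
    = sq_norm2 (u - average w *\<^sub>v u)
      - 2 * (\<Sum>m = 1..M. w m * ((P m *\<^sub>v (u - average w *\<^sub>v u)) \<bullet> v))
      + (\<Sum>l = 1..M. (tail_weight M w l)\<^sup>2 * block l v)"
proof -
  let ?r = "u - average w *\<^sub>v u"
  have r: "?r \<in> carrier_vec N" using u by auto
  have "u - average w *\<^sub>v (u + v) = ?r - average w *\<^sub>v v"
    unfolding mult_add_distrib_mat_vec[OF average_carrier u v]
    using u v by (intro eq_vecI) (auto simp: average_def)
  also have "sq_norm2 \<dots> = sq_norm2 ?r - 2 * (?r \<bullet> (average w *\<^sub>v v)) + sq_norm2 (average w *\<^sub>v v)"
    using r v by (intro sq_norm2_diff[of _ N]) auto
  also have "?r \<bullet> (average w *\<^sub>v v) = (\<Sum>m = 1..M. w m * ((P m *\<^sub>v ?r) \<bullet> v))"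
    unfolding scalar_prod_average[OF r v] using r v by (simp add: scalar_prod_swap)
  finally show ?thesis by (simp add: sq_norm2_average[OF v])
qed

lemma quad_diff_sum:
  assumes "l \<le> m" "m \<le> M" "v \<in> carrier_vec N"
  shows "quad (P m) v - quad (P l) v = (\<Sum>i<N. \<Sum>j<N. (P m - P l) $$ (i, j) * (v $ i * v $ j))"
proof -
  have c: "P m \<in> carrier_mat N N" "P l \<in> carrier_mat N N" using carrier assms by auto
  show ?thesis
    unfolding quad_def scalar_prod_mult_mat_vec_sum[OF c(1) assms(3,3)]
      scalar_prod_mult_mat_vec_sum[OF c(2) assms(3,3)] sum_subtractf[symmetric]
    using c by (intro sum.cong refl) (simp add: algebra_simps)
qed

lemma symmetric_entries:
  assumes "m \<le> M" "i < N" "j < N"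
  shows "P m $$ (i, j) = P m $$ (j, i)"
  using symmetric[OF assms(1)] carrier[OF assms(1)] assms by (metis carrier_matD index_transpose_mat(1))

text \<open>A difference of nested projections is a projection, so its squared Frobenius norm is its trace. This turns
  the variance bound for quadratic forms into a bound by a dimension.\<close>

lemma frobenius_diff:
  assumes "l \<le> m" "m \<le> M"
  shows "(\<Sum>i<N. \<Sum>j<N. ((P m - P l) $$ (i, j))\<^sup>2) = mat_trace (P m) - mat_trace (P l)"
proof -
  have c: "P m \<in> carrier_mat N N" "P l \<in> carrier_mat N N" using carrier assms by auto
  define D where "D = P m - P l"
  have D: "D \<in> carrier_mat N N" unfolding D_def using c by auto
  have sym: "D $$ (i, j) = D $$ (j, i)" if "i < N" "j < N" for i j
    using that c assms symmetric_entries[of m i j] symmetric_entries[of l i j] by (simp add: D_def)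
  have 1: "P m * D = D"
    unfolding D_def using c assms mult_min[of m m] mult_min[of m l]
    by (subst mult_minus_distrib_mat[of _ N N]) (auto simp: min_def)
  have 2: "P l * D = 0\<^sub>m N N"
    unfolding D_def using c assms mult_min[of l m] mult_min[of l l]
    by (subst mult_minus_distrib_mat[of _ N N]) (auto simp: min_def)
  have "D * D = P m * D - P l * D"
    unfolding D_def using c by (intro minus_mult_distrib_mat[of _ N N]) auto
  hence DD: "D * D = D" using 1 2 D by (intro eq_matI) auto
  have "(\<Sum>i<N. \<Sum>j<N. (D $$ (i, j))\<^sup>2) = (\<Sum>i<N. (D * D) $$ (i, i))"
    using D sym by (auto simp: scalar_prod_def atLeast0LessThan power2_eq_square intro!: sum.cong)
  also have "\<dots> = mat_trace (P m) - mat_trace (P l)"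
    unfolding DD using c by (simp add: D_def mat_trace_def sum_subtractf)
  finally show ?thesis by (simp add: D_def)
qed

end

section \<open>Moments of linear and quadratic forms in independent errors\<close>

lemma integrable_mult_of_square_integrable:
  fixes f g :: "'a \<Rightarrow> real"
  assumes [measurable]: "f \<in> borel_measurable \<Omega>" "g \<in> borel_measurable \<Omega>"
    and "integrable \<Omega> (\<lambda>\<omega>. (f \<omega>)\<^sup>2)" "integrable \<Omega> (\<lambda>\<omega>. (g \<omega>)\<^sup>2)"
  shows "integrable \<Omega> (\<lambda>\<omega>. f \<omega> * g \<omega>)"
proof (rule Bochner_Integration.integrable_bound)
  show "integrable \<Omega> (\<lambda>\<omega>. (f \<omega>)\<^sup>2 + (g \<omega>)\<^sup>2)" using assms by auto
  have "\<bar>a * b\<bar> \<le> \<bar>a\<^sup>2 + b\<^sup>2\<bar>" for a b :: real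
  proof -
    have "2 * (\<bar>a\<bar> * \<bar>b\<bar>) \<le> a\<^sup>2 + b\<^sup>2" using sum_squares_bound[of "\<bar>a\<bar>" "\<bar>b\<bar>"] by simp
    moreover have "\<bar>a\<bar> * \<bar>b\<bar> \<ge> 0" by simp
    ultimately show ?thesis unfolding abs_mult by linarith
  qed
  thus "AE \<omega> in \<Omega>. norm (f \<omega> * g \<omega>) \<le> norm ((f \<omega>)\<^sup>2 + (g \<omega>)\<^sup>2)" by simp
qed measurable

lemma integrable_square_add:
  fixes f g :: "'a \<Rightarrow> real"
  assumes [measurable]: "f \<in> borel_measurable \<Omega>" "g \<in> borel_measurable \<Omega>"
    and f: "integrable \<Omega> (\<lambda>\<omega>. (f \<omega>)\<^sup>2)" and g: "integrable \<Omega> (\<lambda>\<omega>. (g \<omega>)\<^sup>2)"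
  shows "integrable \<Omega> (\<lambda>\<omega>. (f \<omega> + g \<omega>)\<^sup>2)"
  unfolding power2_sum using f g integrable_mult_of_square_integrable[OF assms]
  by (auto simp: mult.assoc)

context prob_space
begin

text \<open>A function of \<open>f n\<close> is independent of every function of \<open>f 0, \<dots>, f (n - 1)\<close>.\<close>

lemma indep_var_next:
  assumes ind: "indep_vars (\<lambda>_. borel) f (UNIV :: nat set)"
    and h: "h \<in> borel_measurable borel"
    and F: "F \<in> borel_measurable (PiM {..<n} (\<lambda>_. borel))"
  shows "indep_var borel (\<lambda>\<omega>. h (f n \<omega>) :: real) borel (\<lambda>\<omega>. F (\<lambda>i\<in>{..<n}. f i \<omega>) :: real)"
proof -
  have "indep_var (PiM {n} (\<lambda>_. borel)) (\<lambda>\<omega>. \<lambda>i\<in>{n}. f i \<omega>) (PiM {..<n} (\<lambda>_. borel)) (\<lambda>\<omega>. \<lambda>i\<in>{..<n}. f i \<omega>)"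
    by (rule indep_var_restrict[OF ind]) auto
  moreover have "(\<lambda>g. h (g n)) \<in> borel_measurable (PiM {n} (\<lambda>_. borel))"
    using h by (intro measurable_compose[OF measurable_component_singleton[of n "{n}"] h]) auto
  ultimately have "indep_var borel ((\<lambda>g. h (g n)) \<circ> (\<lambda>\<omega>. \<lambda>i\<in>{n}. f i \<omega>)) borel (F \<circ> (\<lambda>\<omega>. \<lambda>i\<in>{..<n}. f i \<omega>))"
    using F by (rule indep_var_compose)
  thus ?thesis by (simp add: comp_def)
qed

lemma linear_form_moments:
  fixes f :: "nat \<Rightarrow> 'a \<Rightarrow> real" and a :: "nat \<Rightarrow> real"
  assumes ind: "indep_vars (\<lambda>_. borel) f UNIV"
    and sq: "\<And>i. integrable M (\<lambda>\<omega>. (f i \<omega>)\<^sup>2)"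
    and mean: "\<And>i. expectation (f i) = 0" and var: "\<And>i. expectation (\<lambda>\<omega>. (f i \<omega>)\<^sup>2) = s"
  defines "L \<equiv> \<lambda>n \<omega>. \<Sum>j<n. a j * f j \<omega>"
  shows "integrable M (L n)" "integrable M (\<lambda>\<omega>. (L n \<omega>)\<^sup>2)" "expectation (L n) = 0"
    "expectation (\<lambda>\<omega>. (L n \<omega>)\<^sup>2) = s * (\<Sum>j<n. (a j)\<^sup>2)"
proof -
  have [measurable]: "f i \<in> borel_measurable M" for i
    using ind by (auto simp: indep_vars_def)
  have int: "integrable M (f i)" for i
    by (rule square_integrable_imp_integrable[OF _ sq]) measurable
  show I: "integrable M (L n)" for n unfolding L_def using int by auto
  show E: "expectation (L n) = 0" for n unfolding L_def using int mean by (simp add: Bochner_Integration.integral_sum)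
  have [measurable]: "L n \<in> borel_measurable M" for n unfolding L_def by measurable
  have L0: "L 0 = (\<lambda>_. 0)" by (simp add: L_def)
  have LS: "L (Suc n) \<omega> = L n \<omega> + a n * f n \<omega>" for n \<omega> by (simp add: L_def)
  show I2: "integrable M (\<lambda>\<omega>. (L n \<omega>)\<^sup>2)" for n
  proof (induction n)
    case (Suc n)
    show ?case unfolding LS using Suc sq[of n]
      by (intro integrable_square_add) (auto simp: power_mult_distrib)
  qed (simp add: L0)
  have iv: "indep_var borel (f n) borel (L n)" for n
  proof -
    have "(\<lambda>\<omega>. (\<lambda>g. \<Sum>j<n. a j * g j) (\<lambda>i\<in>{..<n}. f i \<omega>)) = L n"
      by (auto simp: L_def)
    moreover have "(\<lambda>g. \<Sum>j<n. a j * g j :: real) \<in> borel_measurable (PiM {..<n} (\<lambda>_. borel))"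
      by measurable
    ultimately show ?thesis using indep_var_next[OF ind, of "\<lambda>x. x" "\<lambda>g. \<Sum>j<n. a j * g j" n] by simp
  qed
  show "expectation (\<lambda>\<omega>. (L n \<omega>)\<^sup>2) = s * (\<Sum>j<n. (a j)\<^sup>2)"
  proof (induction n)
    case (Suc n)
    have prod: "integrable M (\<lambda>\<omega>. f n \<omega> * L n \<omega>)" "expectation (\<lambda>\<omega>. f n \<omega> * L n \<omega>) = 0"
      using indep_var_integrable[OF iv int I] indep_var_lebesgue_integral[OF iv int I] mean by auto
    have "(\<lambda>\<omega>. (L (Suc n) \<omega>)\<^sup>2) = (\<lambda>\<omega>. (L n \<omega>)\<^sup>2 + (a n)\<^sup>2 * (f n \<omega>)\<^sup>2 + 2 * a n * (f n \<omega> * L n \<omega>))"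
      by (auto simp: LS power2_eq_square algebra_simps)
    hence "expectation (\<lambda>\<omega>. (L (Suc n) \<omega>)\<^sup>2) = expectation (\<lambda>\<omega>. (L n \<omega>)\<^sup>2) + (a n)\<^sup>2 * s"
      using I2 sq prod var by simp
    thus ?case by (simp add: Suc algebra_simps)
  qed (simp add: L0)
qed

text \<open>Mean and variance of a centred quadratic form, by induction on the number of variables: the increment
  \<open>W\<close> from \<open>n\<close> to \<open>n + 1\<close> variables is \<open>q\<^sub>n\<^sub>n (f\<^sub>n\<^sup>2 - s)\<close> plus \<open>f\<^sub>n\<close> times a linear form \<open>Z\<close> in the previous
  variables, and it is uncorrelated with the previous form.\<close>

lemma quadratic_form_moments:
  fixes f :: "nat \<Rightarrow> 'a \<Rightarrow> real" and q :: "nat \<Rightarrow> nat \<Rightarrow> real"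
  assumes ind: "indep_vars (\<lambda>_. borel) f UNIV"
    and m4: "\<And>i. integrable M (\<lambda>\<omega>. (f i \<omega>) ^ 4)" "\<And>i. expectation (\<lambda>\<omega>. (f i \<omega>) ^ 4) = \<tau>"
    and mean: "\<And>i. expectation (f i) = 0" and var: "\<And>i. expectation (\<lambda>\<omega>. (f i \<omega>)\<^sup>2) = s"
    and q: "\<And>i j. i < N \<Longrightarrow> j < N \<Longrightarrow> q i j = q j i"
  defines "S \<equiv> \<lambda>n \<omega>. (\<Sum>i<n. \<Sum>j<n. q i j * (f i \<omega> * f j \<omega>)) - s * (\<Sum>i<n. q i i)"
  shows "integrable M (S N)" "integrable M (\<lambda>\<omega>. (S N \<omega>)\<^sup>2)" "expectation (S N) = 0"
    "expectation (\<lambda>\<omega>. (S N \<omega>)\<^sup>2) \<le> (2 * \<tau> + 4 * s\<^sup>2) * (\<Sum>i<N. \<Sum>j<N. (q i j)\<^sup>2)"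
proof -
  have [measurable]: "f i \<in> borel_measurable M" for i
    using ind by (auto simp: indep_vars_def)
  have sq: "integrable M (\<lambda>\<omega>. (f i \<omega>)\<^sup>2)" for i
  proof (rule square_integrable_imp_integrable)
    show "integrable M (\<lambda>\<omega>. ((f i \<omega>)\<^sup>2)\<^sup>2)" using m4(1)[of i] by simp
  qed measurable
  have int: "integrable M (f i)" for i
    by (rule square_integrable_imp_integrable[OF _ sq]) measurable
  have s0: "s \<ge> 0" unfolding var[of 0, symmetric] by simp
  have [measurable]: "S n \<in> borel_measurable M" for n unfolding S_def by measurable
  define Z where "Z n \<omega> = (\<Sum>j<n. (2 * q n j) * f j \<omega>)" for n \<omega>
  have [measurable]: "Z n \<in> borel_measurable M" for n unfolding Z_def by measurable
  note Zm = linear_form_moments[OF ind sq mean var, where a = "\<lambda>j. 2 * q n j" and n = n for n, folded Z_def]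
  define u where "u n \<omega> = q n n * ((f n \<omega>)\<^sup>2 - s)" for n \<omega>
  have [measurable]: "u n \<in> borel_measurable M" for n unfolding u_def by measurable
  have u: "integrable M (u n)" "expectation (u n) = 0" for n
    unfolding u_def using sq var by (auto simp: prob_space)
  have uu: "(\<lambda>\<omega>. (u n \<omega>)\<^sup>2) = (\<lambda>\<omega>. (q n n)\<^sup>2 * ((f n \<omega>) ^ 4 - 2 * s * (f n \<omega>)\<^sup>2 + s\<^sup>2))" for n
  proof
    fix \<omega>
    have "(f n \<omega>) ^ 4 = ((f n \<omega>)\<^sup>2)\<^sup>2" by simp
    thus "(u n \<omega>)\<^sup>2 = (q n n)\<^sup>2 * ((f n \<omega>) ^ 4 - 2 * s * (f n \<omega>)\<^sup>2 + s\<^sup>2)"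
      by (simp only: u_def power2_diff power_mult_distrib) (simp add: algebra_simps)
  qed
  have u2: "integrable M (\<lambda>\<omega>. (u n \<omega>)\<^sup>2)" "expectation (\<lambda>\<omega>. (u n \<omega>)\<^sup>2) \<le> (q n n)\<^sup>2 * \<tau>" for n
  proof -
    show "integrable M (\<lambda>\<omega>. (u n \<omega>)\<^sup>2)" unfolding uu using m4 sq by auto
    have "expectation (\<lambda>\<omega>. (u n \<omega>)\<^sup>2) = (q n n)\<^sup>2 * (\<tau> - s\<^sup>2)"
      unfolding uu using m4 sq by (simp add: prob_space var power2_eq_square[of s])
    also have "\<dots> \<le> (q n n)\<^sup>2 * \<tau>" by (intro mult_left_mono) auto
    finally show "expectation (\<lambda>\<omega>. (u n \<omega>)\<^sup>2) \<le> (q n n)\<^sup>2 * \<tau>" .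
  qed
  define F where "F n g = (\<Sum>i<n. \<Sum>j<n. q i j * (g i * g j)) - s * (\<Sum>i<n. q i i)" for n and g :: "nat \<Rightarrow> real"
  define G where "G n g = (\<Sum>j<n. (2 * q n j) * g j)" for n and g :: "nat \<Rightarrow> real"
  have [measurable]: "F n \<in> borel_measurable (PiM {..<n} (\<lambda>_. borel))" "G n \<in> borel_measurable (PiM {..<n} (\<lambda>_. borel))" for n
    unfolding F_def[abs_def] G_def[abs_def] by measurable
  have FS: "F n (\<lambda>i\<in>{..<n}. f i \<omega>) = S n \<omega>" and GZ: "G n (\<lambda>i\<in>{..<n}. f i \<omega>) = Z n \<omega>" for n \<omega>
    by (simp_all add: F_def G_def S_def Z_def)
  have iv1: "indep_var borel (u n) borel (S n)" for n
    using indep_var_next[OF ind, of "\<lambda>x. q n n * (x\<^sup>2 - s)" "F n" n] by (simp add: FS u_def[abs_def])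
  have iv2: "indep_var borel (f n) borel (\<lambda>\<omega>. S n \<omega> * Z n \<omega>)" for n
    using indep_var_next[OF ind, of "\<lambda>x. x" "\<lambda>g. F n g * G n g" n] by (simp add: FS GZ)
  have iv3: "indep_var borel (\<lambda>\<omega>. (f n \<omega>)\<^sup>2) borel (\<lambda>\<omega>. (Z n \<omega>)\<^sup>2)" for n
    using indep_var_next[OF ind, of "\<lambda>x. x\<^sup>2" "\<lambda>g. (G n g)\<^sup>2" n] by (simp add: GZ)
  have iv4: "indep_var borel (f n) borel (Z n)" for n
    using indep_var_next[OF ind, of "\<lambda>x. x" "G n" n] by (simp add: GZ)
  have fZ: "integrable M (\<lambda>\<omega>. f n \<omega> * Z n \<omega>)" "expectation (\<lambda>\<omega>. f n \<omega> * Z n \<omega>) = 0" for n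
    using indep_var_integrable[OF iv4 int Zm(1)] indep_var_lebesgue_integral[OF iv4 int Zm(1)] mean by auto
  have fZ2: "integrable M (\<lambda>\<omega>. (f n \<omega> * Z n \<omega>)\<^sup>2)"
      "expectation (\<lambda>\<omega>. (f n \<omega> * Z n \<omega>)\<^sup>2) = 4 * s\<^sup>2 * (\<Sum>j<n. (q n j)\<^sup>2)" for n
  proof -
    show "integrable M (\<lambda>\<omega>. (f n \<omega> * Z n \<omega>)\<^sup>2)"
      unfolding power_mult_distrib by (rule indep_var_integrable[OF iv3 sq Zm(2)])
    show "expectation (\<lambda>\<omega>. (f n \<omega> * Z n \<omega>)\<^sup>2) = 4 * s\<^sup>2 * (\<Sum>j<n. (q n j)\<^sup>2)"
      unfolding power_mult_distrib indep_var_lebesgue_integral[OF iv3 sq Zm(2)] Zm(4) var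
      by (simp add: sum_distrib_left[symmetric] power2_eq_square[of s])
  qed
  define W where "W n \<omega> = u n \<omega> + f n \<omega> * Z n \<omega>" for n \<omega>
  have [measurable]: "W n \<in> borel_measurable M" for n unfolding W_def by measurable
  have W: "integrable M (W n)" "expectation (W n) = 0" "integrable M (\<lambda>\<omega>. (W n \<omega>)\<^sup>2)" for n
    unfolding W_def using u fZ u2 fZ2 by (auto intro!: integrable_square_add)
  have W2: "expectation (\<lambda>\<omega>. (W n \<omega>)\<^sup>2) \<le> 2 * \<tau> * (q n n)\<^sup>2 + 8 * s\<^sup>2 * (\<Sum>j<n. (q n j)\<^sup>2)" for n
  proof -
    have "(a + b)\<^sup>2 \<le> 2 * a\<^sup>2 + 2 * b\<^sup>2" for a b :: real
      using sum_squares_bound[of a b] by (simp add: power2_sum)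
    hence "expectation (\<lambda>\<omega>. (W n \<omega>)\<^sup>2) \<le> expectation (\<lambda>\<omega>. 2 * (u n \<omega>)\<^sup>2 + 2 * (f n \<omega> * Z n \<omega>)\<^sup>2)"
      using W u2 fZ2 by (intro integral_mono) (auto simp: W_def)
    also have "\<dots> = 2 * expectation (\<lambda>\<omega>. (u n \<omega>)\<^sup>2) + 2 * expectation (\<lambda>\<omega>. (f n \<omega> * Z n \<omega>)\<^sup>2)"
      using u2(1) fZ2(1) by simp
    finally show ?thesis using u2(2)[of n] fZ2(2)[of n] by (simp add: mult_ac)
  qed
  have S0: "S 0 = (\<lambda>_. 0)" by (simp add: S_def)
  have SS: "S (Suc n) \<omega> = S n \<omega> + W n \<omega>" if "n < N" for n \<omega>
  proof -
    have "(\<Sum>i<n. q i n * (f i \<omega> * f n \<omega>)) = (\<Sum>j<n. q n j * (f n \<omega> * f j \<omega>))"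
      using q that by (intro sum.cong) auto
    hence "S (Suc n) \<omega> = S n \<omega> + (2 * (\<Sum>j<n. q n j * (f n \<omega> * f j \<omega>)) + q n n * (f n \<omega> * f n \<omega>) - s * q n n)"
      by (simp add: S_def sum.distrib algebra_simps)
    also have "2 * (\<Sum>j<n. q n j * (f n \<omega> * f j \<omega>)) = f n \<omega> * Z n \<omega>"
      by (simp add: Z_def sum_distrib_left mult_ac)
    finally show ?thesis by (simp add: W_def u_def power2_eq_square algebra_simps)
  qed
  have "integrable M (S n) \<and> integrable M (\<lambda>\<omega>. (S n \<omega>)\<^sup>2) \<and> expectation (S n) = 0
    \<and> expectation (\<lambda>\<omega>. (S n \<omega>)\<^sup>2) \<le> (2 * \<tau> + 4 * s\<^sup>2) * (\<Sum>i<n. \<Sum>j<n. (q i j)\<^sup>2)" if "n \<le> N" for n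
    using that
  proof (induction n)
    case (Suc n)
    hence n: "n < N" and I: "integrable M (S n)" "integrable M (\<lambda>\<omega>. (S n \<omega>)\<^sup>2)" "expectation (S n) = 0"
      "expectation (\<lambda>\<omega>. (S n \<omega>)\<^sup>2) \<le> (2 * \<tau> + 4 * s\<^sup>2) * (\<Sum>i<n. \<Sum>j<n. (q i j)\<^sup>2)" by auto
    have uS: "integrable M (\<lambda>\<omega>. u n \<omega> * S n \<omega>)" "expectation (\<lambda>\<omega>. u n \<omega> * S n \<omega>) = 0"
      using indep_var_integrable[OF iv1 u(1) I(1)] indep_var_lebesgue_integral[OF iv1 u(1) I(1)] u by auto
    have SZ: "integrable M (\<lambda>\<omega>. S n \<omega> * Z n \<omega>)"
      by (rule integrable_mult_of_square_integrable) (use I Zm in auto)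
    have fSZ: "integrable M (\<lambda>\<omega>. f n \<omega> * (S n \<omega> * Z n \<omega>))" "expectation (\<lambda>\<omega>. f n \<omega> * (S n \<omega> * Z n \<omega>)) = 0"
      using indep_var_integrable[OF iv2 int SZ] indep_var_lebesgue_integral[OF iv2 int SZ] mean by auto
    have e: "(S (Suc n) \<omega>)\<^sup>2 = (S n \<omega>)\<^sup>2 + (W n \<omega>)\<^sup>2 + (2 * (u n \<omega> * S n \<omega>) + 2 * (f n \<omega> * (S n \<omega> * Z n \<omega>)))" for \<omega>
      unfolding SS[OF n] power2_sum by (simp add: W_def algebra_simps)
    have "expectation (\<lambda>\<omega>. (S (Suc n) \<omega>)\<^sup>2) = expectation (\<lambda>\<omega>. (S n \<omega>)\<^sup>2) + expectation (\<lambda>\<omega>. (W n \<omega>)\<^sup>2)"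
      unfolding e using I W uS fSZ by simp
    also have "\<dots> \<le> (2 * \<tau> + 4 * s\<^sup>2) * (\<Sum>i<n. \<Sum>j<n. (q i j)\<^sup>2) + (2 * \<tau> * (q n n)\<^sup>2 + 8 * s\<^sup>2 * (\<Sum>j<n. (q n j)\<^sup>2))"
      using I(4) W2 by (rule add_mono)
    also have "\<dots> \<le> (2 * \<tau> + 4 * s\<^sup>2) * ((\<Sum>i<n. \<Sum>j<n. (q i j)\<^sup>2) + (q n n)\<^sup>2 + 2 * (\<Sum>j<n. (q n j)\<^sup>2))"
    proof -
      have "\<tau> \<ge> 0" unfolding m4(2)[of 0, symmetric] by simp
      hence "0 \<le> \<tau> * (\<Sum>j<n. (q n j)\<^sup>2)" "0 \<le> s\<^sup>2 * (q n n)\<^sup>2" by (auto intro!: mult_nonneg_nonneg sum_nonneg)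
      thus ?thesis by (simp add: algebra_simps)
    qed
    also have "(\<Sum>i<n. \<Sum>j<n. (q i j)\<^sup>2) + (q n n)\<^sup>2 + 2 * (\<Sum>j<n. (q n j)\<^sup>2) = (\<Sum>i<Suc n. \<Sum>j<Suc n. (q i j)\<^sup>2)"
    proof -
      have "(\<Sum>i<n. (q i n)\<^sup>2) = (\<Sum>j<n. (q n j)\<^sup>2)" using q n by (intro sum.cong) auto
      thus ?thesis by (simp add: sum.distrib)
    qed
    finally have "expectation (\<lambda>\<omega>. (S (Suc n) \<omega>)\<^sup>2) \<le> (2 * \<tau> + 4 * s\<^sup>2) * (\<Sum>i<Suc n. \<Sum>j<Suc n. (q i j)\<^sup>2)" .
    moreover have "integrable M (\<lambda>\<omega>. (S (Suc n) \<omega>)\<^sup>2)"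
      unfolding e using I W uS fSZ by auto
    moreover have "integrable M (S (Suc n))" "expectation (S (Suc n)) = 0"
      using I W by (simp_all add: SS[OF n, abs_def] cong: Bochner_Integration.integral_cong Bochner_Integration.integrable_cong)
    ultimately show ?case by blast
  qed (simp add: S0)
  from this[of N] show "integrable M (S N)" "integrable M (\<lambda>\<omega>. (S N \<omega>)\<^sup>2)" "expectation (S N) = 0"
    "expectation (\<lambda>\<omega>. (S N \<omega>)\<^sup>2) \<le> (2 * \<tau> + 4 * s\<^sup>2) * (\<Sum>i<N. \<Sum>j<N. (q i j)\<^sup>2)" by auto
qed

end

section \<open>Convergence in probability and a maximal inequality\<close>

context prob_space
begin

text \<open>The exceptional sets are only required to be contained in small events, so \<open>Z\<close> need not be measurable.\<close>

lemma converges_in_probI: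
  assumes "\<And>\<epsilon> \<delta>. \<epsilon> > 0 \<Longrightarrow> \<delta> > 0 \<Longrightarrow>
    eventually (\<lambda>n. \<exists>B\<in>events. prob B < \<delta> \<and> (\<forall>\<omega>\<in>space M - B. \<bar>Z n \<omega> - c\<bar> \<le> \<epsilon>)) sequentially"
  shows "converges_in_prob M Z c"
  unfolding converges_in_prob_def
proof (intro allI impI tendstoI)
  fix \<epsilon> \<delta> :: real assume "\<epsilon> > 0" "\<delta> > 0"
  from assms[OF this]
  show "eventually (\<lambda>n. dist (measure M {\<omega> \<in> space M. \<bar>Z n \<omega> - c\<bar> > \<epsilon>}) 0 < \<delta>) sequentially"
  proof eventually_elim
    case (elim n)
    then obtain B where B: "B \<in> events" "prob B < \<delta>" "\<forall>\<omega>\<in>space M - B. \<bar>Z n \<omega> - c\<bar> \<le> \<epsilon>" by blast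
    have "{\<omega> \<in> space M. \<bar>Z n \<omega> - c\<bar> > \<epsilon>} \<subseteq> B" using B(3) by (auto simp: not_le[symmetric])
    hence "measure M {\<omega> \<in> space M. \<bar>Z n \<omega> - c\<bar> > \<epsilon>} \<le> prob B" using B(1) by (rule finite_measure_mono)
    thus ?case using B(2) by simp
  qed
qed

lemma indep_vars_shift:
  assumes "indep_vars (\<lambda>_. borel) e {1::nat..}"
  shows "indep_vars (\<lambda>_. borel) (\<lambda>i. e (Suc i)) UNIV"
proof -
  have "indep_vars (\<lambda>j. PiM {Suc j} (\<lambda>_. borel)) (\<lambda>j \<omega>. restrict (\<lambda>i. e i \<omega>) {Suc j}) UNIV"
    by (rule indep_vars_restrict[OF assms]) (auto simp: disjoint_family_on_def)
  hence "indep_vars (\<lambda>_. borel) (\<lambda>j \<omega>. (\<lambda>g. g (Suc j)) (restrict (\<lambda>i. e i \<omega>) {Suc j})) UNIV"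
    by (rule indep_vars_compose2) (auto intro!: measurable_component_singleton)
  thus ?thesis by simp
qed

text \<open>A maximal inequality for a family that is nondecreasing in its index, whose second moment around
  \<open>s d\<^sub>m\<close> is at most \<open>C d\<^sub>m\<close>. Chebyshev bounds summed over all indices
  may grow logarithmically. Instead, within each dyadic block
  \<open>2\<^sup>j \<le> d\<^sub>m < 2\<^sup>j\<^sup>+\<^sup>1\<close> the largest index controls the others, and the Chebyshev bounds
  \<open>O(C / (a\<^sup>2 2\<^sup>j))\<close> for these are summable.\<close>

lemma monotone_process_maximal_inequality:
  fixes S :: "nat \<Rightarrow> 'a \<Rightarrow> real" and d :: "nat \<Rightarrow> nat"
  assumes J: "finite J" and d1: "\<And>m. m \<in> J \<Longrightarrow> d m \<ge> 1"
    and S_mono: "\<And>l m \<omega>. l \<in> J \<Longrightarrow> m \<in> J \<Longrightarrow> l \<le> m \<Longrightarrow> \<omega> \<in> space M \<Longrightarrow> S l \<omega> \<le> S m \<omega>"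
    and S_meas: "\<And>m. m \<in> J \<Longrightarrow> S m \<in> borel_measurable M"
    and S_int: "\<And>m. m \<in> J \<Longrightarrow> integrable M (\<lambda>\<omega>. (S m \<omega> - s * real (d m))\<^sup>2)"
    and S_var: "\<And>m. m \<in> J \<Longrightarrow> expectation (\<lambda>\<omega>. (S m \<omega> - s * real (d m))\<^sup>2) \<le> C * real (d m)"
    and a: "a > 0" "a \<ge> 8 * s" and C: "C \<ge> 0"
  shows "prob (\<Union>m\<in>J. {\<omega> \<in> space M. 2 * S m \<omega> \<ge> a * real (d m)}) \<le> 128 * C / a\<^sup>2"
proof -
  define Jb where "Jb j = {m \<in> J. 2 ^ j \<le> d m \<and> d m < 2 ^ Suc j}" for j
  define top where "top j = Max (Jb j)" for j
  define B where "B j = (if Jb j = {} then {} else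
    {\<omega> \<in> space M. (S (top j) \<omega> - s * real (d (top j)))\<^sup>2 \<ge> (a / 8 * real (d (top j)))\<^sup>2})" for j
  \<comment> \<open>Any bound on the block indices will do, as the estimate is uniform in \<open>L\<close>.\<close>
  define L where "L = Suc (\<Sum>m\<in>J. d m)"
  have finJb: "finite (Jb j)" for j using J by (simp add: Jb_def)
  have top: "top j \<in> Jb j" if "Jb j \<noteq> {}" for j
    using Max_in[OF finJb that] by (simp add: top_def)
  have topJ: "top j \<in> J" if "Jb j \<noteq> {}" for j using top[OF that] by (simp add: Jb_def)
  have Bev: "B j \<in> events" for j
    using S_meas[OF topJ, of j] by (auto simp: B_def)
  have PB: "prob (B j) \<le> 64 * C / a\<^sup>2 * (1 / 2) ^ j" for j
  proof (cases "Jb j = {}")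
    case False
    let ?d = "real (d (top j))"
    have d: "?d \<ge> 2 ^ j" using top[OF False] unfolding Jb_def
      by (metis (mono_tags, lifting) mem_Collect_eq of_nat_le_iff of_nat_numeral of_nat_power)
    have dpos: "?d > 0" using d by (smt (verit) zero_less_power)
    have "prob (B j) \<le> expectation (\<lambda>\<omega>. (S (top j) \<omega> - s * ?d)\<^sup>2) / (a / 8 * ?d)\<^sup>2"
      unfolding B_def using False dpos a S_int[OF topJ[OF False]]
      by (simp, intro integral_Markov_inequality_measure[where A = "{}"]) auto
    also have "\<dots> \<le> (C * ?d) / (a / 8 * ?d)\<^sup>2"
      using S_var[OF topJ[OF False]] by (intro divide_right_mono) auto
    also have "\<dots> = 64 * C / a\<^sup>2 * (1 / ?d)"
      using dpos a by (simp add: power2_eq_square field_simps)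
    also have "\<dots> \<le> 64 * C / a\<^sup>2 * (1 / 2 ^ j)"
      using d C by (intro mult_left_mono divide_left_mono) (use dpos in auto)
    finally show ?thesis by (simp add: power_one_over)
  qed (use C in \<open>simp add: B_def\<close>)
  have sub: "(\<Union>m\<in>J. {\<omega> \<in> space M. 2 * S m \<omega> \<ge> a * real (d m)}) \<subseteq> (\<Union>j\<in>{..<L}. B j)"
  proof
    fix \<omega> assume "\<omega> \<in> (\<Union>m\<in>J. {\<omega> \<in> space M. 2 * S m \<omega> \<ge> a * real (d m)})"
    then obtain m where m: "m \<in> J" "\<omega> \<in> space M" "2 * S m \<omega> \<ge> a * real (d m)" by blast
    obtain j where j: "2 ^ j \<le> d m" "d m < 2 ^ (j + 1)"
      using ex_power_ivl1[of 2 "d m"] d1[OF m(1)] by auto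
    hence mj: "m \<in> Jb j" using m by (simp add: Jb_def)
    hence ne: "Jb j \<noteq> {}" by blast
    let ?t = "top j"
    have "m \<le> ?t" unfolding top_def using finJb mj by (rule Max_ge)
    hence "S m \<omega> \<le> S ?t \<omega>" using S_mono m topJ[OF ne] by blast
    moreover have "real (d ?t) \<le> 2 * real (d m)"
    proof -
      have "d ?t < 2 ^ Suc j" using top[OF ne] by (simp add: Jb_def)
      also have "\<dots> \<le> 2 * d m" using j by simp
      finally show ?thesis by linarith
    qed
    hence "a * real (d ?t) \<le> 2 * (a * real (d m))" using a mult_left_mono[of "real (d ?t)" "2 * real (d m)" a] by simp
    moreover have "8 * s * real (d ?t) \<le> a * real (d ?t)" using a by (intro mult_right_mono) auto
    ultimately have "a / 8 * real (d ?t) \<le> S ?t \<omega> - s * real (d ?t)" using m(3) by simp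
    hence "(a / 8 * real (d ?t))\<^sup>2 \<le> (S ?t \<omega> - s * real (d ?t))\<^sup>2"
      using a by (intro power_mono) auto
    hence "\<omega> \<in> B j" using ne m by (simp add: B_def)
    moreover have "j < L"
    proof -
      have "j < 2 ^ j" by simp
      also have "\<dots> \<le> d m" by (rule j)
      also have "d m \<le> (\<Sum>m\<in>J. d m)" using J m by (intro member_le_sum) auto
      finally show ?thesis by (simp add: L_def)
    qed
    ultimately show "\<omega> \<in> (\<Union>j\<in>{..<L}. B j)" by blast
  qed
  have "prob (\<Union>m\<in>J. {\<omega> \<in> space M. 2 * S m \<omega> \<ge> a * real (d m)}) \<le> prob (\<Union>j\<in>{..<L}. B j)"
    using sub Bev by (intro finite_measure_mono) auto
  also have "\<dots> \<le> (\<Sum>j<L. prob (B j))"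
    using Bev by (intro finite_measure_subadditive_finite) auto
  also have "\<dots> \<le> (\<Sum>j<L. 64 * C / a\<^sup>2 * (1 / 2) ^ j)" by (intro sum_mono PB)
  also have "\<dots> = 64 * C / a\<^sup>2 * (\<Sum>j<L. (1 / 2) ^ j)" by (simp only: sum_distrib_left)
  also have "\<dots> \<le> 64 * C / a\<^sup>2 * 2"
  proof (intro mult_left_mono)
    have "(\<Sum>j<L. (1 / 2 :: real) ^ j) = 2 * (1 - (1 / 2) ^ L)"
      by (simp add: sum_gp_strict)
    thus "(\<Sum>j<L. (1 / 2 :: real) ^ j) \<le> 2" by simp
  qed (use C in auto)
  finally show ?thesis by simp
qed

end

section \<open>The regression model at a fixed sample size\<close>

text \<open>The regression model with nested candidates, as in the theorem.\<close>

locale model_averaging = prob_space \<Omega> for \<Omega> :: "'a measure" +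
  fixes e :: "nat \<Rightarrow> 'a \<Rightarrow> real"
    and x :: "nat \<Rightarrow> nat \<Rightarrow> real"
    and \<beta> :: "nat \<Rightarrow> nat \<Rightarrow> real"
    and M M0 :: "nat \<Rightarrow> nat"
    and k :: "nat \<Rightarrow> nat \<Rightarrow> nat"
    and \<phi> :: "nat \<Rightarrow> real"
    and w_hat :: "nat \<Rightarrow> 'a \<Rightarrow> nat \<Rightarrow> real"
    and \<sigma> \<zeta> :: real
    and n0 :: nat
  assumes indep: "indep_vars (\<lambda>_. borel) e {1..}"
    and ident: "\<And>i. i \<ge> 1 \<Longrightarrow> distr \<Omega> borel (e i) = distr \<Omega> borel (e 1)"
    and mean_e: "\<And>i. i \<ge> 1 \<Longrightarrow> expectation (e i) = 0"
    and var_e: "\<And>i. i \<ge> 1 \<Longrightarrow> expectation (\<lambda>\<omega>. (e i \<omega>)\<^sup>2) = \<sigma>\<^sup>2"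
    and sigma_pos: "\<sigma>\<^sup>2 > 0"
    and zeta_pos: "\<zeta> > 0"
    and moment_e: "\<And>i. i \<ge> 1 \<Longrightarrow> integrable \<Omega> (\<lambda>\<omega>. \<bar>e i \<omega>\<bar> powr (4 + \<zeta>))"
    and nested: "\<And>n. n \<ge> n0 \<Longrightarrow>
          0 < k n 1 \<and> strict_mono_on {1..M n} (k n) \<and> k n (M n) < n"
    and full_rank: "\<And>n m. n \<ge> n0 \<Longrightarrow> m \<in> {1..M n} \<Longrightarrow>
          vec_space.rank n (design x n (k n m)) = k n m"
    and true_index: "\<And>n. n \<ge> n0 \<Longrightarrow> M0 n \<ge> 1 \<and> M n > M0 n + 1"
    and true_model: "\<And>n. n \<ge> n0 \<Longrightarrow>
          (\<exists>j\<in>{1..k n (M0 n + 1)} - {1..k n (M0 n)}. \<beta> n j \<noteq> 0)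
          \<and> (\<forall>j>k n (M0 n + 1). \<beta> n j = 0)"
    and w_hat_rv: "\<And>n m. n \<ge> n0 \<Longrightarrow> m \<in> {1..M n} \<Longrightarrow>
          (\<lambda>\<omega>. w_hat n \<omega> m) \<in> borel_measurable \<Omega>"
    and w_hat_argmin: "\<And>n \<omega>. n \<ge> n0 \<Longrightarrow> \<omega> \<in> space \<Omega> \<Longrightarrow>
          is_arg_min (weight_crit x n (M n) (k n) (\<phi> n) (response_vec x (\<beta> n) e n \<omega>))
            (\<lambda>w. w \<in> weights (M n)) (w_hat n \<omega>)"
    and C1: "(\<lambda>n. sq_norm2 (mean_vec x (\<beta> n) n) / real n) \<in> O(\<lambda>_. 1)"
    and C2: "\<exists>\<kappa>0>0. \<forall>n\<ge>n0.
          lambda_min ((1 / real n) \<cdot>\<^sub>m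
            (transpose_mat (design x n (k n (M0 n + 1))) * design x n (k n (M0 n + 1)))) \<ge> \<kappa>0"
    and C3: "\<exists>c1 c2. 0 < c1 \<and> c1 < c2 \<and>
          (\<lambda>n. measure \<Omega> {\<omega> \<in> space \<Omega>.
              c1 \<le> sigma2_hat x n (k n (M n)) (response_vec x (\<beta> n) e n \<omega>) / \<sigma>\<^sup>2
              \<and> sigma2_hat x n (k n (M n)) (response_vec x (\<beta> n) e n \<omega>) / \<sigma>\<^sup>2 \<le> c2})
            \<longlonglongrightarrow> 1"
begin

text \<open>The candidate projections, extended by 0 at index 0; the given \<open>k n 0\<close> plays no role.\<close>

definition proj :: "nat \<Rightarrow> nat \<Rightarrow> real mat" where
  "proj n m = (if m = 0 then 0\<^sub>m n n else proj_mat (design x n (k n m)))"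

text \<open>The model dimensions, extended by 0 at index 0.\<close>

definition rk :: "nat \<Rightarrow> nat \<Rightarrow> real" where
  "rk n m = (if m = 0 then 0 else real (k n m))"

text \<open>The index of the true model.\<close>

definition true_idx :: "nat \<Rightarrow> nat" where "true_idx n = M0 n + 1"

text \<open>Mean, error and response vector, variance estimate, the dimension that model \<open>l\<close> adds to model
  \<open>l - 1\<close>, and the energy of \<open>v\<close> in the added directions (for \<open>l \<ge> 1\<close>).\<close>

abbreviation "mu n \<equiv> mean_vec x (\<beta> n) n"
abbreviation "err n \<omega> \<equiv> error_vec e n \<omega>"
abbreviation "resp n \<omega> \<equiv> response_vec x (\<beta> n) e n \<omega>"
abbreviation "sig2 n \<omega> \<equiv> sigma2_hat x n (k n (M n)) (resp n \<omega>)"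
abbreviation "dim_inc n l \<equiv> rk n l - rk n (l - 1)"
abbreviation "blk n l v \<equiv> quad (proj n l) v - quad (proj n (l - 1)) v"

lemma vec_carriers [simp]: "mu n \<in> carrier_vec n" "err n \<omega> \<in> carrier_vec n" "resp n \<omega> \<in> carrier_vec n"
  by (auto simp: mean_vec_def error_vec_def response_vec_def)

lemma design_carrier [simp]: "design x n p \<in> carrier_mat n p"
  by (simp add: design_def)

lemma true_idx_bounds: "n \<ge> n0 \<Longrightarrow> 2 \<le> true_idx n \<and> true_idx n < M n \<and> true_idx n - 1 = M0 n"
  using true_index[of n] by (auto simp: true_idx_def)

lemma k_less: "n \<ge> n0 \<Longrightarrow> 1 \<le> l \<Longrightarrow> l < m \<Longrightarrow> m \<le> M n \<Longrightarrow> k n l < k n m"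
  using nested[of n] strict_mono_onD[of "{1..M n}" "k n" l m] by auto

lemma rk_less:
  assumes "n \<ge> n0" "l < m" "m \<le> M n"
  shows "rk n l < rk n m"
proof (cases "l = 0")
  case True
  have "0 < k n m" using nested[of n] k_less[of n 1 m] assms by (cases "m = 1") auto
  thus ?thesis using True assms by (simp add: rk_def)
qed (use k_less assms in \<open>auto simp: rk_def\<close>)

lemma dim_inc_nonneg: "n \<ge> n0 \<Longrightarrow> l \<in> {1..M n} \<Longrightarrow> dim_inc n l \<ge> 0"
  using rk_less[of n "l - 1" l] by auto

lemma nested_proj: 
  assumes n: "n \<ge> n0"
  shows "nested_projections n (M n) (proj n)"
proof
  fix m assume m: "m \<le> M n"
  show "proj n m \<in> carrier_mat n n"
    using proj_mat_carrier[OF design_carrier full_rank[OF n, of m]] m by (auto simp: proj_def)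
  show "transpose_mat (proj n m) = proj n m"
    using proj_mat_symmetric[OF design_carrier full_rank[OF n, of m]] m by (auto simp: proj_def)
  fix l assume l: "l \<le> m"
  show "proj n m * proj n l = proj n l"
  proof (cases "l = 0")
    case True
    thus ?thesis using \<open>proj n m \<in> carrier_mat n n\<close> by (simp add: proj_def)
  next
    case False
    have le: "k n l \<le> k n m" using k_less[OF n, of l m] False l m by (cases "l = m") auto
    have "proj_mat (design x n (k n m)) * proj_mat (design x n (k n l)) = proj_mat (design x n (k n l))"
      using False l m
      by (intro mult_proj_mat_nested[OF design_carrier full_rank[OF n] design_carrier full_rank[OF n] _ design_prefix[OF le]]) auto
    thus ?thesis using False l by (simp add: proj_def)
  qed
qed (simp add: proj_def)

lemma mat_trace_proj: "n \<ge> n0 \<Longrightarrow> m \<le> M n \<Longrightarrow> mat_trace (proj n m) = rk n m"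
  using mat_trace_proj_mat[OF design_carrier full_rank[of n m]]
  by (auto simp: proj_def rk_def mat_trace_def)

lemma avg_mat_eq: "n \<ge> n0 \<Longrightarrow> avg_mat x n (M n) (k n) w = nested_projections.average n (M n) (proj n) w"
  by (auto simp: avg_mat_def nested_projections.average_def[OF nested_proj] proj_def intro!: cong_mat sum.cong)

lemma mean_vec_eq:
  assumes n: "n \<ge> n0"
  shows "mu n = design x n (k n (true_idx n)) *\<^sub>v Matrix.vec (k n (true_idx n)) (\<lambda>j. \<beta> n (Suc j))"
proof (rule eq_vecI)
  fix i assume "i < dim_vec (design x n (k n (true_idx n)) *\<^sub>v Matrix.vec (k n (true_idx n)) (\<lambda>j. \<beta> n (Suc j)))"
  hence i: "i < n" by (simp add: design_def)
  have "(\<Sum>j. \<beta> n (Suc j) * x (Suc i) (Suc j)) = (\<Sum>j<k n (true_idx n). \<beta> n (Suc j) * x (Suc i) (Suc j))"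
    using true_model[OF n] by (intro suminf_finite) (auto simp: true_idx_def)
  thus "mu n $ i = (design x n (k n (true_idx n)) *\<^sub>v Matrix.vec (k n (true_idx n)) (\<lambda>j. \<beta> n (Suc j))) $ i"
    using i by (simp add: mean_vec_def design_def scalar_prod_def atLeast0LessThan mult.commute)
qed (simp add: mean_vec_def design_def)

lemma proj_mean:
  assumes n: "n \<ge> n0"
  shows "proj n (true_idx n) *\<^sub>v mu n = mu n"
proof -
  let ?X = "design x n (k n (true_idx n))" and ?b = "Matrix.vec (k n (true_idx n)) (\<lambda>j. \<beta> n (Suc j))"
  have t: "true_idx n \<in> {1..M n}" using true_idx_bounds[OF n] by auto
  note fr = full_rank[OF n t]
  have P: "proj_mat ?X \<in> carrier_mat n n" by (rule proj_mat_carrier[OF design_carrier fr])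
  have "proj n (true_idx n) *\<^sub>v mu n = proj_mat ?X *\<^sub>v (?X *\<^sub>v ?b)"
    using t mean_vec_eq[OF n] by (simp add: proj_def)
  also have "\<dots> = (proj_mat ?X * ?X) *\<^sub>v ?b"
    using P by (subst assoc_mult_mat_vec[of _ n n _ "k n (true_idx n)"]) auto
  also have "\<dots> = mu n" using proj_mat_mult_self[OF design_carrier fr] mean_vec_eq[OF n] by simp
  finally show ?thesis .
qed

lemma proj_mean_above:
  assumes n: "n \<ge> n0" and "true_idx n \<le> m" "m \<le> M n"
  shows "proj n m *\<^sub>v mu n = mu n"
proof -
  interpret nested_projections n "M n" "proj n" by (rule nested_proj[OF n])
  show ?thesis using fixed_mono[OF assms(2,3) vec_carriers(1) proj_mean[OF n]] .
qed

text \<open>The part of the mean that the largest under-fitted model misses is \<open>X v\<close>, where \<open>X\<close> is the design of the true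
  model and \<open>v\<close> agrees with the true coefficients in the positions beyond that under-fitted model.\<close>

lemma signal_lower_bound:
  obtains \<kappa> where "\<kappa> > 0" "\<And>n. n \<ge> n0 \<Longrightarrow> real n * \<kappa> * eta (\<beta> n) (k n) (M0 n) \<le> blk n (true_idx n) (mu n)"
proof -
  obtain \<kappa> where \<kappa>: "\<kappa> > 0" "\<And>n. n \<ge> n0 \<Longrightarrow> lambda_min ((1 / real n) \<cdot>\<^sub>m
            (transpose_mat (design x n (k n (true_idx n))) * design x n (k n (true_idx n)))) \<ge> \<kappa>"
    using C2 unfolding true_idx_def by blast
  have "real n * \<kappa> * eta (\<beta> n) (k n) (M0 n) \<le> blk n (true_idx n) (mu n)" if n: "n \<ge> n0" for n
  proof -
    interpret NP: nested_projections n "M n" "proj n" by (rule nested_proj[OF n])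
    let ?K = "k n (true_idx n)" and ?L = "k n (M0 n)"
    let ?X = "design x n ?K" and ?b = "Matrix.vec ?K (\<lambda>j. \<beta> n (Suc j))"
    let ?E = "mat ?K ?L (\<lambda>(i, j). if i = j then 1 else 0) :: real mat"
    have t: "2 \<le> true_idx n" "true_idx n < M n" "M0 n = true_idx n - 1" "M0 n \<in> {1..M n}"
      using true_idx_bounds[OF n] true_index[OF n] by auto
    have LK: "?L < ?K" using k_less[OF n, of "M0 n" "true_idx n"] t by auto
    have npos: "n > 0" using nested[OF n] by simp
    obtain C where C: "C \<in> carrier_mat ?L n" "proj_mat (design x n ?L) = design x n ?L * C"
      using proj_mat_factor[OF design_carrier full_rank[OF n t(4)]] by blast
    define c where "c = C *\<^sub>v mu n"
    have c: "c \<in> carrier_vec ?L" using C by (simp add: c_def mult_mat_vec_carrier)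
    have E: "?E \<in> carrier_mat ?K ?L" by simp
    have "proj n (M0 n) *\<^sub>v mu n = design x n ?L *\<^sub>v c"
      using t C by (simp add: proj_def c_def assoc_mult_mat_vec[of _ n ?L _ n])
    also have "\<dots> = (?X * ?E) *\<^sub>v c" using design_prefix[of ?L ?K x n] LK by simp
    also have "\<dots> = ?X *\<^sub>v (?E *\<^sub>v c)" by (rule assoc_mult_mat_vec[OF design_carrier E c])
    finally have low: "proj n (M0 n) *\<^sub>v mu n = ?X *\<^sub>v (?E *\<^sub>v c)" .
    define v where "v = ?b - ?E *\<^sub>v c"
    have v: "v \<in> carrier_vec ?K" 
      unfolding v_def by (intro minus_carrier_vec mult_mat_vec_carrier[OF E c]) auto
    have "?X *\<^sub>v v = ?X *\<^sub>v ?b - ?X *\<^sub>v (?E *\<^sub>v c)"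
      unfolding v_def by (rule mult_minus_distrib_mat_vec[OF design_carrier _ mult_mat_vec_carrier[OF E c]]) simp
    hence Xv: "?X *\<^sub>v v = mu n - proj n (M0 n) *\<^sub>v mu n"
      using low mean_vec_eq[OF n] by simp
    have "v $ j = \<beta> n (Suc j)" if "j \<in> {?L..<?K}" for j
    proof -
      have "(?E *\<^sub>v c) $ j = (\<Sum>l\<in>{0..<?L}. (if j = l then 1 else 0) * c $ l)"
        using that c by (simp add: scalar_prod_def)
      also have "\<dots> = 0" using that by (intro sum.neutral) auto
      finally show ?thesis using that c by (simp add: v_def)
    qed
    hence "(\<Sum>j\<in>{?L..<?K}. (\<beta> n (Suc j))\<^sup>2) = (\<Sum>j\<in>{?L..<?K}. (v $ j)\<^sup>2)" by simp
    also have "\<dots> \<le> sq_norm2 v" unfolding sq_norm2_sum[OF v] by (intro sum_mono2) auto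
    finally have "(\<Sum>j\<in>{?L..<?K}. (\<beta> n (Suc j))\<^sup>2) \<le> sq_norm2 v" .
    moreover have "eta (\<beta> n) (k n) (M0 n) = (\<Sum>j\<in>{?L..<?K}. (\<beta> n (Suc j))\<^sup>2)"
      unfolding eta_def using LK
      by (intro sum.reindex_bij_witness[of _ Suc "\<lambda>j. j - 1"]) (auto simp: true_idx_def)
    ultimately have eta: "eta (\<beta> n) (k n) (M0 n) \<le> sq_norm2 v" by simp
    let ?G = "transpose_mat ?X * ?X"
    have G: "?G \<in> carrier_mat ?K ?K" using design_carrier by (metis mult_carrier_mat transpose_carrier_mat)
    have Gt: "transpose_mat ?G = ?G"
      by (subst transpose_mult[of _ ?K n _ ?K]) auto
    have "transpose_mat ((1 / real n) \<cdot>\<^sub>m ?G) = (1 / real n) \<cdot>\<^sub>m ?G"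
    proof -
      have "transpose_mat ((1 / real n) \<cdot>\<^sub>m ?G) = (1 / real n) \<cdot>\<^sub>m transpose_mat ?G"
        using G by (intro eq_matI) auto
      thus ?thesis using Gt by simp
    qed
    hence "lambda_min ((1 / real n) \<cdot>\<^sub>m ?G) * sq_norm2 v \<le> quad ((1 / real n) \<cdot>\<^sub>m ?G) v"
      using G v by (intro lambda_min_le_quad[of _ ?K]) auto
    also have "\<dots> = (1 / real n) * quad ?G v"
      using G v by (simp add: quad_def smult_mat_mat_vec[OF G v])
    also have "quad ?G v = sq_norm2 (?X *\<^sub>v v)" by (rule quad_gram[OF design_carrier v])
    also have "?X *\<^sub>v v = proj n (true_idx n) *\<^sub>v mu n - proj n (M0 n) *\<^sub>v mu n"
      using Xv proj_mean[OF n] by simp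
    also have "sq_norm2 \<dots> = blk n (true_idx n) (mu n)"
      using NP.quad_diff[of "M0 n" "true_idx n" "mu n"] t by simp
    finally have "lambda_min ((1 / real n) \<cdot>\<^sub>m ?G) * sq_norm2 v \<le> (1 / real n) * blk n (true_idx n) (mu n)" .
    moreover have "\<kappa> * sq_norm2 v \<le> lambda_min ((1 / real n) \<cdot>\<^sub>m ?G) * sq_norm2 v"
      using \<kappa>(2)[OF n] sq_norm2_nonneg by (intro mult_right_mono) auto
    moreover have "\<kappa> * eta (\<beta> n) (k n) (M0 n) \<le> \<kappa> * sq_norm2 v"
      using eta \<kappa>(1) by (intro mult_left_mono) auto
    ultimately have "\<kappa> * eta (\<beta> n) (k n) (M0 n) \<le> (1 / real n) * blk n (true_idx n) (mu n)" by linarith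
    thus ?thesis using npos by (simp add: field_simps)
  qed
  thus thesis using that \<kappa>(1) by blast
qed

lemma eta_pos: 
  assumes n: "n \<ge> n0"
  shows "eta (\<beta> n) (k n) (M0 n) > 0"
proof -
  obtain j where j: "j \<in> {1..k n (M0 n + 1)} - {1..k n (M0 n)}" "\<beta> n j \<noteq> 0"
    using true_model[OF n] by blast
  thus ?thesis unfolding eta_def by (intro sum_pos2[of _ j]) auto
qed

lemma weight_crit_eq:
  assumes n: "n \<ge> n0"
  shows "weight_crit x n (M n) (k n) c (resp n \<omega>) w
    = sq_norm2 (resp n \<omega>) - quad (proj n (M n)) (resp n \<omega>)
      + tail_crit (M n) (c * sig2 n \<omega>) (dim_inc n) (\<lambda>l. blk n l (resp n \<omega>)) (tail_weight (M n) w)"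
proof -
  interpret nested_projections n "M n" "proj n" by (rule nested_proj[OF n])
  have "(1\<^sub>m n - average w) *\<^sub>v resp n \<omega> = resp n \<omega> - average w *\<^sub>v resp n \<omega>"
    by (subst minus_mult_distrib_mat_vec[of _ n n]) auto
  moreover have "(\<Sum>m = 1..M n. w m * real (k n m)) = (\<Sum>l = 1..M n. tail_weight (M n) w l * dim_inc n l)"
  proof -
    have "(\<Sum>m = 1..M n. w m * real (k n m)) = (\<Sum>m = 1..M n. w m * rk n m)"
      by (intro sum.cong) (auto simp: rk_def)
    thus ?thesis using sum_weights_Abel[of "rk n" w "M n"] by (simp add: rk_def)
  qed
  ultimately show ?thesis
    by (simp add: weight_crit_def avg_mat_eq[OF n] sq_norm2_residual tail_crit_def sum.distrib sum_distrib_left mult.assoc)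
qed

lemma w_hat_weights: "n \<ge> n0 \<Longrightarrow> \<omega> \<in> space \<Omega> \<Longrightarrow> w_hat n \<omega> \<in> weights (M n)"
  using w_hat_argmin by (auto simp: is_arg_min_def)

lemma w_hat_crit_min:
  assumes n: "n \<ge> n0" and \<omega>: "\<omega> \<in> space \<Omega>" and h: "tail_seq (M n) h"
  shows "tail_crit (M n) (\<phi> n * sig2 n \<omega>) (dim_inc n) (\<lambda>l. blk n l (resp n \<omega>)) (tail_weight (M n) (w_hat n \<omega>))
    \<le> tail_crit (M n) (\<phi> n * sig2 n \<omega>) (dim_inc n) (\<lambda>l. blk n l (resp n \<omega>)) h"
proof -
  obtain w where w: "w \<in> weights (M n)" "\<And>l. l \<in> {1..M n} \<Longrightarrow> tail_weight (M n) w l = h l"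
    using tail_seq_obtain_weights[OF h] by blast
  have "weight_crit x n (M n) (k n) (\<phi> n) (resp n \<omega>) (w_hat n \<omega>) \<le> weight_crit x n (M n) (k n) (\<phi> n) (resp n \<omega>) w"
    using w_hat_argmin[OF n \<omega>] w(1) by (auto simp: is_arg_min_def not_less)
  hence "tail_crit (M n) (\<phi> n * sig2 n \<omega>) (dim_inc n) (\<lambda>l. blk n l (resp n \<omega>)) (tail_weight (M n) (w_hat n \<omega>))
    \<le> tail_crit (M n) (\<phi> n * sig2 n \<omega>) (dim_inc n) (\<lambda>l. blk n l (resp n \<omega>)) (tail_weight (M n) w)"
    unfolding weight_crit_eq[OF n] by simp
  also have "\<dots> = tail_crit (M n) (\<phi> n * sig2 n \<omega>) (dim_inc n) (\<lambda>l. blk n l (resp n \<omega>)) h"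
    unfolding tail_crit_def using w(2) by (intro sum.cong) auto
  finally show ?thesis .
qed

text \<open>The common fourth moment of the errors.\<close>

abbreviation "\<tau> \<equiv> expectation (\<lambda>\<omega>. (e 1 \<omega>) ^ 4)"

lemma e_measurable: "i \<ge> 1 \<Longrightarrow> e i \<in> borel_measurable \<Omega>"
  using indep by (auto simp: indep_vars_def)

lemma fourth_moment:
  assumes i: "i \<ge> 1"
  shows "integrable \<Omega> (\<lambda>\<omega>. (e i \<omega>) ^ 4)" "expectation (\<lambda>\<omega>. (e i \<omega>) ^ 4) = \<tau>"
proof -
  note [measurable] = e_measurable[OF i] e_measurable[of 1]
  have bound: "\<bar>t\<bar> ^ 4 \<le> 1 + \<bar>t\<bar> powr (4 + \<zeta>)" for t :: real
  proof (cases "\<bar>t\<bar> \<le> 1")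
    case True
    hence "\<bar>t\<bar> ^ 4 \<le> 1" by (intro power_le_one) auto
    thus ?thesis by (smt (verit) powr_ge_zero)
  next
    case False
    hence "\<bar>t\<bar> ^ 4 = \<bar>t\<bar> powr 4" by (simp add: powr_numeral)
    also have "\<dots> \<le> \<bar>t\<bar> powr (4 + \<zeta>)" using False zeta_pos by (intro powr_mono) auto
    finally show ?thesis by simp
  qed
  show "integrable \<Omega> (\<lambda>\<omega>. (e i \<omega>) ^ 4)"
  proof (rule Bochner_Integration.integrable_bound)
    show "integrable \<Omega> (\<lambda>\<omega>. 1 + \<bar>e i \<omega>\<bar> powr (4 + \<zeta>))" using moment_e[OF i] by auto
    show "AE \<omega> in \<Omega>. norm ((e i \<omega>) ^ 4) \<le> norm (1 + \<bar>e i \<omega>\<bar> powr (4 + \<zeta>))"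
      using bound by (intro always_eventually allI) (simp add: power_abs add_nonneg_nonneg)
  qed measurable
  have "expectation (\<lambda>\<omega>. (e j \<omega>) ^ 4) = (\<integral>t. t ^ 4 \<partial>distr \<Omega> borel (e j))" if "j \<ge> 1" for j
    by (subst integral_distr) (auto simp: e_measurable[OF that])
  thus "expectation (\<lambda>\<omega>. (e i \<omega>) ^ 4) = \<tau>" using ident[OF i] i by simp
qed

lemma tau_nonneg: "\<tau> \<ge> 0" by simp

text \<open>The quadratic form of a difference of projections in the errors has mean \<open>\<sigma>\<^sup>2\<close> times the difference of dimensions,
  and variance at most a constant multiple of that difference.\<close>

lemma noise_block:
  assumes n: "n \<ge> n0" and lm: "l \<le> m" "m \<le> M n"
  defines "S \<equiv> \<lambda>\<omega>. quad (proj n m) (err n \<omega>) - quad (proj n l) (err n \<omega>)"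
  shows "S \<in> borel_measurable \<Omega>" "integrable \<Omega> S" "expectation S = \<sigma>\<^sup>2 * (rk n m - rk n l)"
    "integrable \<Omega> (\<lambda>\<omega>. (S \<omega> - \<sigma>\<^sup>2 * (rk n m - rk n l))\<^sup>2)"
    "expectation (\<lambda>\<omega>. (S \<omega> - \<sigma>\<^sup>2 * (rk n m - rk n l))\<^sup>2) \<le> (2 * \<tau> + 4 * (\<sigma>\<^sup>2)\<^sup>2) * (rk n m - rk n l)"
proof -
  interpret NP: nested_projections n "M n" "proj n" by (rule nested_proj[OF n])
  define q where "q i j = (proj n m - proj n l) $$ (i, j)" for i j
  have c: "proj n m \<in> carrier_mat n n" "proj n l \<in> carrier_mat n n" using NP.carrier lm by auto
  have S: "S \<omega> = (\<Sum>i<n. \<Sum>j<n. q i j * (e (Suc i) \<omega> * e (Suc j) \<omega>))" for \<omega>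
    unfolding S_def NP.quad_diff_sum[OF lm vec_carriers(2)] q_def by (intro sum.cong refl) (simp add: error_vec_def)
  have q: "q i j = q j i" if "i < n" "j < n" for i j
    unfolding q_def using that c lm NP.symmetric_entries[of m i j] NP.symmetric_entries[of l i j] by simp
  have tr: "(\<Sum>i<n. q i i) = rk n m - rk n l"
    using c lm mat_trace_proj[OF n, of m] mat_trace_proj[OF n, of l]
    by (simp add: q_def mat_trace_def sum_subtractf)
  have fr: "(\<Sum>i<n. \<Sum>j<n. (q i j)\<^sup>2) = rk n m - rk n l"
    unfolding q_def using NP.frobenius_diff[OF lm] mat_trace_proj[OF n, of m] mat_trace_proj[OF n, of l] lm by simp
  note Q = quadratic_form_moments[OF indep_vars_shift[OF indep] fourth_moment mean_e var_e, of n q, OF _ _ _ _ q,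
      unfolded tr fr S[symmetric], simplified]
  show "S \<in> borel_measurable \<Omega>" unfolding S using e_measurable by measurable
  have "integrable \<Omega> (\<lambda>\<omega>. (S \<omega> - \<sigma>\<^sup>2 * (rk n m - rk n l)) + \<sigma>\<^sup>2 * (rk n m - rk n l))"
    using Q(1) by (rule Bochner_Integration.integrable_add) simp
  thus int: "integrable \<Omega> S" by simp
  show "expectation S = \<sigma>\<^sup>2 * (rk n m - rk n l)"
    using Q(3) int by (simp add: prob_space)
  show "integrable \<Omega> (\<lambda>\<omega>. (S \<omega> - \<sigma>\<^sup>2 * (rk n m - rk n l))\<^sup>2)" by (rule Q(2))
  show "expectation (\<lambda>\<omega>. (S \<omega> - \<sigma>\<^sup>2 * (rk n m - rk n l))\<^sup>2) \<le> (2 * \<tau> + 4 * (\<sigma>\<^sup>2)\<^sup>2) * (rk n m - rk n l)"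
    using Q(4) by simp
qed

lemma noise_linear:
  assumes u: "u \<in> carrier_vec n"
  shows "integrable \<Omega> (\<lambda>\<omega>. u \<bullet> err n \<omega>)" "expectation (\<lambda>\<omega>. u \<bullet> err n \<omega>) = 0"
proof -
  have int: "integrable \<Omega> (\<lambda>\<omega>. e (Suc i) \<omega>)" for i
  proof (rule square_integrable_imp_integrable)
    show "integrable \<Omega> (\<lambda>\<omega>. (e (Suc i) \<omega>)\<^sup>2)"
    proof (rule square_integrable_imp_integrable)
      show "integrable \<Omega> (\<lambda>\<omega>. ((e (Suc i) \<omega>)\<^sup>2)\<^sup>2)" using fourth_moment(1)[of "Suc i"] by simp
    qed (use e_measurable in measurable)
  qed (use e_measurable in simp)
  have eq: "u \<bullet> err n \<omega> = (\<Sum>i<n. u $ i * e (Suc i) \<omega>)" for \<omega>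
    by (simp add: scalar_prod_def error_vec_def atLeast0LessThan)
  show "integrable \<Omega> (\<lambda>\<omega>. u \<bullet> err n \<omega>)" unfolding eq using int by auto
  show "expectation (\<lambda>\<omega>. u \<bullet> err n \<omega>) = 0"
    unfolding eq using int mean_e by (simp add: Bochner_Integration.integral_sum)
qed

text \<open>The cross term of the loss is linear in the errors and has mean 0.\<close>

lemma risk_eq:
  assumes n: "n \<ge> n0"
  shows "risk \<Omega> x (\<beta> n) e n (M n) (k n) w
    = (\<Sum>l = 1..M n. (1 - tail_weight (M n) w l)\<^sup>2 * blk n l (mu n))
      + \<sigma>\<^sup>2 * (\<Sum>l = 1..M n. (tail_weight (M n) w l)\<^sup>2 * dim_inc n l)"
proof -
  interpret NP: nested_projections n "M n" "proj n" by (rule nested_proj[OF n])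
  let ?g = "tail_weight (M n) w"
  let ?r = "mu n - NP.average w *\<^sub>v mu n"
  have r: "?r \<in> carrier_vec n" by auto
  have "proj n (M n) *\<^sub>v mu n = mu n" using proj_mean_above[OF n, of "M n"] true_idx_bounds[OF n] by simp
  hence "quad (proj n (M n)) (mu n) = sq_norm2 (mu n)" by (simp add: quad_def sq_norm2_def)
  hence bias: "sq_norm2 ?r = (\<Sum>l = 1..M n. (1 - ?g l)\<^sup>2 * blk n l (mu n))"
    using NP.sq_norm2_residual[of "mu n" w] by simp
  have loss: "loss x (\<beta> n) n (M n) (k n) (resp n \<omega>) w
      = sq_norm2 ?r - 2 * (\<Sum>m = 1..M n. w m * ((proj n m *\<^sub>v ?r) \<bullet> err n \<omega>))
        + (\<Sum>l = 1..M n. (?g l)\<^sup>2 * blk n l (err n \<omega>))" for \<omega>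
    unfolding loss_def avg_mat_eq[OF n] response_vec_def by (rule NP.sq_norm2_average_loss) auto
  have lin: "integrable \<Omega> (\<lambda>\<omega>. (\<Sum>m = 1..M n. w m * ((proj n m *\<^sub>v ?r) \<bullet> err n \<omega>)))"
    "expectation (\<lambda>\<omega>. (\<Sum>m = 1..M n. w m * ((proj n m *\<^sub>v ?r) \<bullet> err n \<omega>))) = 0"
  proof -
    have I: "integrable \<Omega> (\<lambda>\<omega>. w m * ((proj n m *\<^sub>v ?r) \<bullet> err n \<omega>))"
      "expectation (\<lambda>\<omega>. w m * ((proj n m *\<^sub>v ?r) \<bullet> err n \<omega>)) = 0" if "m \<in> {1..M n}" for m
      using noise_linear[of "proj n m *\<^sub>v ?r" n] NP.mult_vec_carrier[of m ?r] r that by auto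
    show "integrable \<Omega> (\<lambda>\<omega>. (\<Sum>m = 1..M n. w m * ((proj n m *\<^sub>v ?r) \<bullet> err n \<omega>)))"
      using I by (intro Bochner_Integration.integrable_sum) auto
    show "expectation (\<lambda>\<omega>. (\<Sum>m = 1..M n. w m * ((proj n m *\<^sub>v ?r) \<bullet> err n \<omega>))) = 0"
    proof (subst Bochner_Integration.integral_sum)
      show "(\<Sum>m = 1..M n. expectation (\<lambda>\<omega>. w m * ((proj n m *\<^sub>v ?r) \<bullet> err n \<omega>))) = 0"
        using I(2) by (intro sum.neutral) blast
    qed (rule I(1))
  qed
  have quadr: "integrable \<Omega> (\<lambda>\<omega>. (\<Sum>l = 1..M n. (?g l)\<^sup>2 * blk n l (err n \<omega>)))"
    "expectation (\<lambda>\<omega>. (\<Sum>l = 1..M n. (?g l)\<^sup>2 * blk n l (err n \<omega>))) = \<sigma>\<^sup>2 * (\<Sum>l = 1..M n. (?g l)\<^sup>2 * dim_inc n l)"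
  proof -
    have I: "integrable \<Omega> (\<lambda>\<omega>. (?g l)\<^sup>2 * blk n l (err n \<omega>))"
      "expectation (\<lambda>\<omega>. (?g l)\<^sup>2 * blk n l (err n \<omega>)) = \<sigma>\<^sup>2 * ((?g l)\<^sup>2 * dim_inc n l)" if "l \<in> {1..M n}" for l
      using noise_block(2,3)[OF n, of "l - 1" l] that by auto
    show "integrable \<Omega> (\<lambda>\<omega>. (\<Sum>l = 1..M n. (?g l)\<^sup>2 * blk n l (err n \<omega>)))"
      using I by (intro Bochner_Integration.integrable_sum) auto
    show "expectation (\<lambda>\<omega>. (\<Sum>l = 1..M n. (?g l)\<^sup>2 * blk n l (err n \<omega>))) = \<sigma>\<^sup>2 * (\<Sum>l = 1..M n. (?g l)\<^sup>2 * dim_inc n l)"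
      using I by (subst Bochner_Integration.integral_sum) (auto simp: sum_distrib_left intro!: sum.cong)
  qed
  show ?thesis unfolding risk_def loss using lin quadr bias by (simp add: prob_space)
qed

lemma sig2_measurable:
  assumes n: "n \<ge> n0"
  shows "(\<lambda>\<omega>. sig2 n \<omega>) \<in> borel_measurable \<Omega>"
proof -
  let ?Q = "1\<^sub>m n - proj_mat (design x n (k n (M n)))"
  have "proj_mat (design x n (k n (M n))) \<in> carrier_mat n n"
    using proj_mat_carrier[OF design_carrier full_rank[OF n, of "M n"]] true_idx_bounds[OF n] by auto
  hence Q: "?Q \<in> carrier_mat n n" by auto
  have [measurable]: "(\<lambda>\<omega>. resp n \<omega> $ i) \<in> borel_measurable \<Omega>" if "i < n" for i
  proof -
    have "resp n \<omega> $ i = mu n $ i + e (Suc i) \<omega>" for \<omega>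
      using that by (simp add: response_vec_def error_vec_def)
    thus ?thesis using e_measurable[of "Suc i"] by simp
  qed
  show ?thesis unfolding sigma2_hat_def scalar_prod_mult_mat_vec_sum[OF Q vec_carriers(3,3)] by measurable
qed

section \<open>Asymptotic risk\<close>

text \<open>The ratio \<open>(k\<^sub>T - k\<^sub>1) / (n \<eta>)\<close> of the number of coefficients beyond the first model to the signal strength.\<close>

definition noise_signal :: "nat \<Rightarrow> real" where
  "noise_signal n = (rk n (true_idx n) - rk n 1) / (real n * eta (\<beta> n) (k n) (M0 n))"

text \<open>The infimum of the risk, the risk at the selected weights, the bias up to the true index, and the excess
  variance beyond it.\<close>

abbreviation "opt_risk n \<equiv> (INF w\<in>weights (M n). risk \<Omega> x (\<beta> n) e n (M n) (k n) w)"
abbreviation "sel_risk n \<omega> \<equiv> risk \<Omega> x (\<beta> n) e n (M n) (k n) (w_hat n \<omega>)"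
abbreviation "underfit n w \<equiv> (\<Sum>l = 1..true_idx n. (1 - tail_weight (M n) w l)\<^sup>2 * blk n l (mu n))"
abbreviation "overfit n w \<equiv> (\<Sum>l = Suc (true_idx n)..M n. (tail_weight (M n) w l)\<^sup>2 * dim_inc n l)"

lemma blk_nonneg: "n \<ge> n0 \<Longrightarrow> l \<in> {1..M n} \<Longrightarrow> v \<in> carrier_vec n \<Longrightarrow> blk n l v \<ge> 0"
  using nested_projections.block_nonneg[OF nested_proj] by blast

lemma blk_mean_above:
  assumes n: "n \<ge> n0" and l: "l \<in> {Suc (true_idx n)..M n}"
  shows "blk n l (mu n) = 0"
proof -
  have "true_idx n \<le> l" "true_idx n \<le> l - 1" "l - 1 \<le> M n" "l \<le> M n" using l by auto
  thus ?thesis using proj_mean_above[OF n] by (simp add: quad_def)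
qed

lemma risk_split:
  assumes n: "n \<ge> n0"
  shows "risk \<Omega> x (\<beta> n) e n (M n) (k n) w
    = underfit n w + \<sigma>\<^sup>2 * (\<Sum>l = 1..true_idx n. (tail_weight (M n) w l)\<^sup>2 * dim_inc n l) + \<sigma>\<^sup>2 * overfit n w"
proof -
  have s: "(\<Sum>l = 1..M n. f l) = (\<Sum>l = 1..true_idx n. f l) + (\<Sum>l = Suc (true_idx n)..M n. f l)" for f :: "nat \<Rightarrow> real"
  proof -
    have "{1..M n} = {1..true_idx n} \<union> {Suc (true_idx n)..M n}" using true_idx_bounds[OF n] by auto
    thus ?thesis by (simp only: sum.union_disjoint finite_atLeastAtMost) (subst sum.union_disjoint, auto)
  qed
  show ?thesis unfolding risk_eq[OF n] s using blk_mean_above[OF n] by (simp add: algebra_simps)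
qed

lemma overfit_nonneg: "n \<ge> n0 \<Longrightarrow> overfit n w \<ge> 0"
  using dim_inc_nonneg by (intro sum_nonneg mult_nonneg_nonneg) auto

lemma dim_inc_sum:
  assumes n: "n \<ge> n0"
  shows "(\<Sum>l = 2..true_idx n. dim_inc n l) = rk n (true_idx n) - rk n 1" "(\<Sum>l = 1..true_idx n. dim_inc n l) = rk n (true_idx n)"
proof -
  show "(\<Sum>l = 2..true_idx n. dim_inc n l) = rk n (true_idx n) - rk n 1"
    using sum_telescope_range[of 1 "true_idx n" "rk n"] true_idx_bounds[OF n] by (simp add: numeral_2_eq_2)
  show "(\<Sum>l = 1..true_idx n. dim_inc n l) = rk n (true_idx n)"
    by (rule sum_telescope_from_0[of "rk n"]) (simp add: rk_def)
qed

lemma rk_true_idx_pos: "n \<ge> n0 \<Longrightarrow> rk n (true_idx n) > 0"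
  using rk_less[of n 0 "true_idx n"] true_idx_bounds[of n] by (simp add: rk_def)

lemma dim_excess_bounds:
  assumes n: "n \<ge> n0"
  shows "0 < rk n (true_idx n) - rk n 1" "rk n (true_idx n) - rk n 1 \<le> rk n (true_idx n)"
  using rk_less[OF n, of 1 "true_idx n"] true_idx_bounds[OF n] by (auto simp: rk_def)

lemma sample_size_pos: "n \<ge> n0 \<Longrightarrow> n > 0" using nested[of n] by simp

lemma noise_signal_nonneg: "n \<ge> n0 \<Longrightarrow> noise_signal n \<ge> 0"
  using dim_excess_bounds[of n] eta_pos[of n] unfolding noise_signal_def by auto

text \<open>Fix a constant for the signal bound; it exists by \<open>signal_lower_bound\<close>.\<close>

context
  fixes \<kappa> :: real
  assumes kappa: "\<kappa> > 0" "\<And>n. n \<ge> n0 \<Longrightarrow> real n * \<kappa> * eta (\<beta> n) (k n) (M0 n) \<le> blk n (true_idx n) (mu n)"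
begin

text \<open>The bound uses only the terms of the risk up to the true index. The remaining one, the excess variance,
  stays available for the necessity direction.\<close>

lemma risk_up_to_true_lower:
  assumes n: "n \<ge> n0" and w: "w \<in> weights (M n)"
  shows "underfit n w + \<sigma>\<^sup>2 * (\<Sum>l = 1..true_idx n. (tail_weight (M n) w l)\<^sup>2 * dim_inc n l)
    \<ge> \<sigma>\<^sup>2 * rk n (true_idx n) * (1 - \<sigma>\<^sup>2 / \<kappa> * noise_signal n)"
proof -
  have T: "2 \<le> true_idx n" "true_idx n \<le> M n" using true_idx_bounds[OF n] by auto
  have a: "real n * \<kappa> * eta (\<beta> n) (k n) (M0 n) > 0" using kappa eta_pos[OF n] sample_size_pos[OF n] by simp
  have "\<sigma>\<^sup>2 * (dim_inc n 1 + (rk n (true_idx n) - rk n 1)) * (1 - \<sigma>\<^sup>2 * (rk n (true_idx n) - rk n 1) / (real n * \<kappa> * eta (\<beta> n) (k n) (M0 n)))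
    \<le> underfit n w + \<sigma>\<^sup>2 * (\<Sum>l = 1..true_idx n. (tail_weight (M n) w l)\<^sup>2 * dim_inc n l)"
    by (rule truncated_risk_lower_bound[where g = "tail_weight (M n) w" and d = "dim_inc n" and \<theta> = "\<lambda>l. blk n l (mu n)" and M = "M n"])
      (use tail_seq_tail_weight[OF w] T dim_inc_nonneg[OF n] blk_nonneg[OF n] a kappa(2)[OF n] dim_inc_sum[OF n] in auto)
  moreover have "dim_inc n 1 + (rk n (true_idx n) - rk n 1) = rk n (true_idx n)" by (simp add: rk_def)
  moreover have "\<sigma>\<^sup>2 * (rk n (true_idx n) - rk n 1) / (real n * \<kappa> * eta (\<beta> n) (k n) (M0 n)) = \<sigma>\<^sup>2 / \<kappa> * noise_signal n"
    by (simp add: noise_signal_def)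
  ultimately show ?thesis by metis
qed

lemma risk_lower:
  assumes n: "n \<ge> n0" and w: "w \<in> weights (M n)"
  shows "risk \<Omega> x (\<beta> n) e n (M n) (k n) w \<ge> \<sigma>\<^sup>2 * rk n (true_idx n) * (1 - \<sigma>\<^sup>2 / \<kappa> * noise_signal n)"
  using risk_up_to_true_lower[OF n w] overfit_nonneg[OF n, of w] sigma_pos unfolding risk_split[OF n]
  by (smt (verit) mult_nonneg_nonneg)

lemma opt_risk_bounds:
  assumes n: "n \<ge> n0"
  shows "opt_risk n \<le> \<sigma>\<^sup>2 * rk n (true_idx n)"
    and "opt_risk n \<ge> \<sigma>\<^sup>2 * rk n (true_idx n) * (1 - \<sigma>\<^sup>2 / \<kappa> * noise_signal n)"
    and "w \<in> weights (M n) \<Longrightarrow> opt_risk n \<le> risk \<Omega> x (\<beta> n) e n (M n) (k n) w"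
proof -
  have bdd: "bdd_below (risk \<Omega> x (\<beta> n) e n (M n) (k n) ` weights (M n))"
    using risk_lower[OF n] unfolding bdd_below_def by blast
  show le: "opt_risk n \<le> risk \<Omega> x (\<beta> n) e n (M n) (k n) w" if "w \<in> weights (M n)" for w
    by (rule cINF_lower[OF bdd that])
  have "tail_seq (M n) (\<lambda>l. if l \<le> true_idx n then 1 else 0)"
    using true_idx_bounds[OF n] by (auto simp: tail_seq_def)
  from tail_seq_obtain_weights[OF this] obtain w where w: "w \<in> weights (M n)"
    "\<And>l. l \<in> {1..M n} \<Longrightarrow> tail_weight (M n) w l = (if l \<le> true_idx n then 1 else 0)"
    by blast
  have "underfit n w = 0" using w(2) true_idx_bounds[OF n] by (intro sum.neutral) auto
  moreover have "overfit n w = 0" using w(2) by (intro sum.neutral) auto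
  moreover have "(\<Sum>l = 1..true_idx n. (tail_weight (M n) w l)\<^sup>2 * dim_inc n l) = (\<Sum>l = 1..true_idx n. dim_inc n l)"
    using w(2) true_idx_bounds[OF n] by (intro sum.cong) auto
  ultimately have "risk \<Omega> x (\<beta> n) e n (M n) (k n) w = \<sigma>\<^sup>2 * rk n (true_idx n)"
    unfolding risk_split[OF n] by (simp add: dim_inc_sum(2)[OF n, simplified])
  thus "opt_risk n \<le> \<sigma>\<^sup>2 * rk n (true_idx n)" using le[OF w(1)] by simp
  show "opt_risk n \<ge> \<sigma>\<^sup>2 * rk n (true_idx n) * (1 - \<sigma>\<^sup>2 / \<kappa> * noise_signal n)"
    by (rule cINF_greatest) (use w risk_lower[OF n] in auto)
qed

lemma underfit_bound:
  assumes n: "n \<ge> n0" and \<omega>: "\<omega> \<in> space \<Omega>" and phi: "\<phi> n \<ge> 0"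
    and sig: "0 \<le> sig2 n \<omega>" "sig2 n \<omega> \<le> c"
    and noise: "quad (proj n (true_idx n)) (err n \<omega>) - quad (proj n 1) (err n \<omega>) \<le> K * (rk n (true_idx n) - rk n 1)"
    and K: "K \<ge> 0" "K * noise_signal n \<le> \<kappa> / 4"
  shows "underfit n (w_hat n \<omega>) \<le> rk n (true_idx n) *
    (8 * c\<^sup>2 / \<kappa> * ((\<phi> n)\<^sup>2 * noise_signal n) + 32 * K * c\<^sup>2 / \<kappa>\<^sup>2 * ((\<phi> n)\<^sup>2 * noise_signal n * noise_signal n))"
proof -
  interpret NP: nested_projections n "M n" "proj n" by (rule nested_proj[OF n])
  let ?N = "real n * eta (\<beta> n) (k n) (M0 n)"
  let ?D = "rk n (true_idx n) - rk n 1"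
  let ?\<nu> = "\<phi> n * sig2 n \<omega>"
  have N: "?N > 0" using eta_pos[OF n] sample_size_pos[OF n] by simp
  have "?N \<noteq> 0" using N by linarith
  hence D: "?D = noise_signal n * ?N" unfolding noise_signal_def by (metis nonzero_divide_eq_eq)
  have D0: "?D > 0" using dim_excess_bounds[OF n] by simp
  have T: "2 \<le> true_idx n" "true_idx n \<le> M n" using true_idx_bounds[OF n] by auto
  have a: "real n * \<kappa> * eta (\<beta> n) (k n) (M0 n) = \<kappa> * ?N" by simp
  have "underfit n (w_hat n \<omega>) \<le> 8 * ?\<nu>\<^sup>2 * ?D\<^sup>2 / (\<kappa> * ?N) + 32 * ?\<nu>\<^sup>2 * ?D\<^sup>2 * (K * ?D) / (\<kappa> * ?N)\<^sup>2"
  proof (rule underfit_bias_bound[where g = "tail_weight (M n) (w_hat n \<omega>)" and M = "M n" and d = "dim_inc n"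
        and Y = "\<lambda>l. blk n l (resp n \<omega>)" and \<epsilon> = "\<lambda>l. blk n l (err n \<omega>)"])
    show "tail_seq (M n) (tail_weight (M n) (w_hat n \<omega>))"
      by (rule tail_seq_tail_weight[OF w_hat_weights[OF n \<omega>]])
    show "blk n l (mu n) \<le> 2 * blk n l (resp n \<omega>) + 2 * blk n l (err n \<omega>)" if "l \<in> {2..true_idx n}" for l
      unfolding response_vec_def using that T by (intro NP.quad_diff_le_add) auto
    show "(\<Sum>l = 2..true_idx n. blk n l (err n \<omega>)) \<le> K * ?D"
      using noise sum_telescope_range[of 1 "true_idx n" "\<lambda>l. quad (proj n l) (err n \<omega>)"] T
      by (simp add: numeral_2_eq_2)
    show "K * ?D \<le> \<kappa> * ?N / 4"
      using mult_right_mono[OF K(2), of ?N] N unfolding D by (simp add: mult_ac)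
    show "\<kappa> * ?N \<le> blk n (true_idx n) (mu n)" using kappa(2)[OF n] unfolding a .
  qed (use T w_hat_crit_min[OF n \<omega>] phi sig dim_inc_nonneg[OF n] blk_nonneg[OF n] kappa N dim_inc_sum[OF n] a in auto)
  also have "\<dots> = ?D * (8 * (sig2 n \<omega>)\<^sup>2 / \<kappa> * ((\<phi> n)\<^sup>2 * noise_signal n)
      + 32 * K * (sig2 n \<omega>)\<^sup>2 / \<kappa>\<^sup>2 * ((\<phi> n)\<^sup>2 * noise_signal n * noise_signal n))"
  proof -
    have r: "noise_signal n = ?D / ?N" by (simp add: noise_signal_def)
    show ?thesis unfolding r using kappa N by (simp add: power2_eq_square field_simps)
  qed
  also have "\<dots> \<le> ?D * (8 * c\<^sup>2 / \<kappa> * ((\<phi> n)\<^sup>2 * noise_signal n)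
      + 32 * K * c\<^sup>2 / \<kappa>\<^sup>2 * ((\<phi> n)\<^sup>2 * noise_signal n * noise_signal n))"
    using D0 kappa K noise_signal_nonneg[OF n] sig
    by (intro mult_left_mono add_mono mult_right_mono divide_right_mono power_mono) auto
  also have "\<dots> \<le> rk n (true_idx n) * (8 * c\<^sup>2 / \<kappa> * ((\<phi> n)\<^sup>2 * noise_signal n)
      + 32 * K * c\<^sup>2 / \<kappa>\<^sup>2 * ((\<phi> n)\<^sup>2 * noise_signal n * noise_signal n))"
    using dim_excess_bounds[OF n] kappa K noise_signal_nonneg[OF n]
    by (intro mult_right_mono add_nonneg_nonneg mult_nonneg_nonneg divide_nonneg_nonneg) auto
  finally show ?thesis .
qed

text \<open>The assumptions on the penalty make the bias of the selected weights negligible, so risk optimality follows once the excess variance is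
  \<open>o(k\<^sub>T)\<close> off events of vanishing probability. The good event requires in addition that the variance estimate be
  within its bounds and that the error energy between the first and the true model be at most \<open>K\<close> times the
  difference of their dimensions; Markov's inequality makes the latter likely for large \<open>K\<close>.\<close>

lemma risk_optimalI:
  assumes phi: "eventually (\<lambda>n. \<phi> n \<ge> 0) sequentially"
    and r: "noise_signal \<longlonglongrightarrow> 0" "(\<lambda>n. (\<phi> n)\<^sup>2 * noise_signal n) \<longlonglongrightarrow> 0"
    and \<delta>: "\<delta> \<longlonglongrightarrow> 0"
    and Bev: "eventually (\<lambda>n. B n \<in> events) sequentially" and PB: "(\<lambda>n. prob (B n)) \<longlonglongrightarrow> 0"
    and over: "eventually (\<lambda>n. \<forall>\<omega>\<in>space \<Omega> - B n. overfit n (w_hat n \<omega>) \<le> \<delta> n * rk n (true_idx n)) sequentially"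
  shows "risk_optimal \<Omega> x \<beta> e M k w_hat"
  unfolding risk_optimal_def
proof (rule converges_in_probI)
  fix \<epsilon> p :: real assume \<epsilon>: "\<epsilon> > 0" and p: "p > 0"
  obtain c1 c2 where c: "0 < c1" "c1 < c2" and lim: "(\<lambda>n. prob {\<omega> \<in> space \<Omega>. c1 \<le> sig2 n \<omega> / \<sigma>\<^sup>2 \<and> sig2 n \<omega> / \<sigma>\<^sup>2 \<le> c2}) \<longlonglongrightarrow> 1"
    using C3 by blast
  define E1 where "E1 n = {\<omega> \<in> space \<Omega>. c1 \<le> sig2 n \<omega> / \<sigma>\<^sup>2 \<and> sig2 n \<omega> / \<sigma>\<^sup>2 \<le> c2}" for n
  \<comment> \<open>Large enough for the Markov bound \<open>\<sigma>\<^sup>2 / K\<close> to be below a third of the allowed probability.\<close>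
  define K where "K = 3 * \<sigma>\<^sup>2 / p + 1"
  have K: "K > 0" "\<sigma>\<^sup>2 / K < p / 3"
  proof -
    show "K > 0" unfolding K_def using p sigma_pos by (intro add_nonneg_pos) auto
    hence "K * p > 3 * \<sigma>\<^sup>2" unfolding K_def using p by (simp add: field_simps)
    thus "\<sigma>\<^sup>2 / K < p / 3" using \<open>K > 0\<close> by (simp add: field_simps)
  qed
  define Q where "Q n \<omega> = quad (proj n (true_idx n)) (err n \<omega>) - quad (proj n 1) (err n \<omega>)" for n \<omega>
  define B2 where "B2 n = {\<omega> \<in> space \<Omega>. Q n \<omega> \<ge> K * (rk n (true_idx n) - rk n 1)}" for n
  define c where "c = c2 * \<sigma>\<^sup>2"
  define \<alpha> where "\<alpha> n = (8 * c\<^sup>2 / \<kappa> * ((\<phi> n)\<^sup>2 * noise_signal n) + 32 * K * c\<^sup>2 / \<kappa>\<^sup>2 * ((\<phi> n)\<^sup>2 * noise_signal n * noise_signal n)) / \<sigma>\<^sup>2" for n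
  define \<rho> where "\<rho> n = \<sigma>\<^sup>2 / \<kappa> * noise_signal n" for n
  have \<alpha>: "\<alpha> \<longlonglongrightarrow> 0"
  proof -
    have "\<alpha> \<longlonglongrightarrow> (8 * c\<^sup>2 / \<kappa> * 0 + 32 * K * c\<^sup>2 / \<kappa>\<^sup>2 * (0 * 0)) / \<sigma>\<^sup>2"
      unfolding \<alpha>_def by (intro tendsto_intros r) (use sigma_pos in auto)
    thus ?thesis by simp
  qed
  have \<rho>: "\<rho> \<longlonglongrightarrow> 0"
    unfolding \<rho>_def by (rule tendsto_mult_right_zero[OF r(1)])
  have "(\<lambda>n. (1 + \<alpha> n + \<delta> n) / (1 - \<rho> n)) \<longlonglongrightarrow> (1 + 0 + 0) / (1 - 0)"
    by (intro tendsto_intros \<alpha> \<delta> \<rho>) auto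
  hence ev1: "eventually (\<lambda>n. (1 + \<alpha> n + \<delta> n) / (1 - \<rho> n) < 1 + \<epsilon>) sequentially"
    using \<epsilon> by (intro order_tendstoD(2)[of _ 1]) auto
  have ev2: "eventually (\<lambda>n. \<rho> n < 1) sequentially"
    using \<rho> by (rule order_tendstoD(2)) auto
  have ev3: "eventually (\<lambda>n. K * noise_signal n < \<kappa> / 4) sequentially"
    using tendsto_mult_right_zero[OF r(1), of K] kappa by (intro order_tendstoD(2)) auto
  have ev4: "eventually (\<lambda>n. prob (E1 n) > 1 - p / 3) sequentially"
    using lim p unfolding E1_def by (intro order_tendstoD(1)) auto
  have ev5: "eventually (\<lambda>n. prob (B n) < p / 3) sequentially"
    using PB p by (intro order_tendstoD(2)) auto
  show "eventually (\<lambda>n. \<exists>B\<in>events. prob B < p \<and> (\<forall>\<omega>\<in>space \<Omega> - B. \<bar>sel_risk n \<omega> / opt_risk n - 1\<bar> \<le> \<epsilon>)) sequentially"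
    using ev1 ev2 ev3 ev4 ev5 phi Bev over eventually_ge_at_top[of n0]
  proof eventually_elim
    case (elim n)
    note n = \<open>n0 \<le> n\<close>
    note [measurable] = sig2_measurable[OF n]
    have E1: "E1 n \<in> events" unfolding E1_def by measurable
    have NQ: "Q n \<in> borel_measurable \<Omega>" "integrable \<Omega> (Q n)" "expectation (Q n) = \<sigma>\<^sup>2 * (rk n (true_idx n) - rk n 1)"
      using noise_block(1-3)[OF n, of 1 "true_idx n"] true_idx_bounds[OF n] by (auto simp: Q_def[abs_def])
    note [measurable] = NQ(1)
    have B2: "B2 n \<in> events" unfolding B2_def by measurable
    have D: "rk n (true_idx n) - rk n 1 > 0" using dim_excess_bounds[OF n] by simp
    have "prob (B2 n) \<le> expectation (Q n) / (K * (rk n (true_idx n) - rk n 1))"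
      unfolding B2_def
    proof (rule integral_Markov_inequality_measure[where A = "{}"])
      show "AE \<omega> in \<Omega>. 0 \<le> Q n \<omega>"
        using nested_projections.quad_mono[OF nested_proj[OF n], of 1 "true_idx n"] true_idx_bounds[OF n]
        by (auto simp: Q_def)
    qed (use NQ K D in auto)
    also have "\<dots> = \<sigma>\<^sup>2 / K" using NQ(3) D by simp
    finally have PB2: "prob (B2 n) < p / 3" using K by linarith
    let ?B = "(space \<Omega> - E1 n) \<union> B2 n \<union> B n"
    have "prob ?B \<le> prob (space \<Omega> - E1 n) + prob (B2 n) + prob (B n)"
      using E1 B2 elim by (smt (verit) measure_Un_le sets.Un sets.compl_sets)
    also have "prob (space \<Omega> - E1 n) = 1 - prob (E1 n)" using E1 by (rule prob_compl)
    finally have PBn: "prob ?B < p" using elim PB2 by linarith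
    have "\<bar>sel_risk n \<omega> / opt_risk n - 1\<bar> \<le> \<epsilon>" if "\<omega> \<in> space \<Omega> - ?B" for \<omega>
    proof -
      have \<omega>: "\<omega> \<in> space \<Omega>" "\<omega> \<in> E1 n" "\<omega> \<notin> B2 n" "\<omega> \<notin> B n" using that by auto
      let ?w = "w_hat n \<omega>"
      have w: "?w \<in> weights (M n)" by (rule w_hat_weights[OF n \<omega>(1)])
      have sig: "0 \<le> sig2 n \<omega>" "sig2 n \<omega> \<le> c"
      proof -
        have "c1 \<le> sig2 n \<omega> / \<sigma>\<^sup>2" "sig2 n \<omega> / \<sigma>\<^sup>2 \<le> c2" using \<omega>(2) by (auto simp: E1_def)
        hence "c1 * \<sigma>\<^sup>2 \<le> sig2 n \<omega>" "sig2 n \<omega> \<le> c"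
          unfolding c_def pos_le_divide_eq[OF sigma_pos] pos_divide_le_eq[OF sigma_pos] by auto
        moreover have "c1 * \<sigma>\<^sup>2 > 0" using \<open>0 < c1\<close> sigma_pos by (rule mult_pos_pos)
        ultimately show "0 \<le> sig2 n \<omega>" "sig2 n \<omega> \<le> c" by linarith+
      qed
      have "underfit n ?w \<le> rk n (true_idx n) * (\<sigma>\<^sup>2 * \<alpha> n)"
      proof -
        have "underfit n ?w \<le> rk n (true_idx n) * (8 * c\<^sup>2 / \<kappa> * ((\<phi> n)\<^sup>2 * noise_signal n) + 32 * K * c\<^sup>2 / \<kappa>\<^sup>2 * ((\<phi> n)\<^sup>2 * noise_signal n * noise_signal n))"
          by (rule underfit_bound[OF n \<omega>(1) _ sig]) (use elim \<omega> K in \<open>auto simp: B2_def Q_def\<close>)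
        also have "8 * c\<^sup>2 / \<kappa> * ((\<phi> n)\<^sup>2 * noise_signal n) + 32 * K * c\<^sup>2 / \<kappa>\<^sup>2 * ((\<phi> n)\<^sup>2 * noise_signal n * noise_signal n) = \<sigma>\<^sup>2 * \<alpha> n"
          using sigma_pos by (simp add: \<alpha>_def)
        finally show ?thesis .
      qed
      moreover have "(\<Sum>l = 1..true_idx n. (tail_weight (M n) ?w l)\<^sup>2 * dim_inc n l) \<le> rk n (true_idx n)"
      proof -
        have "(\<Sum>l = 1..true_idx n. (tail_weight (M n) ?w l)\<^sup>2 * dim_inc n l) \<le> (\<Sum>l = 1..true_idx n. 1 * dim_inc n l)"
          using tail_seq_bounds[OF tail_seq_tail_weight[OF w]] dim_inc_nonneg[OF n] true_idx_bounds[OF n]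
          by (intro sum_mono mult_right_mono power_le_one) auto
        thus ?thesis using dim_inc_sum(2)[OF n] by simp
      qed
      hence "\<sigma>\<^sup>2 * (\<Sum>l = 1..true_idx n. (tail_weight (M n) ?w l)\<^sup>2 * dim_inc n l) \<le> \<sigma>\<^sup>2 * rk n (true_idx n)"
        by (intro mult_left_mono) auto
      moreover have "\<sigma>\<^sup>2 * overfit n ?w \<le> \<sigma>\<^sup>2 * (\<delta> n * rk n (true_idx n))"
        using elim \<omega> by (intro mult_left_mono) auto
      ultimately have R: "sel_risk n \<omega> \<le> (\<sigma>\<^sup>2 * rk n (true_idx n)) * (1 + \<alpha> n + \<delta> n)"
        unfolding risk_split[OF n] by (simp add: algebra_simps)
      have pos: "\<sigma>\<^sup>2 * rk n (true_idx n) > 0" using sigma_pos rk_true_idx_pos[OF n] by simp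
      have Ilow: "\<sigma>\<^sup>2 * rk n (true_idx n) * (1 - \<rho> n) \<le> opt_risk n" unfolding \<rho>_def by (rule opt_risk_bounds(2)[OF n])
      moreover have "\<sigma>\<^sup>2 * rk n (true_idx n) * (1 - \<rho> n) > 0" by (rule mult_pos_pos[OF pos]) (use elim in auto)
      ultimately have I0: "opt_risk n > 0" by linarith
      have ge: "sel_risk n \<omega> \<ge> opt_risk n" by (rule opt_risk_bounds(3)[OF n w])
      have "sel_risk n \<omega> / opt_risk n \<le> sel_risk n \<omega> / (\<sigma>\<^sup>2 * rk n (true_idx n) * (1 - \<rho> n))"
        using Ilow ge I0 mult_pos_pos[OF I0 \<open>\<sigma>\<^sup>2 * rk n (true_idx n) * (1 - \<rho> n) > 0\<close>]
        by (intro divide_left_mono) linarith+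
      also have "\<dots> \<le> ((\<sigma>\<^sup>2 * rk n (true_idx n)) * (1 + \<alpha> n + \<delta> n)) / (\<sigma>\<^sup>2 * rk n (true_idx n) * (1 - \<rho> n))"
        using R \<open>\<sigma>\<^sup>2 * rk n (true_idx n) * (1 - \<rho> n) > 0\<close> by (intro divide_right_mono) auto
      also have "\<dots> = (1 + \<alpha> n + \<delta> n) / (1 - \<rho> n)" using pos by (intro mult_divide_mult_cancel_left) linarith
      finally have "sel_risk n \<omega> / opt_risk n < 1 + \<epsilon>" using elim by linarith
      moreover have "sel_risk n \<omega> / opt_risk n \<ge> 1" using ge I0 by simp
      ultimately show ?thesis by simp
    qed
    moreover have "?B \<in> events" using E1 B2 elim by auto
    ultimately show ?case using PBn by blast
  qed
qed

lemma sel_risk_measurable: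
  assumes n: "n \<ge> n0"
  shows "sel_risk n \<in> borel_measurable \<Omega>"
proof -
  have [measurable]: "(\<lambda>\<omega>. tail_weight (M n) (w_hat n \<omega>) l) \<in> borel_measurable \<Omega>" if "l \<in> {1..M n}" for l
    unfolding tail_weight_def using w_hat_rv[OF n] that by (intro borel_measurable_sum) auto
  show ?thesis unfolding risk_eq[OF n, abs_def] by measurable
qed

text \<open>The excess variance is the amount by which the risk exceeds the terms up to the true index, which are already
  asymptotically as large as the infimum of the risk.\<close>

lemma overfit_vanishes:
  assumes opt: "risk_optimal \<Omega> x \<beta> e M k w_hat" and r: "noise_signal \<longlonglongrightarrow> 0"
  shows "converges_in_prob \<Omega> (\<lambda>n \<omega>. \<Sum>m\<in>{M0 n + 2..M n}.
    (w_hat n \<omega> m)\<^sup>2 * (real (k n m) / real (k n (M0 n + 1)) - 1)) 0"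
proof (rule converges_in_probI)
  fix \<epsilon> p :: real assume \<epsilon>: "\<epsilon> > 0" and p: "p > 0"
  define \<rho> where "\<rho> n = \<sigma>\<^sup>2 / \<kappa> * noise_signal n" for n
  have \<rho>: "\<rho> \<longlonglongrightarrow> 0"
    unfolding \<rho>_def by (rule tendsto_mult_right_zero[OF r(1)])
  have ev1: "eventually (\<lambda>n. \<rho> n < \<epsilon> / 2) sequentially" 
    using \<rho> by (rule order_tendstoD(2)) (use \<epsilon> in auto)
  have ev2: "eventually (\<lambda>n. \<rho> n < 1) sequentially"
    using \<rho> by (rule order_tendstoD(2)) auto
  define B where "B n = {\<omega> \<in> space \<Omega>. \<bar>sel_risk n \<omega> / opt_risk n - 1\<bar> > \<epsilon> / 2}" for n
  have "(\<lambda>n. prob (B n)) \<longlonglongrightarrow> 0"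
    using opt[unfolded risk_optimal_def converges_in_prob_def, rule_format, of "\<epsilon> / 2"] \<epsilon>
    unfolding B_def by simp
  hence ev3: "eventually (\<lambda>n. prob (B n) < p) sequentially" using p by (rule order_tendstoD(2))
  show "eventually (\<lambda>n. \<exists>B\<in>events. prob B < p \<and> (\<forall>\<omega>\<in>space \<Omega> - B.
    \<bar>(\<Sum>m\<in>{M0 n + 2..M n}. (w_hat n \<omega> m)\<^sup>2 * (real (k n m) / real (k n (M0 n + 1)) - 1)) - 0\<bar> \<le> \<epsilon>)) sequentially"
    using ev1 ev2 ev3 eventually_ge_at_top[of n0]
  proof eventually_elim
    case (elim n)
    note n = \<open>n0 \<le> n\<close>
    note [measurable] = sel_risk_measurable[OF n]
    have B: "B n \<in> events" unfolding B_def by measurable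
    have "\<bar>(\<Sum>m\<in>{M0 n + 2..M n}. (w_hat n \<omega> m)\<^sup>2 * (real (k n m) / real (k n (M0 n + 1)) - 1)) - 0\<bar> \<le> \<epsilon>"
      if \<omega>: "\<omega> \<in> space \<Omega> - B n" for \<omega>
    proof -
      let ?w = "w_hat n \<omega>" and ?kT = "rk n (true_idx n)"
      have w: "?w \<in> weights (M n)" using w_hat_weights[OF n] \<omega> by auto
      have kT: "?kT > 0" by (rule rk_true_idx_pos[OF n])
      define Z where "Z = (\<Sum>m = Suc (true_idx n)..M n. (?w m)\<^sup>2 * (rk n m - ?kT))"
      have Zeq: "(\<Sum>m\<in>{M0 n + 2..M n}. (?w m)\<^sup>2 * (real (k n m) / real (k n (M0 n + 1)) - 1)) = Z / ?kT"
        unfolding Z_def sum_divide_distrib using kT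
        by (intro sum.cong) (auto simp: rk_def true_idx_def field_simps)
      have Z0: "Z \<ge> 0" unfolding Z_def using rk_less[OF n, of "true_idx n"]
        by (intro sum_nonneg mult_nonneg_nonneg) (auto simp: less_imp_le)
      have "Z \<le> overfit n ?w"
        unfolding Z_def using true_idx_bounds[OF n] dim_inc_nonneg[OF n] by (intro sum_sq_weights_le_tail[OF w]) auto
      hence "\<sigma>\<^sup>2 * Z \<le> \<sigma>\<^sup>2 * overfit n ?w" by (intro mult_left_mono) auto
      also have "\<dots> \<le> sel_risk n \<omega> - \<sigma>\<^sup>2 * ?kT * (1 - \<rho> n)"
        using risk_up_to_true_lower[OF n w] unfolding risk_split[OF n] \<rho>_def by linarith
      finally have 1: "\<sigma>\<^sup>2 * Z \<le> sel_risk n \<omega> - \<sigma>\<^sup>2 * ?kT * (1 - \<rho> n)" .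
      have pos: "\<sigma>\<^sup>2 * ?kT > 0" using sigma_pos kT by simp
      have "\<sigma>\<^sup>2 * ?kT * (1 - \<rho> n) > 0" by (rule mult_pos_pos[OF pos]) (use elim in auto)
      hence I0: "opt_risk n > 0" using opt_risk_bounds(2)[OF n] unfolding \<rho>_def by linarith
      have "sel_risk n \<omega> = (sel_risk n \<omega> / opt_risk n) * opt_risk n" using I0 by simp
      also have "\<dots> \<le> (1 + \<epsilon> / 2) * opt_risk n"
      proof (intro mult_right_mono)
        have "\<bar>sel_risk n \<omega> / opt_risk n - 1\<bar> \<le> \<epsilon> / 2" using \<omega> unfolding B_def by fastforce
        thus "sel_risk n \<omega> / opt_risk n \<le> 1 + \<epsilon> / 2" by linarith
      qed (use I0 in simp)
      also have "\<dots> \<le> (1 + \<epsilon> / 2) * (\<sigma>\<^sup>2 * ?kT)"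
        using opt_risk_bounds(1)[OF n] \<epsilon> by (intro mult_left_mono) auto
      finally have "\<sigma>\<^sup>2 * Z \<le> (\<sigma>\<^sup>2 * ?kT) * (\<epsilon> / 2 + \<rho> n)" using 1 by (simp add: algebra_simps)
      also have "\<dots> \<le> (\<sigma>\<^sup>2 * ?kT) * \<epsilon>" using pos elim by (intro mult_left_mono) linarith+
      finally have "Z \<le> ?kT * \<epsilon>" using sigma_pos by (simp add: mult.assoc)
      hence "Z / ?kT \<le> \<epsilon>" using kT by (simp add: field_simps)
      thus ?thesis unfolding Zeq using Z0 kT by simp
    qed
    thus ?case using B elim by blast
  qed
qed

text \<open>The hypotheses are stated with \<open>n \<eta>\<^sup>2\<close>; one factor \<open>\<eta>\<close> is removed because \<open>\<eta>\<close> is bounded: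
  \<open>n \<kappa> \<eta> \<le> \<parallel>\<mu>\<parallel>\<^sup>2 = O(n)\<close>.\<close>

lemma noise_signal_tendsto:
  assumes "(\<lambda>n. a n * (real (k n (M0 n + 1)) - real (k n 1)) / (real n * (eta (\<beta> n) (k n) (M0 n))\<^sup>2)) \<longlonglongrightarrow> 0"
  shows "(\<lambda>n. a n * noise_signal n) \<longlonglongrightarrow> 0"
proof -
  obtain Cb where Cb: "Cb > 0" "eventually (\<lambda>n. norm (sq_norm2 (mu n) / real n) \<le> Cb * norm (1::real)) sequentially"
    using C1 unfolding bigo_def by auto
  have "eventually (\<lambda>n. norm (a n * noise_signal n)
      \<le> norm (a n * (real (k n (M0 n + 1)) - real (k n 1)) / (real n * (eta (\<beta> n) (k n) (M0 n))\<^sup>2)) * (Cb / \<kappa>)) sequentially"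
    using Cb(2) eventually_ge_at_top[of n0]
  proof eventually_elim
    case (elim n)
    note n = \<open>n0 \<le> n\<close>
    let ?e = "eta (\<beta> n) (k n) (M0 n)"
    interpret NP: nested_projections n "M n" "proj n" by (rule nested_proj[OF n])
    have T: "true_idx n \<le> M n" "M0 n \<le> M n" "true_idx n - 1 = M0 n" using true_idx_bounds[OF n] by auto
    have "real n * \<kappa> * ?e \<le> blk n (true_idx n) (mu n)" by (rule kappa(2)[OF n])
    also have "\<dots> \<le> quad (proj n (true_idx n)) (mu n)"
      using NP.quad_mono[of 0 "M0 n" "mu n"] NP.quad_0[of "mu n"] T by simp
    also have "\<dots> = sq_norm2 (mu n)" using proj_mean[OF n] by (simp add: quad_def sq_norm2_def)
    also have "\<dots> \<le> Cb * real n" using elim sample_size_pos[OF n] sq_norm2_nonneg[of "mu n"] by (simp add: field_simps)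
    finally have e: "?e \<le> Cb / \<kappa>" using sample_size_pos[OF n] kappa by (simp add: field_simps)
    have ep: "?e > 0" by (rule eta_pos[OF n])
    have "noise_signal n = (real (k n (M0 n + 1)) - real (k n 1)) / (real n * ?e\<^sup>2) * ?e"
      using ep by (simp add: noise_signal_def rk_def true_idx_def power2_eq_square)
    hence "norm (a n * noise_signal n) = norm (a n * (real (k n (M0 n + 1)) - real (k n 1)) / (real n * ?e\<^sup>2)) * ?e"
      using ep by (simp add: abs_mult)
    also have "\<dots> \<le> norm (a n * (real (k n (M0 n + 1)) - real (k n 1)) / (real n * ?e\<^sup>2)) * (Cb / \<kappa>)"
      using e by (intro mult_left_mono) auto
    finally show ?case .
  qed
  moreover have "(\<lambda>n. norm (a n * (real (k n (M0 n + 1)) - real (k n 1)) / (real n * (eta (\<beta> n) (k n) (M0 n))\<^sup>2)) * (Cb / \<kappa>)) \<longlonglongrightarrow> 0"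
    using tendsto_norm_zero[OF assms] by (rule tendsto_mult_left_zero)
  ultimately show ?thesis by (rule Lim_null_comparison)
qed

lemma risk_optimal_diverging_penalty:
  assumes phi: "filterlim \<phi> at_top sequentially"
    and r: "(\<lambda>n. (\<phi> n)\<^sup>2 * (real (k n (M0 n + 1)) - real (k n 1)) / (real n * (eta (\<beta> n) (k n) (M0 n))\<^sup>2)) \<longlonglongrightarrow> 0"
  shows "risk_optimal \<Omega> x \<beta> e M k w_hat"
proof -
  have r2: "(\<lambda>n. (\<phi> n)\<^sup>2 * noise_signal n) \<longlonglongrightarrow> 0" by (rule noise_signal_tendsto[OF r])
  have phi1: "eventually (\<lambda>n. \<phi> n \<ge> 1) sequentially" using phi by (simp add: filterlim_at_top)
  have r1: "noise_signal \<longlonglongrightarrow> 0"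
  proof (rule Lim_null_comparison[OF _ r2])
    show "eventually (\<lambda>n. norm (noise_signal n) \<le> (\<phi> n)\<^sup>2 * noise_signal n) sequentially"
      using phi1 eventually_ge_at_top[of n0]
    proof eventually_elim
      case (elim n)
      have "1 \<le> (\<phi> n)\<^sup>2" using elim by simp
      thus ?case using noise_signal_nonneg[OF elim(2)] mult_right_mono[of 1 "(\<phi> n)\<^sup>2" "noise_signal n"] by simp
    qed
  qed
  obtain c1 c2 where c: "0 < c1" "c1 < c2" and lim: "(\<lambda>n. prob {\<omega> \<in> space \<Omega>. c1 \<le> sig2 n \<omega> / \<sigma>\<^sup>2 \<and> sig2 n \<omega> / \<sigma>\<^sup>2 \<le> c2}) \<longlonglongrightarrow> 1"
    using C3 by blast
  define E1 where "E1 n = {\<omega> \<in> space \<Omega>. c1 \<le> sig2 n \<omega> / \<sigma>\<^sup>2 \<and> sig2 n \<omega> / \<sigma>\<^sup>2 \<le> c2}" for n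
  define a where "a n = \<phi> n * (c1 * \<sigma>\<^sup>2)" for n
  define S where "S n m \<omega> = quad (proj n m) (err n \<omega>) - quad (proj n (true_idx n)) (err n \<omega>)" for n m \<omega>
  define d where "d n m = k n m - k n (true_idx n)" for n m
  define B3 where "B3 n = (\<Union>m\<in>{Suc (true_idx n)..M n}. {\<omega> \<in> space \<Omega>. 2 * S n m \<omega> \<ge> a n * real (d n m)})" for n
  define C where "C = 2 * \<tau> + 4 * (\<sigma>\<^sup>2)\<^sup>2"
  have C: "C \<ge> 0" unfolding C_def by (intro add_nonneg_nonneg mult_nonneg_nonneg tau_nonneg) auto
  have a_lim: "filterlim a at_top sequentially"
    unfolding a_def using c sigma_pos by (intro filterlim_at_top_mult_tendsto_pos[OF tendsto_const _ phi]) auto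
  have d: "real (d n m) = rk n m - rk n (true_idx n)" "d n m \<ge> 1" if "n \<ge> n0" "m \<in> {Suc (true_idx n)..M n}" for n m
    using k_less[OF that(1), of "true_idx n" m] that true_idx_bounds[OF that(1)] by (auto simp: d_def rk_def of_nat_diff)
  have B3: "B3 n \<in> events" if n: "n \<ge> n0" for n
  proof -
    have "S n m \<in> borel_measurable \<Omega>" if "m \<in> {Suc (true_idx n)..M n}" for m
      using noise_block(1)[OF n, of "true_idx n" m] that by (simp add: S_def[abs_def])
    thus ?thesis unfolding B3_def by (intro sets.finite_UN) auto
  qed
  have PB3: "prob (B3 n) \<le> 128 * C / (a n)\<^sup>2" if n: "n \<ge> n0" and an: "a n > 0" "a n \<ge> 8 * \<sigma>\<^sup>2" for n
    unfolding B3_def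
  proof (rule monotone_process_maximal_inequality[where s = "\<sigma>\<^sup>2"])
    fix l m assume lm: "l \<in> {Suc (true_idx n)..M n}" "m \<in> {Suc (true_idx n)..M n}" "l \<le> m"
    fix \<omega> assume "\<omega> \<in> space \<Omega>"
    show "S n l \<omega> \<le> S n m \<omega>"
      using nested_projections.quad_mono[OF nested_proj[OF n], of l m "err n \<omega>"] lm by (simp add: S_def)
  next
    fix m assume m: "m \<in> {Suc (true_idx n)..M n}"
    show "S n m \<in> borel_measurable \<Omega>" "integrable \<Omega> (\<lambda>\<omega>. (S n m \<omega> - \<sigma>\<^sup>2 * real (d n m))\<^sup>2)"
      "expectation (\<lambda>\<omega>. (S n m \<omega> - \<sigma>\<^sup>2 * real (d n m))\<^sup>2) \<le> C * real (d n m)"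
      unfolding d(1)[OF n m] S_def[abs_def] C_def
      using noise_block(1,4,5)[OF n, of "true_idx n" m] m by auto
  qed (use d[OF n] an C in auto)
  have PB3lim: "(\<lambda>n. prob (B3 n)) \<longlonglongrightarrow> 0"
  proof (rule Lim_null_comparison)
    have "eventually (\<lambda>n. a n \<ge> 1 + 8 * \<sigma>\<^sup>2) sequentially" using a_lim by (simp add: filterlim_at_top)
    thus "eventually (\<lambda>n. norm (prob (B3 n)) \<le> 128 * C / (a n)\<^sup>2) sequentially"
      using eventually_ge_at_top[of n0]
    proof eventually_elim
      case (elim n)
      thus ?case using PB3[of n] sigma_pos by simp
    qed
    have "filterlim (\<lambda>n. (a n)\<^sup>2) at_top sequentially"
      by (rule filterlim_pow_at_top[OF _ a_lim]) simp
    thus "(\<lambda>n. 128 * C / (a n)\<^sup>2) \<longlonglongrightarrow> 0"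
      by (intro tendsto_divide_0[OF tendsto_const] filterlim_at_top_imp_at_infinity)
  qed
  define B where "B n = (space \<Omega> - E1 n) \<union> B3 n" for n
  have E1: "E1 n \<in> events" if n: "n \<ge> n0" for n
  proof -
    note [measurable] = sig2_measurable[OF n]
    show ?thesis unfolding E1_def by measurable
  qed
  show ?thesis
  proof (rule risk_optimalI[OF _ r1 r2])
    show "eventually (\<lambda>n. \<phi> n \<ge> 0) sequentially" using phi1 by eventually_elim simp
    show "(\<lambda>_. 0) \<longlonglongrightarrow> (0::real)" by simp
    show "eventually (\<lambda>n. B n \<in> events) sequentially"
      using eventually_ge_at_top[of n0] by eventually_elim (use E1 B3 in \<open>auto simp: B_def\<close>)
    show "(\<lambda>n. prob (B n)) \<longlonglongrightarrow> 0"
    proof (rule Lim_null_comparison)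
      show "eventually (\<lambda>n. norm (prob (B n)) \<le> (1 - prob (E1 n)) + prob (B3 n)) sequentially"
        using eventually_ge_at_top[of n0]
      proof eventually_elim
        case (elim n)
        have "prob (B n) \<le> prob (space \<Omega> - E1 n) + prob (B3 n)"
          unfolding B_def using E1[OF elim] B3[OF elim] by (intro measure_Un_le) auto
        thus ?case using prob_compl[OF E1[OF elim]] by simp
      qed
      have "(\<lambda>n. (1 - prob (E1 n)) + prob (B3 n)) \<longlonglongrightarrow> (1 - 1) + 0"
        by (intro tendsto_intros PB3lim lim[folded E1_def])
      thus "(\<lambda>n. (1 - prob (E1 n)) + prob (B3 n)) \<longlonglongrightarrow> 0" by simp
    qed
    show "eventually (\<lambda>n. \<forall>\<omega>\<in>space \<Omega> - B n. overfit n (w_hat n \<omega>) \<le> 0 * rk n (true_idx n)) sequentially"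
      using phi1 eventually_ge_at_top[of n0]
    proof eventually_elim
      case (elim n)
      note n = \<open>n0 \<le> n\<close>
      interpret NP: nested_projections n "M n" "proj n" by (rule nested_proj[OF n])
      show ?case
      proof
        fix \<omega> assume "\<omega> \<in> space \<Omega> - B n"
        hence \<omega>: "\<omega> \<in> space \<Omega>" "\<omega> \<in> E1 n" "\<omega> \<notin> B3 n" by (auto simp: B_def)
        have "c1 * \<sigma>\<^sup>2 \<le> sig2 n \<omega>" using \<omega>(2) sigma_pos by (auto simp: E1_def field_simps)
        hence an: "a n \<le> \<phi> n * sig2 n \<omega>" unfolding a_def using elim by (intro mult_left_mono) auto
        have "tail_weight (M n) (w_hat n \<omega>) l = 0" if l: "l \<in> {Suc (true_idx n)..M n}" for l
        proof (rule crit_min_no_overfit[where \<nu> = "\<phi> n * sig2 n \<omega>" and \<rho> = "rk n" and T = "true_idx n"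
              and q = "\<lambda>m. quad (proj n m) (resp n \<omega>)"])
          show "w_hat n \<omega> \<in> weights (M n)" by (rule w_hat_weights[OF n \<omega>(1)])
          show "1 \<le> true_idx n" "true_idx n \<le> M n" using true_idx_bounds[OF n] by auto
          show "quad (proj n (l - 1)) (resp n \<omega>) \<le> quad (proj n l) (resp n \<omega>)" if "l \<in> {1..M n}" for l
            using blk_nonneg[OF n that, of "resp n \<omega>"] by simp
          fix m assume m: "m \<in> {Suc (true_idx n)..M n}"
          have "\<not> 2 * S n m \<omega> \<ge> a n * real (d n m)" using \<omega>(1,3) m unfolding B3_def by blast
          hence "2 * S n m \<omega> < a n * real (d n m)" by simp
          also have "\<dots> \<le> \<phi> n * sig2 n \<omega> * real (d n m)" using an by (intro mult_right_mono) auto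
          finally have "2 * S n m \<omega> < \<phi> n * sig2 n \<omega> * (rk n m - rk n (true_idx n))" by (simp only: d(1)[OF n m])
          moreover have "quad (proj n m) (resp n \<omega>) - quad (proj n (true_idx n)) (resp n \<omega>) = S n m \<omega>"
            unfolding response_vec_def S_def using m proj_mean[OF n] by (intro NP.quad_diff_fixed) auto
          ultimately show "2 * (quad (proj n m) (resp n \<omega>) - quad (proj n (true_idx n)) (resp n \<omega>))
            < \<phi> n * sig2 n \<omega> * (rk n m - rk n (true_idx n))" by simp
        qed (use w_hat_crit_min[OF n \<omega>(1)] l in auto)
        thus "overfit n (w_hat n \<omega>) \<le> 0 * rk n (true_idx n)" by simp
      qed
    qed
  qed
qed

lemma risk_optimal_fixed_penalty:
  assumes phi: "\<forall>n. \<phi> n = 2"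
    and r: "(\<lambda>n. (real (k n (M0 n + 1)) - real (k n 1)) / (real n * (eta (\<beta> n) (k n) (M0 n))\<^sup>2)) \<longlonglongrightarrow> 0"
    and k: "(\<lambda>n. real (k n (M n)) / real (k n (M0 n + 1))) \<longlonglongrightarrow> 1"
  shows "risk_optimal \<Omega> x \<beta> e M k w_hat"
proof -
  have r1: "noise_signal \<longlonglongrightarrow> 0" using noise_signal_tendsto[of "\<lambda>_. 1"] r by simp
  have r2: "(\<lambda>n. (\<phi> n)\<^sup>2 * noise_signal n) \<longlonglongrightarrow> 0"
    using tendsto_mult_right_zero[OF r1, of 4] phi by simp
  show ?thesis
  proof (rule risk_optimalI[OF _ r1 r2, where B = "\<lambda>_. {}"])
    show "(\<lambda>n. real (k n (M n)) / real (k n (M0 n + 1)) - 1) \<longlonglongrightarrow> 0"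
      using tendsto_diff[OF k tendsto_const[of 1]] by simp
    show "eventually (\<lambda>n. \<forall>\<omega>\<in>space \<Omega> - {}. overfit n (w_hat n \<omega>)
        \<le> (real (k n (M n)) / real (k n (M0 n + 1)) - 1) * rk n (true_idx n)) sequentially"
      using eventually_ge_at_top[of n0]
    proof eventually_elim
      case (elim n)
      note n = \<open>n0 \<le> n\<close>
      show ?case
      proof
        fix \<omega> assume "\<omega> \<in> space \<Omega> - {}"
        hence w: "w_hat n \<omega> \<in> weights (M n)" using w_hat_weights[OF n] by simp
        have "overfit n (w_hat n \<omega>) \<le> (\<Sum>l = Suc (true_idx n)..M n. 1 * dim_inc n l)"
          using tail_seq_bounds[OF tail_seq_tail_weight[OF w]] dim_inc_nonneg[OF n]
          by (intro sum_mono mult_right_mono power_le_one) auto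
        also have "\<dots> = rk n (M n) - rk n (true_idx n)"
          using sum_telescope_range[of "true_idx n" "M n" "rk n"] true_idx_bounds[OF n] by simp
        also have "\<dots> = (real (k n (M n)) / real (k n (M0 n + 1)) - 1) * rk n (true_idx n)"
          using rk_true_idx_pos[OF n] true_idx_bounds[OF n] by (auto simp: rk_def true_idx_def field_simps split: if_splits)
        finally show "overfit n (w_hat n \<omega>) \<le> (real (k n (M n)) / real (k n (M0 n + 1)) - 1) * rk n (true_idx n)" .
      qed
    qed
  qed (use phi in auto)
qed

end
end

theorem theorem2:
  fixes \<Omega> :: "'a measure"
    and e :: "nat \<Rightarrow> 'a \<Rightarrow> real"
    and x :: "nat \<Rightarrow> nat \<Rightarrow> real"
    and \<beta> :: "nat \<Rightarrow> nat \<Rightarrow> real"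
    and M M0 :: "nat \<Rightarrow> nat"
    and k :: "nat \<Rightarrow> nat \<Rightarrow> nat"
    and \<phi> :: "nat \<Rightarrow> real"
    and w_hat :: "nat \<Rightarrow> 'a \<Rightarrow> nat \<Rightarrow> real"
    and \<sigma> \<zeta> :: real
    and n0 :: nat
  assumes "prob_space \<Omega>"
    and "prob_space.indep_vars \<Omega> (\<lambda>_. borel) e {1..}"
    and "\<And>i. i \<ge> 1 \<Longrightarrow> distr \<Omega> borel (e i) = distr \<Omega> borel (e 1)"
    and "\<And>i. i \<ge> 1 \<Longrightarrow> prob_space.expectation \<Omega> (e i) = 0"
    and "\<And>i. i \<ge> 1 \<Longrightarrow> prob_space.expectation \<Omega> (\<lambda>\<omega>. (e i \<omega>)\<^sup>2) = \<sigma>\<^sup>2"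
    and "\<sigma>\<^sup>2 > 0"
    and "\<zeta> > 0"
    and "\<And>i. i \<ge> 1 \<Longrightarrow> integrable \<Omega> (\<lambda>\<omega>. \<bar>e i \<omega>\<bar> powr (4 + \<zeta>))"
    and nested: "\<And>n. n \<ge> n0 \<Longrightarrow>
          0 < k n 1 \<and> strict_mono_on {1..M n} (k n) \<and> k n (M n) < n"
    and full_rank: "\<And>n m. n \<ge> n0 \<Longrightarrow> m \<in> {1..M n} \<Longrightarrow>
          vec_space.rank n (design x n (k n m)) = k n m"
    and true_index: "\<And>n. n \<ge> n0 \<Longrightarrow> M0 n \<ge> 1 \<and> M n > M0 n + 1"
    and true_model: "\<And>n. n \<ge> n0 \<Longrightarrow>
          (\<exists>j\<in>{1..k n (M0 n + 1)} - {1..k n (M0 n)}. \<beta> n j \<noteq> 0)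
          \<and> (\<forall>j>k n (M0 n + 1). \<beta> n j = 0)"
    and w_hat_rv: "\<And>n m. n \<ge> n0 \<Longrightarrow> m \<in> {1..M n} \<Longrightarrow>
          (\<lambda>\<omega>. w_hat n \<omega> m) \<in> borel_measurable \<Omega>"
    and w_hat_argmin: "\<And>n \<omega>. n \<ge> n0 \<Longrightarrow> \<omega> \<in> space \<Omega> \<Longrightarrow>
          is_arg_min (weight_crit x n (M n) (k n) (\<phi> n) (response_vec x (\<beta> n) e n \<omega>))
            (\<lambda>w. w \<in> weights (M n)) (w_hat n \<omega>)"
    and C1: "(\<lambda>n. sq_norm2 (mean_vec x (\<beta> n) n) / real n) \<in> O(\<lambda>_. 1)"
    and C2: "\<exists>\<kappa>0>0. \<forall>n\<ge>n0.
          lambda_min ((1 / real n) \<cdot>\<^sub>m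
            (transpose_mat (design x n (k n (M0 n + 1))) * design x n (k n (M0 n + 1)))) \<ge> \<kappa>0"
    and C3: "\<exists>c1 c2. 0 < c1 \<and> c1 < c2 \<and>
          (\<lambda>n. measure \<Omega> {\<omega> \<in> space \<Omega>.
              c1 \<le> sigma2_hat x n (k n (M n)) (response_vec x (\<beta> n) e n \<omega>) / \<sigma>\<^sup>2
              \<and> sigma2_hat x n (k n (M n)) (response_vec x (\<beta> n) e n \<omega>) / \<sigma>\<^sup>2 \<le> c2})
            \<longlonglongrightarrow> 1"
  shows
    "(filterlim \<phi> at_top sequentially \<longrightarrow>
      (\<lambda>n. (\<phi> n)\<^sup>2 * (real (k n (M0 n + 1)) - real (k n 1))
            / (real n * (eta (\<beta> n) (k n) (M0 n))\<^sup>2)) \<longlonglongrightarrow> 0 \<longrightarrow>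
      risk_optimal \<Omega> x \<beta> e M k w_hat)
   \<and> ((\<forall>n. \<phi> n = 2) \<longrightarrow>
      (\<lambda>n. (real (k n (M0 n + 1)) - real (k n 1))
            / (real n * (eta (\<beta> n) (k n) (M0 n))\<^sup>2)) \<longlonglongrightarrow> 0 \<longrightarrow>
      (\<not> converges_in_prob \<Omega>
          (\<lambda>n \<omega>. \<Sum>m\<in>{M0 n + 2..M n}.
             (w_hat n \<omega> m)\<^sup>2 * (real (k n m) / real (k n (M0 n + 1)) - 1)) 0 \<longrightarrow>
       \<not> risk_optimal \<Omega> x \<beta> e M k w_hat)
      \<and> (filterlim (\<lambda>n. k n (M0 n + 1)) at_top sequentially \<longrightarrow>
         (\<lambda>n. real (k n (M n)) / real (k n (M0 n + 1))) \<longlonglongrightarrow> 1 \<longrightarrow>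
         risk_optimal \<Omega> x \<beta> e M k w_hat))"
proof -
  interpret prob_space \<Omega> by fact
  interpret model_averaging \<Omega> e x \<beta> M M0 k \<phi> w_hat \<sigma> \<zeta> n0
    by unfold_locales (fact assms)+
  obtain \<kappa> where \<kappa>: "\<kappa> > 0"
      "\<And>n. n \<ge> n0 \<Longrightarrow> real n * \<kappa> * eta (\<beta> n) (k n) (M0 n) \<le> blk n (true_idx n) (mu n)"
    using signal_lower_bound by blast
  show ?thesis
  proof (intro conjI impI)
    assume phi: "filterlim \<phi> at_top sequentially"
      and r: "(\<lambda>n. (\<phi> n)\<^sup>2 * (real (k n (M0 n + 1)) - real (k n 1))
            / (real n * (eta (\<beta> n) (k n) (M0 n))\<^sup>2)) \<longlonglongrightarrow> 0"
    show "risk_optimal \<Omega> x \<beta> e M k w_hat"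
      by (rule risk_optimal_diverging_penalty[where \<kappa> = \<kappa>]) (fact \<kappa> phi r)+
  next
    assume r: "(\<lambda>n. (real (k n (M0 n + 1)) - real (k n 1))
            / (real n * (eta (\<beta> n) (k n) (M0 n))\<^sup>2)) \<longlonglongrightarrow> 0"
      and not_vanishing: "\<not> converges_in_prob \<Omega>
          (\<lambda>n \<omega>. \<Sum>m\<in>{M0 n + 2..M n}.
             (w_hat n \<omega> m)\<^sup>2 * (real (k n m) / real (k n (M0 n + 1)) - 1)) 0"
    have "(\<lambda>n. 1 * noise_signal n) \<longlonglongrightarrow> 0"
      by (rule noise_signal_tendsto[where \<kappa> = \<kappa>]) (use \<kappa> r in auto)
    hence ns: "noise_signal \<longlonglongrightarrow> 0" by simp
    show "\<not> risk_optimal \<Omega> x \<beta> e M k w_hat"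
    proof
      assume opt: "risk_optimal \<Omega> x \<beta> e M k w_hat"
      have "converges_in_prob \<Omega>
          (\<lambda>n \<omega>. \<Sum>m\<in>{M0 n + 2..M n}.
             (w_hat n \<omega> m)\<^sup>2 * (real (k n m) / real (k n (M0 n + 1)) - 1)) 0"
        by (rule overfit_vanishes[where \<kappa> = \<kappa>]) (fact \<kappa> opt ns)+
      thus False using not_vanishing by contradiction
    qed
  next
    assume phi: "\<forall>n. \<phi> n = 2"
      and r: "(\<lambda>n. (real (k n (M0 n + 1)) - real (k n 1))
            / (real n * (eta (\<beta> n) (k n) (M0 n))\<^sup>2)) \<longlonglongrightarrow> 0"
      and kM: "(\<lambda>n. real (k n (M n)) / real (k n (M0 n + 1))) \<longlonglongrightarrow> 1"
    show "risk_optimal \<Omega> x \<beta> e M k w_hat"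
      by (rule risk_optimal_fixed_penalty[where \<kappa> = \<kappa>]) (fact \<kappa> phi r kM)+
  qed
qed

end
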